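(* Let $n\ge1$ and let $K_n$ be the (invertible, skew-symmetric) Kasteleyn matrix of the graph $G_n$. Suppose $(x_1,x_2)=(i_1,i_1+2i_2+\epsilon_i)$ and $(y_1,y_2)=(j_1,j_1+2j_2+\epsilon_j)$ with $0\le i_1,j_1\le 2n-1$, $\epsilon_i,\epsilon_j\in\{0,1\}$, $0\le i_2\le n-\lfloor (i_1+\epsilon_i)/2\rfloor$ and $0\le j_2\le n-\lfloor (j_1+\epsilon_j)/2\rfloor$. (1) If $\epsilon_i=\epsilon_j=1$, then $$K_n^{-1}((x_1,x_2),(y_1,y_2))=\sum_{\ell_1=0}^{i_1}\sum_{\ell_2=0}^{j_1}(-1)^{i_2+j_2}(-1)^{\ell_1+\ell_2}\binom{i_2-1+\ell_1}{\ell_1}\binom{j_2-1+\ell_2}{\ell_2}\,t_n^{1,1}(i_1-\ell_1,j_1-\ell_2).$$ (2) If $\epsilon_i=\epsilon_j=0$, then $$K_n^{-1}((x_1,x_2),(y_1,y_2))=\sum_{\ell_1=0}^{i_2}\sum_{\ell_2=0}^{j_2}(-1)^{i_2+j_2}\binom{i_2}{\ell_1}\binom{j_2}{\ell_2}\,t_n^{0,0}(i_1+\ell_1,j_1+\ell_2).$$ (3) If $\epsilon_i=1$ and $\epsilon_j=0$, then $$K_n^{-1}((x_1,x_2),(y_1,y_2))=\sum_{\ell_1=0}^{i_1}\sum_{\ell_2=0}^{j_2}(-1)^{i_2+j_2}(-1)^{\ell_1}\binom{i_2-1+\ell_1}{\ell_1}\binom{j_2}{\ell_2}\,t_n^{1,0}(i_1-\ell_1,j_1+\ell_2)$$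 $$\qquad-(-1)^{i_2+j_2}\,\mathbbm 1_{x_1\ge y_1}\,\mathbbm 1_{x_1+x_2<y_1+y_2}\binom{j_2-i_2-1}{i_1-j_1}.$$
   Context: Notation: $[x]_2\in\{0,1\}$ is $x \bmod 2$; $\mathbbm{1}$ denotes an indicator; $\mathrm{i}=\sqrt{-1}$. Binomials: $\binom{a}{l}=a(a-1)\cdots(a-l+1)/l!$ for integers $a$ and $l\ge 0$ (so $\binom{-1}{0}=1$, $\binom{l-1}{l}=0$ for $l\ge1$), and $\binom{a}{-1}=0$. Graph: $G_n=(\mathtt V_n,\mathtt E_n)$, where $\mathtt V_n=\{(x_1,x_2)\in\mathbb Z^2: 0\le x_1\le 2n,\ x_1\le x_2\le 2n+1\}$, with the vertex $(2n,2n+1)$ removed when $n$ is odd, and $\mathtt E_n$ consists of - the edges $\{(x_1,x_2),(x_1+1,x_2)\}$ with $0\le x_1\le 2n-1$, $x_1\le x_2\le 2n+1$, $[x_1+x_2]_2=1$; - the edges $\{(x_1,x_2),(x_1,x_2+1)\}$ with $0\le x_1\le 2n-[n]_2$, $x_1\le x_2\le 2n$; - the edges $\{(x_1,x_1),(x_1+1,x_1+1)\}$ with $0\le x_1\le 2n-1$. Kasteleyn matrix: $K_n=(K_n(x,y))_{x,y\in\mathtt V_n}$ with $K_n(x,y)=k_n(x,y)-k_n(y,x)$, where $k_n((x_1,x_2),(y_1,y_2))=1$ if [$[x_1+x_2]_2=0$, $x_2=y_2$, $x_1-y_1=1$], or [$[x_1+x_2]_2=0$, $|y_2-x_2|=1$,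 $x_1=y_1$], or [$x_1=x_2$ and $y_1=y_2=x_1-1$], and $k_n=0$ otherwise. $|\mathrm{Pf}\,K_n|$ is the number of perfect matchings of $G_n$, which is nonzero. With $C_m=\frac1{m+1}\binom{2m}{m}$ the Catalan numbers, set $$p(n,k,\ell)=\frac{(n+k-2\ell+1)!\,(2n-k-\ell+1)!}{(k-\ell)!\,(3n-k+2-2\ell)!}(-1)^k(3n-3k+2)\,C_{n-k}.$$ Let $\Gamma_0$ be a positively oriented circle around the origin of radius less than $1$. For $0\le i,j\le 2n$, $$h_n^{0,\mathbf b}(i)=-[i+1]_2+\sum_{k=0}^n p(n,k,0)\frac1{2\pi \mathrm i}\int_{\Gamma_0}\mathrm dr\,\frac{(1+r)^{n-k}}{(1-r)\,r^{i-2k}},$$ $$h_n^{1,\mathbf b}(i)=\sum_{k=0}^n p(n,k,0)\frac1{2\pi \mathrm i}\int_{\Gamma_0}\mathrm dr\,\frac{(1+r)^{n-k}}{r^{i-2k+1}},$$ $$t_n^{0,0}(i,j)=\mathbbm 1_{i<j}[i+1]_2[j]_2-\mathbbm 1_{i>j}[i]_2[j+1]_2+[j+1]_2h_n^{0,\mathbf b}(i)-[i+1]_2h_n^{0,\mathbf b}(j)$$ $$+\sum_{k_1=0}^n\sum_{\ell_1=0}^{k_1}\sum_{k_2=0}^n\sum_{\ell_2=0}^{k_2}p(n,k_1,\ell_1)p(n,k_2,\ell_2)\frac1{(2\pi \mathrm i)^4}\int_{\Gamma_0}\mathrm dr_1\int_{\Gamma_0}\mathrm dr_2\int_{\Gamma_0}\mathrm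 ds_1\int_{\Gamma_0}\mathrm ds_2\,\frac{(1+r_1)^{n-k_1}(1+r_2)^{n-k_2}}{(1-r_1)r_1^{i-2k_1}(1-r_2)r_2^{j-2k_2}}\,\frac{s_1-s_2}{(s_1s_2-1)s_1^{\ell_1+1}s_2^{\ell_2+1}},$$ $$t_n^{1,0}(i,j)=[j+1]_2h_n^{1,\mathbf b}(i)$$ $$+\sum_{k_1=0}^n\sum_{\ell_1=0}^{k_1}\sum_{k_2=0}^n\sum_{\ell_2=0}^{k_2}p(n,k_1,\ell_1)p(n,k_2,\ell_2)\frac1{(2\pi \mathrm i)^4}\int_{\Gamma_0}\mathrm dr_1\int_{\Gamma_0}\mathrm dr_2\int_{\Gamma_0}\mathrm ds_1\int_{\Gamma_0}\mathrm ds_2\,\frac{(1+r_1)^{n-k_1}(1+r_2)^{n-k_2}}{r_1^{i-2k_1+1}(1-r_2)r_2^{j-2k_2}}\,\frac{s_1-s_2}{(s_1s_2-1)s_1^{\ell_1+1}s_2^{\ell_2+1}},$$ $$t_n^{1,1}(i,j)=\sum_{k_1=0}^n\sum_{\ell_1=0}^{k_1}\sum_{k_2=0}^n\sum_{\ell_2=0}^{k_2}p(n,k_1,\ell_1)p(n,k_2,\ell_2)\frac1{(2\pi \mathrm i)^4}\int_{\Gamma_0}\mathrm dr_1\int_{\Gamma_0}\mathrm dr_2\int_{\Gamma_0}\mathrm ds_1\int_{\Gamma_0}\mathrm ds_2\,\frac{(1+r_1)^{n-k_1}(1+r_2)^{n-k_2}}{r_1^{i-2k_1+1}r_2^{j-2k_2+1}}\,\frac{s_1-s_2}{(s_1s_2-1)s_1^{\ell_1+1}s_2^{\ell_2+1}}.$$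 *)

theory Defs
  imports "HOL-Complex_Analysis.Complex_Analysis"
begin

definition is_inverse_on :: "'a set \<Rightarrow> ('a \<Rightarrow> 'a \<Rightarrow> complex) \<Rightarrow> ('a \<Rightarrow> 'a \<Rightarrow> complex) \<Rightarrow> bool" where
  "is_inverse_on V A B \<longleftrightarrow>
     (\<forall>x\<in>V. \<forall>y\<in>V. (\<Sum>z\<in>V. A x z * B z y) = of_bool (x = y)) \<and>
     (\<forall>x\<in>V. \<forall>y\<in>V. (\<Sum>z\<in>V. B x z * A z y) = of_bool (x = y))"

text \<open>As for \<^const>\<open>matrix_inv\<close>, the value is meaningful only if an inverse exists; by
  \<open>is_inverse_on_unique\<close> its entries with both indices in \<open>V\<close> are then uniquely determined.\<close>

definition matrix_inv_on :: "'a set \<Rightarrow> ('a \<Rightarrow> 'a \<Rightarrow> complex) \<Rightarrow> 'a \<Rightarrow> 'a \<Rightarrow> complex" where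
  "matrix_inv_on V A = (SOME B. is_inverse_on V A B)"

lemma is_inverse_on_unique:
  assumes "finite V" "is_inverse_on V A B" "is_inverse_on V A C" "x \<in> V" "y \<in> V"
  shows "B x y = C x y"
proof -
  have "B x y = (\<Sum>z\<in>V. B x z * of_bool (z = y))"
    using assms by (simp add: of_bool_def if_distrib cong: if_cong)
  also have "\<dots> = (\<Sum>z\<in>V. B x z * (\<Sum>w\<in>V. A z w * C w y))"
    using assms by (intro sum.cong) (auto simp: is_inverse_on_def)
  also have "\<dots> = (\<Sum>z\<in>V. \<Sum>w\<in>V. B x z * A z w * C w y)"
    by (simp add: sum_distrib_left mult.assoc)
  also have "\<dots> = (\<Sum>w\<in>V. \<Sum>z\<in>V. B x z * A z w * C w y)"
    by (rule sum.swap)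
  also have "\<dots> = (\<Sum>w\<in>V. (\<Sum>z\<in>V. B x z * A z w) * C w y)"
    by (simp add: sum_distrib_right)
  also have "\<dots> = (\<Sum>w\<in>V. of_bool (x = w) * C w y)"
    using assms by (intro sum.cong) (auto simp: is_inverse_on_def)
  also have "\<dots> = (\<Sum>w\<in>V. if x = w then C w y else 0)"
    by (intro sum.cong) auto
  also have "\<dots> = C x y"
    using assms by simp
  finally show ?thesis .
qed

definition G_verts :: "nat \<Rightarrow> (int \<times> int) set" where
  "G_verts n =
     {(x1, x2). 0 \<le> x1 \<and> x1 \<le> 2 * int n \<and> x1 \<le> x2 \<and> x2 \<le> 2 * int n + 1}
       - (if odd n then {(2 * int n, 2 * int n + 1)} else {})"

definition G_edges :: "nat \<Rightarrow> (int \<times> int) set set" where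
  "G_edges n =
     {{(x1, x2), (x1 + 1, x2)} | x1 x2.
        0 \<le> x1 \<and> x1 \<le> 2 * int n - 1 \<and> x1 \<le> x2 \<and> x2 \<le> 2 * int n + 1 \<and> (x1 + x2) mod 2 = 1} \<union>
     {{(x1, x2), (x1, x2 + 1)} | x1 x2.
        0 \<le> x1 \<and> x1 \<le> 2 * int n - int n mod 2 \<and> x1 \<le> x2 \<and> x2 \<le> 2 * int n} \<union>
     {{(x1, x1), (x1 + 1, x1 + 1)} | x1. 0 \<le> x1 \<and> x1 \<le> 2 * int n - 1}"

definition kasteleyn_orient :: "int \<times> int \<Rightarrow> int \<times> int \<Rightarrow> complex" where
  "kasteleyn_orient = (\<lambda>(x1, x2) (y1, y2). of_bool
     ((x1 + x2) mod 2 = 0 \<and> x2 = y2 \<and> x1 - y1 = 1 \<or>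
      (x1 + x2) mod 2 = 0 \<and> \<bar>y2 - x2\<bar> = 1 \<and> x1 = y1 \<or>
      x1 = x2 \<and> y1 = x1 - 1 \<and> y2 = x1 - 1))"

text \<open>Only the entries with both indices in \<^term>\<open>G_verts n\<close> form the Kasteleyn matrix of the
  graph; the formula for them does not involve \<open>n\<close>.\<close>

definition kasteleyn :: "int \<times> int \<Rightarrow> int \<times> int \<Rightarrow> complex" where
  "kasteleyn x y = kasteleyn_orient x y - kasteleyn_orient y x"

definition kasteleyn_inv :: "nat \<Rightarrow> int \<times> int \<Rightarrow> int \<times> int \<Rightarrow> complex" where
  "kasteleyn_inv n = matrix_inv_on (G_verts n) kasteleyn"

lemma finite_G_verts: "finite (G_verts n)"
  by (rule finite_subset[of _ "{0..2 * int n} \<times> {0..2 * int n + 1}"]) (auto simp: G_verts_def)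

lemma kasteleyn_skew: "kasteleyn y x = - kasteleyn x y"
  by (simp add: kasteleyn_def)

lemma kasteleyn_nonzero_iff_edge:
  assumes "x \<in> G_verts n" "y \<in> G_verts n"
  shows "kasteleyn x y \<noteq> 0 \<longleftrightarrow> {x, y} \<in> G_edges n"
proof -
  obtain x1 x2 where x: "x = (x1, x2)" by (cases x)
  obtain y1 y2 where y: "y = (y1, y2)" by (cases y)
  let ?P = "\<lambda>x1 x2 y1 y2 :: int. (x1 + x2) mod 2 = 0 \<and> x2 = y2 \<and> x1 - y1 = 1 \<or>
      (x1 + x2) mod 2 = 0 \<and> \<bar>y2 - x2\<bar> = 1 \<and> x1 = y1 \<or>
      x1 = x2 \<and> y1 = x1 - 1 \<and> y2 = x1 - 1"
  let ?E = "\<lambda>x1 x2 y1 y2 :: int.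
      y1 = x1 + 1 \<and> y2 = x2 \<and> 0 \<le> x1 \<and> x1 \<le> 2 * int n - 1 \<and> x1 \<le> x2 \<and> x2 \<le> 2 * int n + 1 \<and>
        (x1 + x2) mod 2 = 1 \<or>
      y1 = x1 \<and> y2 = x2 + 1 \<and> 0 \<le> x1 \<and> x1 \<le> 2 * int n - int n mod 2 \<and> x1 \<le> x2 \<and> x2 \<le> 2 * int n \<or>
      x2 = x1 \<and> y1 = x1 + 1 \<and> y2 = x1 + 1 \<and> 0 \<le> x1 \<and> x1 \<le> 2 * int n - 1"
  have V: "0 \<le> x1 \<and> x1 \<le> 2 * int n \<and> x1 \<le> x2 \<and> x2 \<le> 2 * int n + 1"
          "0 \<le> y1 \<and> y1 \<le> 2 * int n \<and> y1 \<le> y2 \<and> y2 \<le> 2 * int n + 1"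
          "int n mod 2 = 1 \<Longrightarrow> x1 = 2 * int n \<Longrightarrow> x2 \<noteq> 2 * int n + 1"
          "int n mod 2 = 1 \<Longrightarrow> y1 = 2 * int n \<Longrightarrow> y2 \<noteq> 2 * int n + 1"
    using assms unfolding x y G_verts_def by (auto split: if_splits simp: odd_iff_mod_2_eq_one zmod_int[symmetric])
  have ex: "\<not> (?P x1 x2 y1 y2 \<and> ?P y1 y2 x1 x2)" by presburger
  have gen: "(of_bool p - of_bool q :: complex) \<noteq> 0 \<longleftrightarrow> p \<or> q" if "\<not> (p \<and> q)" for p q
    using that by auto
  have k: "kasteleyn x y \<noteq> 0 \<longleftrightarrow> ?P x1 x2 y1 y2 \<or> ?P y1 y2 x1 x2"
    unfolding kasteleyn_def kasteleyn_orient_def x y prod.case by (rule gen[OF ex])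
  have e: "{x, y} \<in> G_edges n \<longleftrightarrow> ?E x1 x2 y1 y2 \<or> ?E y1 y2 x1 x2"
    unfolding G_edges_def x y by (auto simp: doubleton_eq_iff)
  have pn: "int n mod 2 = 0 \<or> int n mod 2 = 1" by presburger
  have c0: "(x1 + x2) mod 2 = 0 \<or> (x1 + x2) mod 2 = 1" by presburger
  have c1: "(x1 + (x2 + 1)) mod 2 = 0 \<longleftrightarrow> (x1 + x2) mod 2 = 1"
    and c3: "(x1 + (x2 - 1)) mod 2 = 0 \<longleftrightarrow> (x1 + x2) mod 2 = 1"
    and c4: "(x1 - 1 + x2) mod 2 = 1 \<longleftrightarrow> (x1 + x2) mod 2 = 0"
    by presburger+
  have "?P x1 x2 y1 y2 \<or> ?P y1 y2 x1 x2 \<longleftrightarrow> ?E x1 x2 y1 y2 \<or> ?E y1 y2 x1 x2"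
  proof (cases "y1 = x1")
    case True
    have P: "?P x1 x2 y1 y2 \<or> ?P y1 y2 x1 x2 \<longleftrightarrow> y2 = x2 + 1 \<or> y2 = x2 - 1"
      using True c1 c3 c0 by auto
    have l: "x1 = 2 * int n \<or> x1 \<le> 2 * int n - 1" using V by linarith
    have E: "?E x1 x2 y1 y2 \<or> ?E y1 y2 x1 x2 \<longleftrightarrow> y2 = x2 + 1 \<or> y2 = x2 - 1"
      using l pn V True by (elim disjE) auto
    show ?thesis using P E by simp
  next
    case F1: False
    show ?thesis
    proof (cases "y2 = x2")
      case True
      let ?Q = "y1 = x1 + 1 \<and> (x1 + x2) mod 2 = 1 \<or> y1 = x1 - 1 \<and> (x1 + x2) mod 2 = 0"
      have P: "?P x1 x2 y1 y2 \<or> ?P y1 y2 x1 x2 \<longleftrightarrow> ?Q" using True F1 by presburger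
      have E: "?E x1 x2 y1 y2 \<or> ?E y1 y2 x1 x2 \<longleftrightarrow> ?Q"
      proof -
        consider "y1 = x1 + 1" | "y1 = x1 - 1" | "y1 \<noteq> x1 + 1" "y1 \<noteq> x1 - 1" by blast
        then show ?thesis
        proof cases
          case 1
          then show ?thesis using V(1,2) True by simp
        next
          case 2
          then show ?thesis using V(1,2) True c4 by simp
        next
          case 3
          then have "x1 \<noteq> y1 + 1" by linarith
          then show ?thesis using 3 F1 by simp
        qed
      qed
      show ?thesis using P E by simp
    next
      case F2: False
      have a: "y1 \<noteq> x1" "x1 \<noteq> y1" "y2 \<noteq> x2" "x2 \<noteq> y2" using F1 F2 by auto
      have "(x1 = x2 \<and> y1 = x1 - 1 \<and> y2 = x1 - 1 \<or> y1 = y2 \<and> x1 = y1 - 1 \<and> x2 = y1 - 1) \<longleftrightarrow>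
            (x2 = x1 \<and> y1 = x1 + 1 \<and> y2 = x1 + 1 \<and> 0 \<le> x1 \<and> x1 \<le> 2 * int n - 1 \<or>
             y2 = y1 \<and> x1 = y1 + 1 \<and> x2 = y1 + 1 \<and> 0 \<le> y1 \<and> y1 \<le> 2 * int n - 1)"
        using V(1,2) by linarith
      then show ?thesis by (simp only: a simp_thms)
    qed
  qed
  then show ?thesis using k e by simp
qed

definition catalan :: "nat \<Rightarrow> complex" where
  "catalan m = of_nat ((2 * m) choose m) / of_nat (m + 1)"

text \<open>Used only for \<open>l \<le> k \<le> n\<close>, where no natural-number subtraction truncates.\<close>

definition p_coeff :: "nat \<Rightarrow> nat \<Rightarrow> nat \<Rightarrow> complex" where
  "p_coeff n k l =
     fact (n + k + 1 - 2 * l) * fact (2 * n + 1 - k - l) / (fact (k - l) * fact (3 * n + 2 - k - 2 * l))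
       * (- 1) ^ k * of_nat (3 * n + 2 - 3 * k) * catalan (n - k)"

text \<open>\<open>[i]\<^sub>2\<close>\<close>

definition par :: "nat \<Rightarrow> complex" where
  "par i = of_nat (i mod 2)"

text \<open>The parameter \<open>\<rho>\<close> is the radius of the contour around the origin, and \<open>0 < \<rho> < 1\<close> is intended.\<close>

definition h0 :: "real \<Rightarrow> nat \<Rightarrow> nat \<Rightarrow> complex" where
  "h0 \<rho> n i = - par (i + 1) +
     (\<Sum>k\<le>n. p_coeff n k 0 * (1 / (2 * of_real pi * \<i>) *
        contour_integral (circlepath 0 \<rho>)
          (\<lambda>r. (1 + r) ^ (n - k) / ((1 - r) * r powi (int i - 2 * int k)))))"

definition h1 :: "real \<Rightarrow> nat \<Rightarrow> nat \<Rightarrow> complex" where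
  "h1 \<rho> n i =
     (\<Sum>k\<le>n. p_coeff n k 0 * (1 / (2 * of_real pi * \<i>) *
        contour_integral (circlepath 0 \<rho>)
          (\<lambda>r. (1 + r) ^ (n - k) / r powi (int i - 2 * int k + 1))))"

definition t00 :: "real \<Rightarrow> nat \<Rightarrow> nat \<Rightarrow> nat \<Rightarrow> complex" where
  "t00 \<rho> n i j =
     of_bool (i < j) * par (i + 1) * par j - of_bool (i > j) * par i * par (j + 1)
     + par (j + 1) * h0 \<rho> n i - par (i + 1) * h0 \<rho> n j
     + (\<Sum>k1\<le>n. \<Sum>l1\<le>k1. \<Sum>k2\<le>n. \<Sum>l2\<le>k2. p_coeff n k1 l1 * p_coeff n k2 l2 *
         (1 / (2 * of_real pi * \<i>) ^ 4 *
           contour_integral (circlepath 0 \<rho>) (\<lambda>r1.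
           contour_integral (circlepath 0 \<rho>) (\<lambda>r2.
           contour_integral (circlepath 0 \<rho>) (\<lambda>s1.
           contour_integral (circlepath 0 \<rho>) (\<lambda>s2.
             ((1 + r1) ^ (n - k1) * (1 + r2) ^ (n - k2))
             / ((1 - r1) * r1 powi (int i - 2 * int k1) * (1 - r2) * r2 powi (int j - 2 * int k2))
             * ((s1 - s2) / ((s1 * s2 - 1) * s1 ^ (l1 + 1) * s2 ^ (l2 + 1)))))))))"

definition t10 :: "real \<Rightarrow> nat \<Rightarrow> nat \<Rightarrow> nat \<Rightarrow> complex" where
  "t10 \<rho> n i j =
     par (j + 1) * h1 \<rho> n i
     + (\<Sum>k1\<le>n. \<Sum>l1\<le>k1. \<Sum>k2\<le>n. \<Sum>l2\<le>k2. p_coeff n k1 l1 * p_coeff n k2 l2 *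
         (1 / (2 * of_real pi * \<i>) ^ 4 *
           contour_integral (circlepath 0 \<rho>) (\<lambda>r1.
           contour_integral (circlepath 0 \<rho>) (\<lambda>r2.
           contour_integral (circlepath 0 \<rho>) (\<lambda>s1.
           contour_integral (circlepath 0 \<rho>) (\<lambda>s2.
             ((1 + r1) ^ (n - k1) * (1 + r2) ^ (n - k2))
             / (r1 powi (int i - 2 * int k1 + 1) * (1 - r2) * r2 powi (int j - 2 * int k2))
             * ((s1 - s2) / ((s1 * s2 - 1) * s1 ^ (l1 + 1) * s2 ^ (l2 + 1)))))))))"

definition t11 :: "real \<Rightarrow> nat \<Rightarrow> nat \<Rightarrow> nat \<Rightarrow> complex" where
  "t11 \<rho> n i j =
     (\<Sum>k1\<le>n. \<Sum>l1\<le>k1. \<Sum>k2\<le>n. \<Sum>l2\<le>k2. p_coeff n k1 l1 * p_coeff n k2 l2 *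
         (1 / (2 * of_real pi * \<i>) ^ 4 *
           contour_integral (circlepath 0 \<rho>) (\<lambda>r1.
           contour_integral (circlepath 0 \<rho>) (\<lambda>r2.
           contour_integral (circlepath 0 \<rho>) (\<lambda>s1.
           contour_integral (circlepath 0 \<rho>) (\<lambda>s2.
             ((1 + r1) ^ (n - k1) * (1 + r2) ^ (n - k2))
             / (r1 powi (int i - 2 * int k1 + 1) * r2 powi (int j - 2 * int k2 + 1))
             * ((s1 - s2) / ((s1 * s2 - 1) * s1 ^ (l1 + 1) * s2 ^ (l2 + 1)))))))))"

end

theory Submission
  imports Defs
begin

text \<open>The graph is a triangular piece of a lattice, and the proof reads the columns of \<open>K\<inverse>\<close> as
solutions of a linear recurrence with boundary conditions. Call a vertex \<open>(x\<^sub>1, x\<^sub>2)\<close> even or odd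
according to \<open>x\<^sub>1 + x\<^sub>2\<close>. Off the diagonal, a row of \<open>K v = \<delta>\<close> at an odd vertex is a three-term
relation between even values, and conversely. Hence the values of a column at the vertices \<open>(i, i)\<close>
and \<open>(i, i + 1)\<close> determine all its other values, and solving the relations upwards gives the
binomial sums \<open>ext_even\<close> and \<open>ext_odd\<close> of the theorem; the term outside the double sum in the mixed
case (\<open>source_term\<close>) is what \<open>\<delta>\<close> itself contributes. What remains are the rows on the diagonal and
the requirement that the continuation past the upper and the right side of the graph vanishes.

The sequences \<open>odd_basis n k\<close>, \<open>k \<le> n\<close>, with generating functions \<open>z\<^sup>2\<^sup>k (1 + z)\<^sup>n\<^sup>-\<^sup>k\<close>, satisfy all
upper boundary conditions for odd vertices, and together with \<open>even_basis n k\<close>, their partial sums,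
they solve the diagonal rows. Up to signs, the upper boundary conditions for even vertices, applied
to these partial sums, form the matrix \<open>W = boundary_matrix n\<close>, whose entries are partial row sums
of Pascal's triangle. With \<open>u\<^sub>k = 2\<^sup>n\<^sup>-\<^sup>k\<close> one has \<open>W + W\<^sup>T = 2 u u\<^sup>T\<close>, so \<open>Q = W - u u\<^sup>T\<close>
(\<open>centred_boundary n\<close>) is skew. Once the contour integrals are evaluated as coefficients, the main
part of the functions \<open>t\<^sub>n\<close> is bilinear in the basis sequences with the skew matrix \<open>M = P A P\<^sup>T\<close>
(\<open>core_matrix n\<close>). Here \<open>P\<close> is the lower triangular matrix of the \<open>p(n, k, \<ell>)\<close> (\<open>p_matrix n\<close>), and
\<open>A\<close> (\<open>pairing\<close>) is skew and tridiagonal. Writing \<open>p\<close> for the first column of \<open>P\<close>, the boundary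
conditions reduce to \<open>W M = u p\<^sup>T - I\<close> (lemma \<open>boundary_matrix_core_matrix\<close>).

This in turn follows from the single vector identity \<open>W p = u\<close> (lemma \<open>boundary_matrix_p_coeff\<close>).
Since \<open>p(n, k, \<ell>) = (-1)\<^sup>\<ell> p(n - \<ell>, k - \<ell>, 0)\<close> and \<open>W\<close> is invariant under the same shift, the
identity for \<open>n - \<ell>\<close> evaluates column \<open>\<ell>\<close> of \<open>Q P\<close> from row \<open>\<ell>\<close> on. So \<open>P\<^sup>T Q P\<close> is known on and
below its diagonal, by skewness everywhere, and turns out to be a matrix of zeros and signs that is
inverse to \<open>A\<close> up to sign and a rank one term.

The identity \<open>W p = u\<close> is hypergeometric. Twice a row of \<open>W\<close> minus the preceding row has entries
that are single products of factorials, and the corresponding sums vanish by a recurrence found by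
creative telescoping; the last row amounts to the evaluation of \<open>\<Sum>\<^sub>k 2\<^sup>n\<^sup>-\<^sup>k p\<^sub>k\<close>, which satisfies a
recurrence of order two in \<open>n\<close>.

Finally, the formulas of the theorem make sense on all of the vertex set. They define a skew matrix
\<open>C\<close> with \<open>K C = I\<close>; transposing gives \<open>C K = I\<close>, and inverses are unique.\<close>

section \<open>Vanishing of the sums that compare neighbouring boundary conditions\<close>

text \<open>The function \<open>rGamma\<close> serves as a reciprocal factorial that vanishes at negative integers. The
natural boundaries of the hypergeometric sums below then need no case distinctions, and contiguous
terms are polynomial multiples of each other.\<close>

lemma rGamma_step: "rGamma (z :: complex) = z * rGamma (z + 1)"
  by (simp add: rGamma_plus1)

lemma rGamma_of_nat_plus_1: "rGamma (of_nat m + 1 :: complex) = 1 / fact m"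
  using rGamma_inverse_Gamma[of "of_nat m + 1 :: complex"] Gamma_fact[of m, where 'a = complex]
  by (simp add: add.commute inverse_eq_divide)

text \<open>With \<open>d = n - m\<close> and \<open>j = n - k\<close>, this is, up to factors independent of \<open>j\<close>, the coefficient
\<open>p(n, k, 0)\<close> times the \<open>k\<close>-th entry of \<open>2 W\<^sub>m\<^sub>+\<^sub>1 - W\<^sub>m\<close>, where \<open>W\<^sub>m\<close> denotes row \<open>m\<close> of the
boundary matrix.\<close>

definition row_term :: "nat \<Rightarrow> nat \<Rightarrow> nat \<Rightarrow> complex" where
  "row_term n d j = (- 1) ^ j * (fact (n + 1 + j) * fact (2 * n + 1 - j) / fact (2 * n + 2 + j))
     * rGamma (of_nat n - of_nat j + 1)
     * (of_nat (3 * j + 2) * fact (2 * j) / (fact j * fact (j + 1))) * fact (j + d)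
     * rGamma (2 * of_nat j + 2 - of_nat d) * rGamma (2 * of_nat d - of_nat j + 1)"

text \<open>The antidifference for the first-order recurrence in \<open>d\<close> that Zeilberger's algorithm finds for
the sums of \<open>row_term\<close>.\<close>

definition row_certificate :: "nat \<Rightarrow> nat \<Rightarrow> nat \<Rightarrow> complex" where
  "row_certificate n d j = - 3 * of_nat (d + 1) * (- 1) ^ j
     * (fact (n + 1 + j) * fact (2 * n + 2 - j) / fact (2 * n + 1 + j))
     * rGamma (of_nat n - of_nat j + 1) * (fact (2 * j) / fact j ^ 2) * fact (j + d)
     * rGamma (2 * of_nat j - of_nat d) * rGamma (2 * of_nat d + 3 - of_nat j)"

text \<open>Every factor is a polynomial multiple of one common product of factorials and \<open>rGamma\<close> values,
so the claim is a polynomial identity in \<open>n\<close>, \<open>d\<close> and \<open>j\<close>.\<close>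

lemma row_term_telescope:
  fixes n d j :: nat
  assumes "j \<le> n"
  defines "x \<equiv> of_nat (n + 1) :: complex" and "e \<equiv> of_nat (d + 1) :: complex"
  shows "of_nat d * (4 * x ^ 2 - e ^ 2) * row_term n d j
       + 2 * of_nat (2 * d + 3) * (x ^ 2 - e ^ 2) * row_term n (d + 1) j
     = row_certificate n d (j + 1) - row_certificate n d j"
proof -
  define a where "a = rGamma (of_nat n - of_nat j + 1 :: complex)"
  define b where "b = rGamma (2 * of_nat j + 2 - of_nat d :: complex)"
  define c where "c = rGamma (2 * of_nat d + 3 - of_nat j :: complex)"
  have a1: "rGamma (of_nat n - of_nat j :: complex) = (of_nat n - of_nat j) * a"
    unfolding a_def using rGamma_step[of "of_nat n - of_nat j"] by simp
  have b1: "rGamma (2 * of_nat j + 1 - of_nat d :: complex) = (2 * of_nat j + 1 - of_nat d) * b"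
    unfolding b_def using rGamma_step[of "2 * of_nat j + 1 - of_nat d"] by (simp add: algebra_simps)
  have b2: "rGamma (2 * of_nat j - of_nat d :: complex)
     = (2 * of_nat j - of_nat d) * ((2 * of_nat j + 1 - of_nat d) * b)"
    unfolding b1[symmetric] using rGamma_step[of "2 * of_nat j - of_nat d"] by (simp add: algebra_simps)
  have c1: "rGamma (2 * of_nat d + 2 - of_nat j :: complex) = (2 * of_nat d + 2 - of_nat j) * c"
    unfolding c_def using rGamma_step[of "2 * of_nat d + 2 - of_nat j"] by (simp add: algebra_simps)
  have c2: "rGamma (2 * of_nat d - of_nat j + 1 :: complex)
     = (2 * of_nat d + 1 - of_nat j) * ((2 * of_nat d + 2 - of_nat j) * c)"
    unfolding c1[symmetric] using rGamma_step[of "2 * of_nat d + 1 - of_nat j"] by (simp add: algebra_simps)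
  define u where "u = fact (n + 1 + j) * fact (2 * n + 1 - j) / (fact (2 * n + 2 + j) :: complex)"
  define k where "k = fact (2 * j) / (fact j * fact (j + 1) :: complex)"
  define f where "f = (fact (j + d) :: complex)"
  define s where "s = ((- 1) ^ j :: complex)"
  have T0: "row_term n d j = s * u * a * (of_nat (3 * j + 2) * k) * f * b
      * ((2 * of_nat d + 1 - of_nat j) * ((2 * of_nat d + 2 - of_nat j) * c))"
    by (simp add: row_term_def s_def u_def a_def k_def f_def b_def c2 del: of_nat_add of_nat_mult)
  have T1: "row_term n (d + 1) j = s * u * a * (of_nat (3 * j + 2) * k) * (of_nat (j + d + 1) * f)
      * ((2 * of_nat j + 1 - of_nat d) * b) * c"
  proof -
    have "rGamma (2 * of_nat j + 2 - of_nat (d + 1)) = (2 * of_nat j + 1 - of_nat d) * b"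
      unfolding b1[symmetric] by (simp add: algebra_simps)
    moreover have "rGamma (2 * of_nat (d + 1) - of_nat j + 1) = c"
      unfolding c_def by (simp add: algebra_simps)
    moreover have "fact (j + (d + 1)) = of_nat (j + d + 1) * f"
      by (simp add: f_def)
    ultimately show ?thesis
      by (simp add: row_term_def s_def u_def a_def k_def del: of_nat_add of_nat_mult of_nat_Suc)
  qed
  have G0: "row_certificate n d j = - 3 * of_nat (d + 1) * s
     * (of_nat (2 * n + 2 + j) * (2 * of_nat n + 2 - of_nat j) * u)
     * a * (of_nat (j + 1) * k) * f
     * ((2 * of_nat j - of_nat d) * ((2 * of_nat j + 1 - of_nat d) * b)) * c"
  proof -
    have "fact (2 * n + 2 - j) = (2 * of_nat n + 2 - of_nat j) * (fact (2 * n + 1 - j) :: complex)"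
      using assms(1) fact_reduce[of "2 * n + 2 - j", where 'a = complex] by (simp add: of_nat_diff)
    moreover have "fact (2 * n + 2 + j) = of_nat (2 * n + 2 + j) * (fact (2 * n + 1 + j) :: complex)"
      using fact_Suc[of "2 * n + 1 + j", where 'a = complex] by simp
    moreover have "fact (j + 1) = of_nat (j + 1) * (fact j :: complex)" by simp
    moreover have "of_nat (2 * n + 2 + j) \<noteq> (0 :: complex)" "of_nat (j + 1) \<noteq> (0 :: complex)"
      by (metis of_nat_eq_0_iff add_is_0 zero_neq_numeral, metis of_nat_eq_0_iff add_is_0 zero_neq_one)
    ultimately show ?thesis
      unfolding row_certificate_def u_def k_def s_def[symmetric] f_def[symmetric] a_def[symmetric] b2
          c_def[symmetric]
      by (simp add: power2_eq_square del: of_nat_add of_nat_mult of_nat_Suc fact_Suc)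
  qed
  have G1: "row_certificate n d (j + 1) = 3 * of_nat (d + 1) * s
     * (of_nat (n + 2 + j) * u)
     * ((of_nat n - of_nat j) * a) * (2 * of_nat (2 * j + 1) * k) * (of_nat (j + d + 1) * f)
     * b * ((2 * of_nat d + 2 - of_nat j) * c)"
  proof -
    have "fact (n + 1 + (j + 1)) = of_nat (n + 2 + j) * (fact (n + 1 + j) :: complex)"
      using fact_Suc[of "n + 1 + j", where 'a = complex] by simp
    moreover have "2 * n + 2 - (j + 1) = 2 * n + 1 - j" "2 * n + 1 + (j + 1) = 2 * n + 2 + j" by auto
    moreover have "rGamma (of_nat n - of_nat (j + 1) + 1) = (of_nat n - of_nat j) * a"
      unfolding a1[symmetric] by simp
    moreover have "fact (2 * (j + 1)) / fact (j + 1) ^ 2 = 2 * of_nat (2 * j + 1) * k"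
    proof -
      have n0: "of_nat (j + 1) \<noteq> (0 :: complex)" by (metis of_nat_eq_0_iff add_is_0 zero_neq_one)
      have "fact (2 * (j + 1)) = of_nat (2 * j + 2) * (of_nat (2 * j + 1) * (fact (2 * j) :: complex))"
        using fact_Suc[of "2 * j + 1", where 'a = complex] fact_Suc[of "2 * j", where 'a = complex] by simp
      moreover have "fact (j + 1) = of_nat (j + 1) * (fact j :: complex)" by simp
      moreover have "of_nat (2 * j + 2) = 2 * (of_nat (j + 1) :: complex)" by simp
      ultimately show ?thesis using n0
        by (simp add: k_def power2_eq_square del: of_nat_add of_nat_mult of_nat_Suc fact_Suc)
    qed
    moreover have "fact (j + 1 + d) = of_nat (j + d + 1) * f" by (simp add: f_def add.commute add.left_commute)
    moreover have "rGamma (2 * of_nat (j + 1) - of_nat d) = b" unfolding b_def by (simp add: algebra_simps)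
    moreover have "rGamma (2 * of_nat d + 3 - of_nat (j + 1)) = (2 * of_nat d + 2 - of_nat j) * c"
      unfolding c1[symmetric] by (simp add: algebra_simps)
    ultimately show ?thesis
      unfolding row_certificate_def by (simp add: u_def s_def del: of_nat_add of_nat_mult of_nat_Suc fact_Suc)
  qed
  show ?thesis
    unfolding T0 T1 G0 G1 x_def e_def of_nat_add of_nat_mult of_nat_numeral of_nat_1
    by algebra
qed

text \<open>The certificate vanishes at both ends of the summation range, so the recurrence is
homogeneous. At \<open>d = 0\<close> the coefficient of the first sum is zero, which starts the induction; up to
\<open>d = n\<close> the coefficient of the second sum does not vanish.\<close>

lemma row_term_sum_eq_0:
  assumes "1 \<le> d" "d \<le> n"
  shows "(\<Sum>j\<le>n. row_term n d j) = 0"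
proof -
  have rec: "of_nat d * (4 * of_nat (n + 1) ^ 2 - of_nat (d + 1) ^ 2) * (\<Sum>j\<le>n. row_term n d j)
       + 2 * of_nat (2 * d + 3) * (of_nat (n + 1) ^ 2 - of_nat (d + 1) ^ 2) * (\<Sum>j\<le>n. row_term n (d + 1) j) = 0"
    (is "?a * _ + ?b * _ = 0") for d
  proof -
    have "?a * (\<Sum>j\<le>n. row_term n d j) + ?b * (\<Sum>j\<le>n. row_term n (d + 1) j)
        = (\<Sum>j\<le>n. ?a * row_term n d j + ?b * row_term n (d + 1) j)"
      by (simp only: sum_distrib_left sum.distrib)
    also have "\<dots> = (\<Sum>j\<le>n. row_certificate n d (j + 1) - row_certificate n d j)"
      by (intro sum.cong refl row_term_telescope) simp
    also have "\<dots> = row_certificate n d (n + 1) - row_certificate n d 0"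
      using sum_lessThan_telescope[of "row_certificate n d" "Suc n"]
      by (simp add: lessThan_Suc_atMost)
    also have "row_certificate n d (n + 1) = 0"
      by (simp add: row_certificate_def)
    also have "row_certificate n d 0 = 0"
      by (simp add: row_certificate_def)
    finally show ?thesis by simp
  qed
  have nz: "(of_nat (n + 1) ^ 2 - of_nat (e + 1) ^ 2 :: complex) \<noteq> 0" if "e < n" for e
  proof
    assume "(of_nat (n + 1) ^ 2 - of_nat (e + 1) ^ 2 :: complex) = 0"
    then have "of_nat ((n + 1) ^ 2) = (of_nat ((e + 1) ^ 2) :: complex)"
      by (simp only: of_nat_power right_minus_eq)
    then have "(n + 1) ^ 2 = (e + 1) ^ 2" by (simp only: of_nat_eq_iff)
    then have "n + 1 = e + 1" by (metis power2_eq_iff_nonneg zero_le)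
    with that show False by simp
  qed
  have nz2: "2 * of_nat (2 * e + 3) \<noteq> (0 :: complex)" for e
    by (metis of_nat_eq_0_iff add_is_0 zero_neq_numeral mult_eq_0_iff)
  have "d \<le> n \<longrightarrow> (\<Sum>j\<le>n. row_term n d j) = 0"
    using assms(1)
  proof (induction d rule: dec_induct)
    case base
    show ?case
    proof
      assume "1 \<le> n"
      then show "(\<Sum>j\<le>n. row_term n 1 j) = 0"
        using rec[of 0] nz[of 0] by simp
    qed
  next
    case (step d)
    show ?case
    proof
      assume "Suc d \<le> n"
      then show "(\<Sum>j\<le>n. row_term n (Suc d) j) = 0"
        using rec[of d] nz[of d] nz2[of d] step by simp
    qed
  qed
  with assms show ?thesis by simp
qed

section \<open>The weighted sum of the coefficients\<close>

text \<open>The summand \<open>2\<^sup>j p(n, n - j, 0)\<close> for \<open>x = n + 1\<close>, up to the sign \<open>(-1)\<^sup>n\<close>.\<close>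

definition weight_term :: "nat \<Rightarrow> nat \<Rightarrow> complex" where
  "weight_term x j = (- 2) ^ j * (of_nat (3 * j + 2) * (fact (2 * j) / (fact j * fact (j + 1))))
     * (fact (x + j) * fact (2 * x - 1 - j) / fact (2 * x + j)) * rGamma (of_nat x - of_nat j)"

text \<open>The antidifference for the second-order recurrence in \<open>x\<close> satisfied by the sums of
\<open>weight_term\<close>.\<close>

definition weight_certificate :: "nat \<Rightarrow> nat \<Rightarrow> complex" where
  "weight_certificate x j = (let y = of_nat x; i = of_nat j in
     2 * (y + 1) * (2 * y + 3) * ((4 * y ^ 2 - 5 * y - 2) * i ^ 2
       + (4 * y ^ 3 + 11 * y ^ 2 + 5 * y + 1) * i - (y + 1) ^ 2 * (2 * y + 1) * (4 * y - 1))
     * (- 2) ^ j * of_nat (2 * x + j) * (fact (x + j) * fact (2 * x - j) / fact (2 * x + j + 3))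
     * (fact (2 * j) / fact j ^ 2) * rGamma (y + 2 - i))"

text \<open>Only \<open>j \<le> x + 1\<close> matters, since all three summands vanish beyond; for \<open>x \<ge> 2\<close> the subtraction
in \<open>fact (2 * x - 1 - j)\<close> is then not truncated.\<close>

lemma weight_term_telescope:
  fixes x j :: nat
  assumes "2 \<le> x" "j \<le> x + 1"
  defines "y \<equiv> of_nat x :: complex"
  shows "(y - 1) * (4 * y + 1) * (2 * y + 3) * weight_term x j
       + 2 * y * (4 * y - 1) * (y + 1) * weight_term (x + 1) j + (9 * y + 3) * weight_term (x + 2) j
     = weight_certificate x (j + 1) - weight_certificate x j"
proof -
  define i where "i = (of_nat j :: complex)"
  define b where "b = rGamma (y + 2 - i)"
  have b1: "rGamma (y + 1 - i) = (y + 1 - i) * b"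
    unfolding b_def using rGamma_step[of "y + 1 - i"] by (simp add: algebra_simps)
  have b2: "rGamma (y - i) = (y - i) * ((y + 1 - i) * b)"
    unfolding b1[symmetric] using rGamma_step[of "y - i"] by (simp add: algebra_simps)
  define u where "u = fact (x + j) * fact (2 * x - 1 - j) / (fact (2 * x + j + 4) :: complex)"
  define k where "k = fact (2 * j) / (fact j * fact (j + 1) :: complex)"
  define s where "s = ((- 2) ^ j :: complex)"
  have f1: "fact (2 * x + 1 - j) = (2 * y + 1 - i) * ((2 * y - i) * (fact (2 * x - 1 - j) :: complex))"
   and f2: "fact (2 * x - j) = (2 * y - i) * (fact (2 * x - 1 - j) :: complex)"
   and f3: "fact (2 * x + 3 - j) = (2 * y + 3 - i) * ((2 * y + 2 - i) * ((2 * y + 1 - i)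
       * ((2 * y - i) * (fact (2 * x - 1 - j) :: complex))))"
  proof -
    have 1: "Suc (2 * x - 1 - j) = 2 * x - j" "Suc (2 * x - j) = 2 * x + 1 - j"
      "Suc (2 * x + 1 - j) = 2 * x + 2 - j" "Suc (2 * x + 2 - j) = 2 * x + 3 - j" using assms by auto
    have 2: "of_nat (2 * x - j) = 2 * y - i" "of_nat (2 * x + 1 - j) = 2 * y + 1 - i"
      "of_nat (2 * x + 2 - j) = 2 * y + 2 - i" "of_nat (2 * x + 3 - j) = 2 * y + 3 - i"
      using assms by (simp_all add: y_def i_def of_nat_diff)
    show f2: "fact (2 * x - j) = (2 * y - i) * (fact (2 * x - 1 - j) :: complex)"
      using fact_Suc[of "2 * x - 1 - j", where 'a = complex] unfolding 1 2 .
    show f1: "fact (2 * x + 1 - j) = (2 * y + 1 - i) * ((2 * y - i) * (fact (2 * x - 1 - j) :: complex))"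
      using fact_Suc[of "2 * x - j", where 'a = complex] unfolding 1 2 f2 .
    have f4: "fact (2 * x + 2 - j) = (2 * y + 2 - i) * ((2 * y + 1 - i)
       * ((2 * y - i) * (fact (2 * x - 1 - j) :: complex)))"
      using fact_Suc[of "2 * x + 1 - j", where 'a = complex] unfolding 1 2 f1 .
    show "fact (2 * x + 3 - j) = (2 * y + 3 - i) * ((2 * y + 2 - i) * ((2 * y + 1 - i)
       * ((2 * y - i) * (fact (2 * x - 1 - j) :: complex))))"
      using fact_Suc[of "2 * x + 2 - j", where 'a = complex] unfolding 1 2 f4 .
  qed
  have g: "fact (2 * x + j + Suc m) = (2 * y + i + of_nat (Suc m)) * (fact (2 * x + j + m) :: complex)" for m
    using fact_Suc[of "2 * x + j + m", where 'a = complex] by (simp add: y_def i_def algebra_simps)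
  have nz: "2 * y + i + of_nat (Suc m) \<noteq> 0" for m
  proof -
    have "2 * y + i + of_nat (Suc m) = of_nat (2 * x + j + Suc m)" by (simp add: y_def i_def)
    then show ?thesis by (metis of_nat_eq_0_iff add_Suc_right nat.distinct(1))
  qed
  have g3: "fact (2 * x + j + 4) = (2 * y + i + 4) * (fact (2 * x + j + 3) :: complex)"
   and g2: "fact (2 * x + j + 3) = (2 * y + i + 3) * (fact (2 * x + j + 2) :: complex)"
   and g1: "fact (2 * x + j + 2) = (2 * y + i + 2) * (fact (2 * x + j + 1) :: complex)"
   and g0: "fact (2 * x + j + 1) = (2 * y + i + 1) * (fact (2 * x + j) :: complex)"
    using g[of 3] g[of 2] g[of 1] g[of 0] by (simp_all add: eval_nat_numeral)
  have z: "2 * y + i + 4 \<noteq> 0" "2 * y + i + 3 \<noteq> 0" "2 * y + i + 2 \<noteq> 0" "2 * y + i + 1 \<noteq> 0"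
    using nz[of 3] nz[of 2] nz[of 1] nz[of 0] by (simp_all add: algebra_simps)
  have h: "fact (x + 1 + j) = (y + i + 1) * (fact (x + j) :: complex)"
    "fact (x + 2 + j) = (y + i + 2) * ((y + i + 1) * (fact (x + j) :: complex))"
    by (simp_all add: y_def i_def algebra_simps)
  have T0: "weight_term x j = s * (of_nat (3 * j + 2) * k)
     * ((2 * y + i + 1) * (2 * y + i + 2) * (2 * y + i + 3) * (2 * y + i + 4) * u) * ((y - i) * ((y + 1 - i) * b))"
    unfolding weight_term_def s_def[symmetric] k_def[symmetric] u_def b2[symmetric] g3 g2 g1 g0
    using z by (simp add: y_def i_def del: of_nat_add of_nat_mult of_nat_Suc fact_Suc)
  have T1: "weight_term (x + 1) j = s * (of_nat (3 * j + 2) * k)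
     * ((y + i + 1) * (2 * y + 1 - i) * (2 * y - i) * (2 * y + i + 3) * (2 * y + i + 4) * u) * ((y + 1 - i) * b)"
  proof -
    have 1: "2 * (x + 1) - 1 - j = 2 * x + 1 - j" "2 * (x + 1) + j = 2 * x + j + 2" by auto
    have 2: "rGamma (of_nat (x + 1) - of_nat j) = rGamma (y + 1 - i)" by (simp add: y_def i_def add.commute)
    show ?thesis
      unfolding weight_term_def 1 2 b1 s_def[symmetric] k_def[symmetric] h(1) f1 u_def g3 g2
      using z by (simp del: of_nat_add of_nat_mult of_nat_Suc fact_Suc)
  qed
  have T2: "weight_term (x + 2) j = s * (of_nat (3 * j + 2) * k)
     * ((y + i + 2) * (y + i + 1) * (2 * y + 3 - i) * (2 * y + 2 - i) * (2 * y + 1 - i) * (2 * y - i) * u) * b"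
  proof -
    have 1: "2 * (x + 2) - 1 - j = 2 * x + 3 - j" "2 * (x + 2) + j = 2 * x + j + 4" by auto
    have 2: "rGamma (of_nat (x + 2) - of_nat j) = b" by (simp add: b_def y_def i_def add.commute)
    show ?thesis
      unfolding weight_term_def 1 2 s_def[symmetric] k_def[symmetric] h(2) f3 u_def
      by (simp del: of_nat_add of_nat_mult of_nat_Suc fact_Suc)
  qed
  have n0: "of_nat (j + 1) \<noteq> (0 :: complex)" by (metis of_nat_eq_0_iff add_is_0 zero_neq_one)
  have G0: "weight_certificate x j = 2 * (y + 1) * (2 * y + 3) * ((4 * y ^ 2 - 5 * y - 2) * i ^ 2
       + (4 * y ^ 3 + 11 * y ^ 2 + 5 * y + 1) * i - (y + 1) ^ 2 * (2 * y + 1) * (4 * y - 1))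
     * s * (2 * y + i) * ((2 * y - i) * (2 * y + i + 4) * u) * (of_nat (j + 1) * k) * b"
  proof -
    have "fact (j + 1) = of_nat (j + 1) * (fact j :: complex)" by simp
    moreover have "of_nat (2 * x + j) = 2 * y + i" by (simp add: y_def i_def)
    ultimately show ?thesis
      unfolding weight_certificate_def Let_def s_def[symmetric] u_def k_def y_def[symmetric] i_def[symmetric]
          b_def[symmetric] g3
      using n0 z by (simp add: f2 power2_eq_square del: of_nat_add of_nat_mult of_nat_Suc fact_Suc)
  qed
  have G1: "weight_certificate x (j + 1) = 2 * (y + 1) * (2 * y + 3) * ((4 * y ^ 2 - 5 * y - 2) * (i + 1) ^ 2
       + (4 * y ^ 3 + 11 * y ^ 2 + 5 * y + 1) * (i + 1) - (y + 1) ^ 2 * (2 * y + 1) * (4 * y - 1))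
     * (- 2 * s) * (2 * y + i + 1) * ((y + i + 1) * u) * (2 * of_nat (2 * j + 1) * k) * ((y + 1 - i) * b)"
  proof -
    have 1: "2 * x - (j + 1) = 2 * x - 1 - j" "2 * x + (j + 1) + 3 = 2 * x + j + 4" "x + (j + 1) = x + 1 + j"
        by auto
    have 2: "fact (2 * (j + 1)) / fact (j + 1) ^ 2 = 2 * of_nat (2 * j + 1) * k"
    proof -
      have "fact (2 * (j + 1)) = of_nat (2 * j + 2) * (of_nat (2 * j + 1) * (fact (2 * j) :: complex))"
        using fact_Suc[of "2 * j + 1", where 'a = complex] fact_Suc[of "2 * j", where 'a = complex] by simp
      moreover have "fact (j + 1) = of_nat (j + 1) * (fact j :: complex)" by simp
      moreover have "of_nat (2 * j + 2) = 2 * (of_nat (j + 1) :: complex)" by simp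
      ultimately show ?thesis using n0
        by (simp add: k_def power2_eq_square del: of_nat_add of_nat_mult of_nat_Suc fact_Suc)
    qed
    have 3: "of_nat (2 * x + (j + 1)) = 2 * y + i + 1" "of_nat (j + 1) = i + 1" by (simp_all add: y_def i_def)
    have 4: "rGamma (y + 2 - (i + 1)) = (y + 1 - i) * b" unfolding b1[symmetric] by (simp add: algebra_simps)
    have 5: "(- 2) ^ (j + 1) = - 2 * s" by (simp add: s_def)
    show ?thesis
      unfolding weight_certificate_def Let_def 1 2 3 4 5 y_def[symmetric] h(1) u_def
      by (simp del: of_nat_add of_nat_mult of_nat_Suc fact_Suc)
  qed
  show ?thesis
    unfolding T0 T1 T2 G0 G1 of_nat_add of_nat_mult of_nat_numeral of_nat_1 i_def[symmetric]
    by algebra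
qed

lemma weight_term_eq_0: "j \<ge> x \<Longrightarrow> weight_term x j = 0"
proof -
  assume "j \<ge> x"
  then have "of_nat x - of_nat j = (- of_nat (j - x) :: complex)" by (simp add: of_nat_diff)
  then show "weight_term x j = 0" by (simp add: weight_term_def del: of_nat_diff)
qed

text \<open>Here the certificate does not vanish at \<open>j = 0\<close>; the right-hand side is minus its value there.\<close>

lemma weight_term_sum_rec:
  assumes "2 \<le> x"
  defines "y \<equiv> of_nat x :: complex"
  shows "(y - 1) * (4 * y + 1) * (2 * y + 3) * (\<Sum>j<x. weight_term x j)
       + 2 * y * (4 * y - 1) * (y + 1) * (\<Sum>j<x + 1. weight_term (x + 1) j)
       + (9 * y + 3) * (\<Sum>j<x + 2. weight_term (x + 2) j)
     = 2 * y * (4 * y - 1) * (y + 1)"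
proof -
  have ext: "(\<Sum>j<z. weight_term z j) = (\<Sum>j<x + 2. weight_term z j)" if "z \<le> x + 2" for z
    using that by (intro sum.mono_neutral_left) (auto intro: weight_term_eq_0)
  let ?a = "(y - 1) * (4 * y + 1) * (2 * y + 3)" and ?b = "2 * y * (4 * y - 1) * (y + 1)" and ?c = "9 * y + 3"
  have "?a * (\<Sum>j<x. weight_term x j) + ?b * (\<Sum>j<x + 1. weight_term (x + 1) j) + ?c *
      (\<Sum>j<x + 2. weight_term (x + 2) j)
      = (\<Sum>j<x + 2. ?a * weight_term x j + ?b * weight_term (x + 1) j + ?c * weight_term (x + 2) j)"
    by (subst ext, simp, subst ext[of "x + 1"], simp) (simp only: sum_distrib_left sum.distrib)
  also have "\<dots> = (\<Sum>j<x + 2. weight_certificate x (Suc j) - weight_certificate x j)"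
  proof (intro sum.cong refl)
    fix j assume "j \<in> {..<x + 2}"
    then show "?a * weight_term x j + ?b * weight_term (x + 1) j + ?c * weight_term (x + 2) j
        = weight_certificate x (Suc j) - weight_certificate x j"
      using weight_term_telescope[OF assms(1), of j] by (simp add: y_def)
  qed
  also have "\<dots> = weight_certificate x (x + 2) - weight_certificate x 0"
    by (rule sum_lessThan_telescope)
  also have "weight_certificate x (x + 2) = 0" by (simp add: weight_certificate_def)
  also have "0 - weight_certificate x 0 = ?b"
  proof -
    have f: "fact (2 * x + 3) = (2 * y + 3) * ((2 * y + 2) * ((2 * y + 1) * (fact (2 * x) :: complex)))"
      by (simp add: y_def eval_nat_numeral algebra_simps)
    have r: "rGamma (y + 2) = 1 / ((y + 1) * fact x)"
      using rGamma_of_nat_plus_1[of "x + 1"] by (simp add: y_def add.commute)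
    have nz: "2 * y + 3 \<noteq> 0" "2 * y + 2 \<noteq> 0" "2 * y + 1 \<noteq> 0" "y + 1 \<noteq> 0"
      using of_nat_eq_0_iff[of "2 * x + 3", where 'a = complex] of_nat_eq_0_iff[of "2 * x + 2", where 'a = complex]
        of_nat_eq_0_iff[of "2 * x + 1", where 'a = complex] of_nat_eq_0_iff[of "x + 1", where 'a = complex]
      by (simp_all add: y_def add.commute)
    have "weight_certificate x 0 = 2 * (y + 1) * (2 * y + 3) * (- ((y + 1) ^ 2 * (2 * y + 1) * (4 * y - 1)))
        * (2 * y) * (1 / ((2 * y + 3) * ((2 * y + 2) * (2 * y + 1)))) * (1 / (y + 1))"
      unfolding weight_certificate_def Let_def using r f by (simp add: y_def)
    also have "\<dots> = - ?b"
      using nz by (simp add: divide_simps) algebra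
    finally show ?thesis by simp
  qed
  finally show ?thesis by simp
qed

text \<open>The coefficients in \<open>weight_term_sum_rec\<close> satisfy \<open>a + c = b\<close>, and the right-hand side is \<open>b\<close>.
Hence the recurrence preserves the alternation of the values one and zero.\<close>

lemma weight_term_sum:
  assumes "1 \<le> x"
  shows "(\<Sum>j<x. weight_term x j) = of_bool (odd x)"
proof -
  have r: "rGamma 1 = (1 :: complex)" "rGamma 2 = (1 :: complex)"
    using rGamma_of_nat_plus_1[of 0] rGamma_of_nat_plus_1[of 1] by simp_all
  have r3: "rGamma 3 = (1 / 2 :: complex)"
  proof -
    have "of_nat 2 + 1 = (3 :: complex)" "fact 2 = (2 :: complex)" by simp_all
    with rGamma_of_nat_plus_1[of 2] show ?thesis by (simp only:)
  qed
  have "(\<Sum>j<x. weight_term x j) = of_bool (odd x) \<and> (\<Sum>j<x + 1. weight_term (x + 1) j) = of_bool (even x)"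
    if "2 \<le> x"
    using that
  proof (induction x rule: dec_induct)
    case base
    show ?case
      by (simp add: weight_term_def eval_nat_numeral fact_reduce r r3)
  next
    case (step x)
    define y where "y = (of_nat x :: complex)"
    have nz: "9 * y + 3 \<noteq> 0"
      using of_nat_eq_0_iff[of "9 * x + 3", where 'a = complex] by (simp add: y_def)
    have "(9 * y + 3) * ((\<Sum>j<x + 2. weight_term (x + 2) j) - of_bool (odd x)) = 0"
      using weight_term_sum_rec[OF step(1)]
          unfolding y_def[symmetric] step(3)[THEN conjunct1] step(3)[THEN conjunct2]
      by (cases "even x") (simp_all add: algebra_simps power2_eq_square)
    then show ?case using nz step(3) by simp
  qed
  moreover have ?thesis if "\<not> 2 \<le> x"
  proof -
    have "x = 1" using that assms by simp
    then show ?thesis using r by (simp add: weight_term_def eval_nat_numeral)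
  qed
  ultimately show ?thesis by blast
qed

section \<open>The boundary matrix and the coefficient vector\<close>

text \<open>Up to sign, the value of the \<open>k\<close>-th even basis sequence when continued to \<open>(2 m, 2 n + 2)\<close>,
the first even point above the graph on the line \<open>x\<^sub>1 = 2 m\<close>; see \<open>ext_even_basis_top\<close>. Truncated
subtraction is intended: the sum is empty if \<open>2 k > n + m\<close>.\<close>

definition boundary_matrix :: "nat \<Rightarrow> nat \<Rightarrow> nat \<Rightarrow> complex" where
  "boundary_matrix n m k = (\<Sum>a<n + m + 1 - 2 * k. of_nat ((2 * n + 1 - k - m) choose a))"

lemma binomial_partial_sum_double:
  "2 * (\<Sum>a<Suc L. of_nat (M choose a)) - (\<Sum>a<L. of_nat (Suc M choose a))
     = (of_nat (Suc M choose L) + of_nat (M choose L) :: 'a :: comm_ring_1)"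
proof (induction L)
  case (Suc L)
  then show ?case by (simp add: algebra_simps)
qed simp

text \<open>By Pascal's rule the partial sums cancel except for two binomial coefficients, whose sum is a
single product. The factor \<open>3 d + 1\<close> does not depend on the column.\<close>

lemma boundary_matrix_double:
  assumes "k \<le> n" "m < n"
  defines "j \<equiv> n - k" and "d \<equiv> n - m"
  shows "2 * boundary_matrix n (m + 1) k - boundary_matrix n m k
     = of_nat (3 * d + 1) * (fact (j + d) * rGamma (2 * of_nat j + 2 - of_nat d) * rGamma
         (2 * of_nat d - of_nat j + 1))"
proof (cases "2 * k \<le> n + m + 1")
  case False
  then have "2 * of_nat j + 2 - of_nat d = (- of_nat (2 * k - (n + m + 2)) :: complex)"
    using assms by (simp add: of_nat_diff)
  then show ?thesis using False by (simp add: boundary_matrix_def del: of_nat_diff)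
next
  case True
  define L where "L = n + m + 1 - 2 * k"
  define M where "M = 2 * n - k - m"
  have rows: "boundary_matrix n (m + 1) k = (\<Sum>a<Suc L. of_nat (M choose a))" "boundary_matrix n m k =
      (\<Sum>a<L. of_nat (Suc M choose a))"
    using True assms by (auto simp: boundary_matrix_def L_def M_def Suc_diff_le intro!: arg_cong2[where f = sum])
  have j: "j + d = M" using assms by (simp add: M_def)
  have r1: "rGamma (2 * of_nat j + 2 - of_nat d :: complex) = 1 / fact L"
  proof -
    have "2 * of_nat j + 2 - of_nat d = (of_nat L + 1 :: complex)"
      using assms True by (simp add: L_def of_nat_diff)
    then show ?thesis by (simp only: rGamma_of_nat_plus_1)
  qed
  show ?thesis
  proof (cases "L \<le> Suc M")
    case False
    then have "2 * of_nat d - of_nat j + 1 = (- of_nat (2 * m - (n + k) - 1) :: complex)"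
      using assms by (simp add: of_nat_diff L_def M_def)
    then show ?thesis using False unfolding rows binomial_partial_sum_double
      by (simp add: binomial_eq_0 del: of_nat_diff)
  next
    case le: True
    have r2: "rGamma (2 * of_nat d - of_nat j + 1 :: complex) = 1 / fact (Suc M - L)"
    proof -
      have "2 * of_nat d - of_nat j + 1 = (of_nat (Suc M - L) + 1 :: complex)"
        using assms True le by (simp add: L_def M_def of_nat_diff)
      then show ?thesis by (simp only: rGamma_of_nat_plus_1)
    qed
    have b1: "of_nat (Suc M choose L) = (of_nat (Suc M) * fact M / (fact L * fact (Suc M - L)) :: complex)"
      using binomial_fact[OF le, where 'a = complex] by simp
    have b2: "of_nat (M choose L) = (of_nat (Suc M - L) * fact M / (fact L * fact (Suc M - L)) :: complex)"
    proof (cases "L \<le> M")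
      case True
      then show ?thesis using binomial_fact[OF True, where 'a = complex]
        by (simp add: Suc_diff_le field_simps del: of_nat_Suc)
    qed (use le in \<open>simp add: binomial_eq_0\<close>)
    have e: "of_nat (Suc M) + of_nat (Suc M - L) = (of_nat (3 * d + 1) :: complex)"
      unfolding of_nat_add[symmetric] of_nat_eq_iff using assms True le by (simp add: L_def M_def)
    have c: "a * x / (p * q) + b * x / (p * q) = (a + b) * (x * (1 / p) * (1 / q))" for a b x p q :: complex
      by (simp add: divide_inverse algebra_simps)
    show ?thesis
      unfolding rows binomial_partial_sum_double r1 r2 j b1 b2 e[symmetric] by (rule c)
  qed
qed

lemma p_coeff_0_reversed:
  assumes "j \<le> n"
  shows "p_coeff n (n - j) 0 = (- 1) ^ n *
      ((- 1) ^ j * (fact (n + 1 + j) * fact (2 * n + 1 - j) / fact (2 * n + 2 + j))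
     * rGamma (of_nat n - of_nat j + 1) * (of_nat (3 * j + 2) * fact (2 * j) / (fact j * fact (j + 1))))"
proof -
  have 1: "n + (n - j) + 1 - 2 * 0 = 2 * n + 1 - j" "2 * n + 1 - (n - j) - 0 = n + 1 + j"
    "3 * n + 2 - (n - j) - 2 * 0 = 2 * n + 2 + j" "3 * n + 2 - 3 * (n - j) = 3 * j + 2" "n - (n - j) = j" "n
        - j - 0 = n - j"
    using assms by auto
  have 2: "(- 1) ^ (n - j) = ((- 1) ^ n * (- 1) ^ j :: complex)"
    using assms by (auto simp: minus_one_power_iff)
  have 3: "rGamma (of_nat n - of_nat j + 1 :: complex) = 1 / fact (n - j)"
    using rGamma_of_nat_plus_1[of "n - j"] assms by (simp add: of_nat_diff)
  have 4: "catalan j = fact (2 * j) / (fact j * fact (j + 1))"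
    using binomial_fact[of j "2 * j", where 'a = complex] by (simp add: catalan_def)
  show ?thesis
    unfolding p_coeff_def 1 2 3 4 by (simp add: mult_ac del: of_nat_add of_nat_mult of_nat_Suc fact_Suc)
qed

lemma sum_atMost_rev: "(\<Sum>k\<le>n. f (n - k)) = (\<Sum>k\<le>n. f k)" for n :: nat
  using sum.nat_diff_reindex[of f "Suc n"] by (simp add: lessThan_Suc_atMost)

text \<open>This evaluates the functional \<open>u\<^sup>T\<close>, that is, the continuation of the even basis sequences to
the first point beyond the right corner, on the coefficient vector \<open>p\<close>.\<close>

lemma p_weight_sum: "(\<Sum>k\<le>n. 2 ^ (n - k) * p_coeff n k 0) = of_bool (even n)"
proof -
  have "(\<Sum>k\<le>n. 2 ^ (n - k) * p_coeff n k 0) = (\<Sum>j\<le>n. 2 ^ (n - (n - j)) * p_coeff n (n - j) 0)"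
    using sum_atMost_rev[of "\<lambda>k. 2 ^ (n - k) * p_coeff n k 0" n] by simp
  also have "\<dots> = (\<Sum>j\<le>n. (- 1) ^ n * weight_term (n + 1) j)"
  proof (intro sum.cong refl)
    fix j assume "j \<in> {..n}"
    moreover have "(- 2) ^ j = (2 ^ j * (- 1) ^ j :: complex)"
      using power_mult_distrib[of 2 "-1 :: complex" j] by simp
    moreover have "2 * (n + 1) - 1 - j = 2 * n + 1 - j" "2 * (n + 1) + j = 2 * n + 2 + j" by auto
    moreover have "rGamma (of_nat (n + 1) - of_nat j) = (rGamma (of_nat n - of_nat j + 1) :: complex)"
      by (simp add: add.commute add_diff_eq)
    ultimately show "2 ^ (n - (n - j)) * p_coeff n (n - j) 0 = (- 1) ^ n * weight_term (n + 1) j"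
      by (simp add: p_coeff_0_reversed weight_term_def mult_ac del: of_nat_add of_nat_mult of_nat_Suc fact_Suc)
  qed
  also have "\<dots> = (- 1) ^ n * of_bool (odd (n + 1))"
    using weight_term_sum[of "n + 1"] by (simp add: sum_distrib_left[symmetric] lessThan_Suc_atMost)
  finally show ?thesis by simp
qed

lemma boundary_matrix_last_row: "k \<le> n \<Longrightarrow> boundary_matrix n n k = 2 * 2 ^ (n - k) - of_bool (k = n)"
proof -
  assume k: "k \<le> n"
  show ?thesis
  proof (cases "k = n")
    case True
    then show ?thesis by (simp add: boundary_matrix_def)
  next
    case False
    have "boundary_matrix n n k = (\<Sum>a\<le>n + 1 - k. of_nat ((n + 1 - k) choose a))"
      unfolding boundary_matrix_def using k False by (intro sum.mono_neutral_cong_right) (auto simp: binomial_eq_0)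
    also have "\<dots> = of_nat (2 ^ (n + 1 - k))" using choose_row_sum[of "n + 1 - k"] by (metis of_nat_sum)
    finally show ?thesis using False k by (simp add: Suc_diff_le)
  qed
qed

lemma p_coeff_n: "p_coeff n n 0 = (- 1) ^ n"
proof -
  have "fact (2 * n + 2) = of_nat (2 * (n + 1)) * (fact (2 * n + 1) :: complex)"
    using fact_Suc[of "2 * n + 1", where 'a = complex] by simp
  moreover have "of_nat (2 * (n + 1)) \<noteq> (0 :: complex)" unfolding of_nat_eq_0_iff by simp
  moreover have "fact (n + 1) = of_nat (n + 1) * (fact n :: complex)" by simp
  moreover have "of_nat (n + 1) \<noteq> (0 :: complex)" unfolding of_nat_eq_0_iff by simp
  moreover have "of_nat (2 * (n + 1)) = 2 * (of_nat (n + 1) :: complex)" by simp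
  moreover have "of_nat (Suc (Suc 0)) = (2 :: complex)" by simp
  ultimately show ?thesis
    using p_coeff_0_reversed[of 0 n] rGamma_of_nat_plus_1[of n]
    by (simp del: of_nat_add of_nat_mult of_nat_Suc fact_Suc)
qed

text \<open>The entries of the last row of \<open>W\<close> are \<open>2 u\<^sub>k\<close> except for the corner, so \<open>p_weight_sum\<close>
settles \<open>m = n\<close>. Downwards, each row yields twice the value of the next one by \<open>row_term_sum_eq_0\<close>.\<close>

lemma boundary_matrix_p_coeff:
  assumes "m \<le> n"
  shows "(\<Sum>k\<le>n. boundary_matrix n m k * p_coeff n k 0) = 2 ^ (n - m)"
  using assms
proof (induction m rule: inc_induct)
  case base
  have "(\<Sum>k\<le>n. boundary_matrix n n k * p_coeff n k 0)
      = (\<Sum>k\<le>n. 2 * (2 ^ (n - k) * p_coeff n k 0) - (if k = n then p_coeff n n 0 else 0))"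
    by (intro sum.cong refl) (auto simp: boundary_matrix_last_row algebra_simps)
  also have "\<dots> = 2 * of_bool (even n) - p_coeff n n 0"
    by (simp add: sum_subtractf sum_distrib_left[symmetric] p_weight_sum)
  also have "p_coeff n n 0 = (- 1) ^ n" by (rule p_coeff_n)
  finally show ?case by (cases "even n") simp_all
next
  case (step m)
  then have m: "m < n" by simp
  define d where "d = n - m"
  have "2 * (\<Sum>k\<le>n. boundary_matrix n (Suc m) k * p_coeff n k 0) - (\<Sum>k\<le>n. boundary_matrix n m k * p_coeff n k 0)
     = (\<Sum>k\<le>n. (2 * boundary_matrix n (m + 1) k - boundary_matrix n m k) * p_coeff n k 0)"
    by (simp add: sum_distrib_left sum_subtractf left_diff_distrib mult.assoc)
  also have "\<dots> = (\<Sum>j\<le>n. (2 * boundary_matrix n (m + 1) (n - j) - boundary_matrix n m (n - j)) * p_coeff n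
      (n - j) 0)"
    by (rule sum_atMost_rev[symmetric])
  also have "\<dots> = (\<Sum>j\<le>n. of_nat (3 * d + 1) * (- 1) ^ n * row_term n d j)"
  proof (intro sum.cong refl)
    fix j assume "j \<in> {..n}"
    then have j: "j \<le> n" "n - (n - j) = j" by auto
    show "(2 * boundary_matrix n (m + 1) (n - j) - boundary_matrix n m (n - j)) * p_coeff n (n - j) 0
        = of_nat (3 * d + 1) * (- 1) ^ n * row_term n d j"
      using boundary_matrix_double[OF _ m, of "n - j"] j
      by (simp add: p_coeff_0_reversed row_term_def d_def[symmetric] del: of_nat_add of_nat_mult of_nat_Suc
          fact_Suc)
  qed
  also have "\<dots> = 0"
    using row_term_sum_eq_0[of d n] m by (simp add: sum_distrib_left[symmetric] d_def)
  finally show ?case using step m by (simp add: Suc_diff_Suc flip: power_Suc)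
qed

section \<open>Inverting the boundary matrix\<close>

definition p_matrix :: "nat \<Rightarrow> nat \<Rightarrow> nat \<Rightarrow> complex" where
  "p_matrix n k l = (if l \<le> k then p_coeff n k l else 0)"

text \<open>The Taylor coefficients of \<open>(s\<^sub>1 - s\<^sub>2) / (s\<^sub>1 s\<^sub>2 - 1)\<close> at the origin.\<close>

definition pairing :: "nat \<Rightarrow> nat \<Rightarrow> complex" where
  "pairing l1 l2 = of_bool (l2 = Suc l1) - of_bool (l1 = Suc l2)"

definition core_matrix :: "nat \<Rightarrow> nat \<Rightarrow> nat \<Rightarrow> complex" where
  "core_matrix n k1 k2 = (\<Sum>l1\<le>k1. \<Sum>l2\<le>k2. p_coeff n k1 l1 * p_coeff n k2 l2 * pairing l1 l2)"

definition centred_boundary :: "nat \<Rightarrow> nat \<Rightarrow> nat \<Rightarrow> complex" where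
  "centred_boundary n m k = boundary_matrix n m k - 2 ^ (n - m) * 2 ^ (n - k)"

text \<open>This shift invariance, shared by the boundary matrix, reduces all columns of the coefficient
matrix to the first one.\<close>

lemma p_coeff_shift:
  assumes "l \<le> k" "k \<le> n"
  shows "p_coeff n k l = (- 1) ^ l * p_coeff (n - l) (k - l) 0"
proof -
  have 1: "n - l + (k - l) + 1 - 2 * 0 = n + k + 1 - 2 * l" "2 * (n - l) + 1 - (k - l) - 0 = 2 * n + 1 - k - l"
    "3 * (n - l) + 2 - (k - l) - 2 * 0 = 3 * n + 2 - k - 2 * l"
    "3 * (n - l) + 2 - 3 * (k - l) = 3 * n + 2 - 3 * k" "n - l - (k - l) = n - k" "k - l - 0 = k - l"
    using assms by auto
  have 2: "(- 1) ^ l * (- 1) ^ (k - l) = ((- 1) ^ k :: complex)"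
    using assms by (simp flip: power_add)
  show ?thesis
    unfolding p_coeff_def 1 2[symmetric] by (simp add: mult_ac del: fact_Suc)
qed

lemma boundary_matrix_shift:
  "l \<le> m \<Longrightarrow> l \<le> k \<Longrightarrow> k \<le> n \<Longrightarrow> m \<le> n \<Longrightarrow> boundary_matrix (n - l) (m - l) (k - l) = boundary_matrix n m k"
  unfolding boundary_matrix_def by (intro sum.cong arg_cong[where f = of_nat] arg_cong2[where f = binomial]) auto

lemma sum_p_matrix_shift:
  assumes "l \<le> n"
  shows "(\<Sum>k\<le>n. f k * p_matrix n k l) = (- 1) ^ l * (\<Sum>k\<le>n - l. f (k + l) * p_coeff (n - l) k 0)"
proof -
  have "(\<Sum>k\<le>n. f k * p_matrix n k l) = (\<Sum>k\<in>{l..n}. f k * p_matrix n k l)"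
    by (intro sum.mono_neutral_right) (auto simp: p_matrix_def)
  also have "\<dots> = (\<Sum>k\<le>n - l. f (k + l) * p_matrix n (k + l) l)"
    using assms by (intro sum.reindex_bij_witness[of _ "\<lambda>k. k + l" "\<lambda>k. k - l"]) auto
  also have "\<dots> = (\<Sum>k\<le>n - l. (- 1) ^ l * (f (k + l) * p_coeff (n - l) k 0))"
    using assms by (intro sum.cong refl) (simp add: p_matrix_def p_coeff_shift[of l "_ + l"])
  finally show ?thesis by (simp add: sum_distrib_left)
qed

lemma boundary_matrix_p_matrix:
  assumes "l \<le> m" "m \<le> n"
  shows "(\<Sum>k\<le>n. boundary_matrix n m k * p_matrix n k l) = (- 1) ^ l * 2 ^ (n - m)"
proof -
  have "(\<Sum>k\<le>n - l. boundary_matrix n m (k + l) * p_coeff (n - l) k 0) =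
      (\<Sum>k\<le>n - l. boundary_matrix (n - l) (m - l) k * p_coeff (n - l) k 0)"
  proof (intro sum.cong refl)
    fix k assume "k \<in> {..n - l}"
    then show "boundary_matrix n m (k + l) * p_coeff (n - l) k 0 = boundary_matrix (n - l) (m - l) k * p_coeff
        (n - l) k 0"
      using boundary_matrix_shift[of l m "k + l" n] assms by simp
  qed
  also have "\<dots> = 2 ^ (n - m)"
    using boundary_matrix_p_coeff[of "m - l" "n - l"] assms by simp
  finally show ?thesis using assms by (simp add: sum_p_matrix_shift)
qed

lemma weight_p_matrix:
  assumes "l \<le> n"
  shows "(\<Sum>k\<le>n. 2 ^ (n - k) * p_matrix n k l) = (- 1) ^ l * of_bool (even (n - l))"
  using assms p_weight_sum[of "n - l"] by (simp add: sum_p_matrix_shift add.commute)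

text \<open>Reflecting the second sum by \<open>a \<mapsto> N - a\<close> makes the two ranges complementary in \<open>{0..N}\<close>.\<close>

lemma binomial_partial_sums_complement:
  assumes "L \<le> Suc N"
  shows "(\<Sum>a<L. N choose a) + (\<Sum>a<Suc N - L. N choose a) = 2 ^ N"
proof -
  have "(\<Sum>a<Suc N - L. N choose a) = (\<Sum>a\<in>{L..N}. N choose a)"
    using assms by (intro sum.reindex_bij_witness[of _ "\<lambda>a. N - a" "\<lambda>a. N - a"])
        (auto simp: binomial_symmetric[symmetric])
  then have "(\<Sum>a<L. N choose a) + (\<Sum>a<Suc N - L. N choose a) = sum ((choose) N) ({..<L} \<union> {L..N})"
    by (simp add: sum.union_disjoint ivl_disj_int)
  also have "{..<L} \<union> {L..N} = {..N}" using assms by auto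
  finally show ?thesis by (simp add: choose_row_sum)
qed

text \<open>The entries at \<open>(m, k)\<close> and \<open>(k, m)\<close> are complementary partial sums of the same row of
Pascal's triangle.\<close>

lemma boundary_matrix_sym:
  assumes "m \<le> n" "k \<le> n"
  shows "boundary_matrix n m k + boundary_matrix n k m = 2 * 2 ^ (n - m) * 2 ^ (n - k)"
proof -
  define N where "N = 2 * n + 1 - k - m"
  have full: "(\<Sum>a<L. N choose a) = 2 ^ N" if "L > N" for L
  proof -
    have "(\<Sum>a<L. N choose a) = (\<Sum>a\<le>N. N choose a)"
      using that by (intro sum.mono_neutral_right) (auto simp: binomial_eq_0)
    then show ?thesis by (simp add: choose_row_sum)
  qed
  have "(\<Sum>a<n + m + 1 - 2 * k. N choose a) + (\<Sum>a<n + k + 1 - 2 * m. N choose a) = 2 ^ N"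
  proof -
    consider "n + m + 1 < 2 * k" | "n + k + 1 < 2 * m" | "2 * k \<le> n + m + 1" "2 * m \<le> n + k + 1" by linarith
    then show ?thesis
    proof cases
      case 1
      then show ?thesis using full[of "n + k + 1 - 2 * m"] assms by (simp add: N_def)
    next
      case 2
      then show ?thesis using full[of "n + m + 1 - 2 * k"] assms by (simp add: N_def)
    next
      case 3
      then have "n + k + 1 - 2 * m = Suc N - (n + m + 1 - 2 * k)" "n + m + 1 - 2 * k \<le> Suc N"
        using assms by (auto simp: N_def)
      then show ?thesis using binomial_partial_sums_complement by metis
    qed
  qed
  moreover have "2 * n + 1 - m - k = N" by (simp add: N_def)
  ultimately have "boundary_matrix n m k + boundary_matrix n k m = of_nat (2 ^ N)"
    unfolding boundary_matrix_def N_def[symmetric] by (metis of_nat_add of_nat_sum)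
  moreover have "N = Suc ((n - m) + (n - k))" using assms by (simp add: N_def)
  ultimately show ?thesis by (simp add: power_add)
qed

lemma centred_boundary_skew: "m \<le> n \<Longrightarrow> k \<le> n \<Longrightarrow> centred_boundary n k m = - centred_boundary n m k"
  using boundary_matrix_sym[of m n k] by (simp add: centred_boundary_def algebra_simps eq_neg_iff_add_eq_0)

lemma pairing_skew: "pairing l2 l1 = - pairing l1 l2"
  by (simp add: pairing_def)

lemma core_matrix_skew: "core_matrix n k2 k1 = - core_matrix n k1 k2"
proof -
  have "core_matrix n k2 k1 = (\<Sum>l2\<le>k1. \<Sum>l1\<le>k2. p_coeff n k2 l1 * p_coeff n k1 l2 * pairing l1 l2)"
    unfolding core_matrix_def by (rule sum.swap)
  also have "\<dots> = (\<Sum>l2\<le>k1. \<Sum>l1\<le>k2. - (p_coeff n k1 l2 * p_coeff n k2 l1 * pairing l2 l1))"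
  proof (intro sum.cong refl)
    fix l1 l2
    show "p_coeff n k2 l1 * p_coeff n k1 l2 * pairing l1 l2 = -
        (p_coeff n k1 l2 * p_coeff n k2 l1 * pairing l2 l1)"
      using pairing_skew[of l1 l2] by simp
  qed
  finally show ?thesis by (simp add: core_matrix_def sum_negf)
qed

lemma sum_pairing:
  fixes f :: "nat \<Rightarrow> complex"
  assumes "j \<le> n"
  shows "(\<Sum>l\<le>n. f l * pairing l j) = (if j = 0 then 0 else f (j - 1)) - (if j < n then f (Suc j) else 0)"
proof -
  have "(\<Sum>l\<le>n. f l * pairing l j)
     = (\<Sum>l\<le>n. if l = j - 1 then (if j = 0 then 0 else f l) else 0) - (\<Sum>l\<le>n. if l = Suc j then f l else 0)"
    unfolding sum_subtractf[symmetric] by (intro sum.cong refl) (auto simp: pairing_def)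
  then show ?thesis using assms by (auto simp: sum.delta)
qed

lemma sum_p_coeff_eq_p_matrix: "k \<le> n \<Longrightarrow> (\<Sum>l\<le>k. p_coeff n k l * f l) = (\<Sum>l\<le>n. p_matrix n k l * f l)"
  by (intro sum.mono_neutral_cong_left) (auto simp: p_matrix_def)

lemma core_matrix_eq:
  assumes "k \<le> n" "j \<le> n"
  shows "core_matrix n k j = (\<Sum>l1\<le>n. \<Sum>l2\<le>n. p_matrix n k l1 * pairing l1 l2 * p_matrix n j l2)"
proof -
  have "core_matrix n k j = (\<Sum>l1\<le>k. p_coeff n k l1 * (\<Sum>l2\<le>j. p_coeff n j l2 * pairing l1 l2))"
    by (simp add: core_matrix_def sum_distrib_left mult.assoc)
  also have "\<dots> = (\<Sum>l1\<le>n. p_matrix n k l1 * (\<Sum>l2\<le>n. p_matrix n j l2 * pairing l1 l2))"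
    using assms by (simp add: sum_p_coeff_eq_p_matrix)
  finally show ?thesis by (simp add: sum_distrib_left mult_ac)
qed

lemma sum_core_matrix:
  assumes "j \<le> n"
  shows "(\<Sum>k\<le>n. f k * core_matrix n k j) =
      (\<Sum>l2\<le>n. (\<Sum>l1\<le>n. (\<Sum>k\<le>n. f k * p_matrix n k l1) * pairing l1 l2) * p_matrix n j l2)"
proof -
  have "(\<Sum>k\<le>n. f k * core_matrix n k j) =
      (\<Sum>k\<le>n. \<Sum>l1\<le>n. \<Sum>l2\<le>n. f k * p_matrix n k l1 * pairing l1 l2 * p_matrix n j l2)"
    using assms by (simp add: core_matrix_eq sum_distrib_left mult.assoc)
  also have "\<dots> = (\<Sum>l1\<le>n. \<Sum>k\<le>n. \<Sum>l2\<le>n. f k * p_matrix n k l1 * pairing l1 l2 * p_matrix n j l2)"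
    by (rule sum.swap)
  also have "\<dots> = (\<Sum>l1\<le>n. \<Sum>l2\<le>n. \<Sum>k\<le>n. f k * p_matrix n k l1 * pairing l1 l2 * p_matrix n j l2)"
    by (intro sum.cong refl sum.swap)
  also have "\<dots> = (\<Sum>l2\<le>n. \<Sum>l1\<le>n. \<Sum>k\<le>n. f k * p_matrix n k l1 * pairing l1 l2 * p_matrix n j l2)"
    by (rule sum.swap)
  finally show ?thesis by (simp add: sum_distrib_right)
qed

text \<open>Multiplying \<open>u\<^sup>T P\<close>, which is supported on indices of one parity, by \<open>A\<close> cancels everything
but possibly the first entry.\<close>

lemma weight_core_matrix:
  assumes "j \<le> n"
  shows "(\<Sum>k\<le>n. 2 ^ (n - k) * core_matrix n k j) = of_bool (odd n) * p_coeff n j 0"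
proof -
  have "(\<Sum>k\<le>n. 2 ^ (n - k) * core_matrix n k j)
     = (\<Sum>l2\<le>n. (\<Sum>l1\<le>n. ((- 1) ^ l1 * of_bool (even (n - l1))) * pairing l1 l2) * p_matrix n j l2)"
    unfolding sum_core_matrix[OF assms] by (intro sum.cong refl) (simp add: weight_p_matrix)
  also have "\<dots> = (\<Sum>l2\<le>n. (if l2 = 0 then of_bool (odd n) * p_matrix n j l2 else 0))"
  proof (intro sum.cong refl)
    fix l2 assume "l2 \<in> {..n}"
    then have l2: "l2 \<le> n" by simp
    show "(\<Sum>l1\<le>n. ((- 1) ^ l1 * of_bool (even (n - l1))) * pairing l1 l2) * p_matrix n j l2
       = (if l2 = 0 then of_bool (odd n) * p_matrix n j l2 else 0)"
      unfolding sum_pairing[OF l2] using l2 by (cases l2) (auto simp: odd_pos minus_one_power_iff)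
  qed
  also have "\<dots> = of_bool (odd n) * p_coeff n j 0" by (simp add: p_matrix_def)
  finally show ?thesis .
qed

text \<open>The congruence transform \<open>P\<^sup>T Q P\<close>.\<close>

definition reduced_boundary :: "nat \<Rightarrow> nat \<Rightarrow> nat \<Rightarrow> complex" where
  "reduced_boundary n m l = (\<Sum>a\<le>n. p_matrix n a m * (\<Sum>k\<le>n. centred_boundary n a k * p_matrix n k l))"

lemma reduced_boundary_skew: "reduced_boundary n l m = - reduced_boundary n m l"
proof -
  have "reduced_boundary n l m = (\<Sum>a\<le>n. \<Sum>k\<le>n. p_matrix n a l * centred_boundary n a k * p_matrix n k m)"
    by (simp add: reduced_boundary_def sum_distrib_left mult.assoc)
  also have "\<dots> = (\<Sum>k\<le>n. \<Sum>a\<le>n. p_matrix n a l * centred_boundary n a k * p_matrix n k m)"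
    by (rule sum.swap)
  also have "\<dots> = (\<Sum>k\<le>n. \<Sum>a\<le>n. - (p_matrix n k m * centred_boundary n k a * p_matrix n a l))"
  proof (intro sum.cong refl)
    fix k a assume "k \<in> {..n}" "a \<in> {..n}"
    then show "p_matrix n a l * centred_boundary n a k * p_matrix n k m = -
        (p_matrix n k m * centred_boundary n k a * p_matrix n a l)"
      using centred_boundary_skew[of k n a] by simp
  qed
  finally show ?thesis by (simp add: reduced_boundary_def sum_distrib_left mult.assoc sum_negf)
qed

text \<open>On or below the diagonal only the rows of \<open>Q P\<close> with index at least \<open>m \<ge> l\<close> enter, because \<open>P\<close>
is lower triangular, and these are given by \<open>boundary_matrix_p_matrix\<close>.\<close>

lemma reduced_boundary_lower:
  assumes "l \<le> m" "m \<le> n"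
  shows "reduced_boundary n m l = - of_bool (odd (n - l) \<and> even (n - m))"
proof -
  have "reduced_boundary n m l = (\<Sum>a\<le>n. (- 1) ^ l * of_bool (odd (n - l)) * (2 ^ (n - a) * p_matrix n a m))"
    unfolding reduced_boundary_def
  proof (intro sum.cong refl)
    fix a assume a: "a \<in> {..n}"
    show "p_matrix n a m * (\<Sum>k\<le>n. centred_boundary n a k * p_matrix n k l) = (- 1) ^ l * of_bool (odd (n - l))
        * (2 ^ (n - a) * p_matrix n a m)"
    proof (cases "m \<le> a")
      case True
      have "(\<Sum>k\<le>n. centred_boundary n a k * p_matrix n k l) = (\<Sum>k\<le>n. boundary_matrix n a k * p_matrix n k l)
          - 2 ^ (n - a) * (\<Sum>k\<le>n. 2 ^ (n - k) * p_matrix n k l)"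
        by (simp add: centred_boundary_def left_diff_distrib sum_subtractf sum_distrib_left mult.assoc)
      also have "\<dots> = (- 1) ^ l * of_bool (odd (n - l)) * 2 ^ (n - a)"
        using a True assms by (simp add: boundary_matrix_p_matrix weight_p_matrix)
      finally show ?thesis by simp
    qed (simp add: p_matrix_def)
  qed
  also have "\<dots> = (- 1) ^ l * of_bool (odd (n - l)) * ((- 1) ^ m * of_bool (even (n - m)))"
    using assms by (simp add: sum_distrib_left[symmetric] weight_p_matrix)
  finally show ?thesis using assms by (auto simp: minus_one_power_iff)
qed

text \<open>Up to sign, \<open>A\<close> inverts \<open>P\<^sup>T Q P\<close> exactly if \<open>n\<close> is odd. For even \<open>n\<close> the size \<open>n + 1\<close> is odd,
so the skew matrices are singular, and a rank one term remains.\<close>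

lemma reduced_boundary_pairing:
  assumes "m \<le> n" "j \<le> n"
  shows "(\<Sum>l\<le>n. reduced_boundary n m l * pairing l j) = of_bool (even n \<and> even m \<and> j = 0) - of_bool (j = m)"
proof -
  have entries: "reduced_boundary n m l =
      (if l \<le> m then - of_bool (odd (n - l) \<and> even (n - m)) else of_bool (odd (n - m) \<and> even (n - l)))"
    if "l \<le> n" for l
    using that reduced_boundary_lower[of l m n] reduced_boundary_lower[of m l n]
        reduced_boundary_skew[of n m l] assms by auto
  show ?thesis
    unfolding sum_pairing[OF assms(2)] using assms by (cases j; auto simp: entries; presburger)
qed

text \<open>\<open>P\<^sup>T\<close> is upper triangular with nonzero diagonal, so back substitution applies.\<close>

lemma p_matrix_left_cancel:
  assumes "\<And>m. m \<le> n \<Longrightarrow> (\<Sum>a\<le>n. p_matrix n a m * X a) = 0" and "a \<le> n"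
  shows "X a = 0"
proof -
  have diag: "p_matrix n m m \<noteq> 0" if "m \<le> n" for m
  proof -
    have "of_nat (n - m + 1) \<noteq> (0 :: complex)" unfolding of_nat_eq_0_iff by simp
    then have "catalan (n - m) \<noteq> 0" by (simp add: catalan_def del: of_nat_add)
    moreover have "of_nat (3 * n + 2 - 3 * m) \<noteq> (0 :: complex)"
      unfolding of_nat_eq_0_iff using that by simp
    ultimately show ?thesis by (simp add: p_matrix_def p_coeff_def del: of_nat_diff)
  qed
  have "\<forall>a. m \<le> a \<and> a \<le> n \<longrightarrow> X a = 0" if "m \<le> n" for m
    using that
  proof (induction m rule: inc_induct)
    case base
    have "(\<Sum>a\<le>n. p_matrix n a n * X a) = (\<Sum>a\<in>{n}. p_matrix n a n * X a)"
      by (intro sum.mono_neutral_right) (auto simp: p_matrix_def)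
    then show ?case using assms(1)[of n] diag[of n] by auto
  next
    case (step m)
    have "(\<Sum>a\<le>n. p_matrix n a m * X a) = (\<Sum>a\<in>{m}. p_matrix n a m * X a)"
      using step by (intro sum.mono_neutral_right) (auto simp: p_matrix_def)
    then have "X m = 0" using assms(1)[of m] diag[of m] step by auto
    then show ?case using step by (metis Suc_leI le_neq_implies_less)
  qed
  from this[of 0] assms(2) show ?thesis by simp
qed

text \<open>After multiplication by \<open>P\<^sup>T\<close> from the left, which is injective, \<open>reduced_boundary_pairing\<close>
evaluates \<open>Q M\<close>, with a rank one term only for even \<open>n\<close>. For odd \<open>n\<close> the same rank one term comes
from \<open>u u\<^sup>T M\<close> by \<open>weight_core_matrix\<close>.\<close>

lemma boundary_matrix_core_matrix:
  assumes "a \<le> n" "j \<le> n"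
  shows "(\<Sum>k\<le>n. boundary_matrix n a k * core_matrix n k j) = 2 ^ (n - a) * p_coeff n j 0 - of_bool (a = j)"
proof -
  \<comment> \<open>the defect of the identity for \<open>Q\<close> in place of \<open>W\<close>\<close>
  define X where "X a = (\<Sum>k\<le>n. centred_boundary n a k * core_matrix n k j) + of_bool (a = j) - of_bool
      (even n) * 2 ^ (n - a) * p_coeff n j 0" for a
  have "X a = 0"
  proof (rule p_matrix_left_cancel[OF _ assms(1)])
    fix m assume m: "m \<le> n"
    have "(\<Sum>a\<le>n. p_matrix n a m * (\<Sum>k\<le>n. centred_boundary n a k * core_matrix n k j)) =
        (\<Sum>k\<le>n. (\<Sum>a\<le>n. p_matrix n a m * centred_boundary n a k) * core_matrix n k j)"
      unfolding sum_distrib_left sum_distrib_right by (subst sum.swap) (simp add: mult.assoc)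
    also have "\<dots> = (\<Sum>l2\<le>n.
        (\<Sum>l1\<le>n. (\<Sum>k\<le>n. (\<Sum>a\<le>n. p_matrix n a m * centred_boundary n a k) * p_matrix n k l1) * pairing l1 l2)
        * p_matrix n j l2)"
      using assms(2) by (rule sum_core_matrix)
    also have "\<dots> = (\<Sum>l2\<le>n. (\<Sum>l1\<le>n. reduced_boundary n m l1 * pairing l1 l2) * p_matrix n j l2)"
    proof -
      have "(\<Sum>k\<le>n. (\<Sum>a\<le>n. p_matrix n a m * centred_boundary n a k) * p_matrix n k l1)
          = reduced_boundary n m l1" for l1
        unfolding reduced_boundary_def sum_distrib_left sum_distrib_right by (subst sum.swap)
            (simp add: mult.assoc)
      then show ?thesis by simp
    qed
    also have "\<dots> = (\<Sum>l2\<le>n. (if l2 = 0 then of_bool (even n \<and> even m) * p_matrix n j l2 else 0) -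
        (if l2 = m then p_matrix n j l2 else 0))"
      by (intro sum.cong refl) (auto simp: reduced_boundary_pairing m)
    also have "\<dots> = of_bool (even n \<and> even m) * p_coeff n j 0 - p_matrix n j m"
      using m by (simp add: sum_subtractf p_matrix_def)
    finally have 1: "(\<Sum>a\<le>n. p_matrix n a m * (\<Sum>k\<le>n. centred_boundary n a k * core_matrix n k j)) = of_bool
        (even n \<and> even m) * p_coeff n j 0 - p_matrix n j m" .
    have 2: "(\<Sum>a\<le>n. p_matrix n a m * of_bool (a = j)) = p_matrix n j m"
      using assms by (simp add: of_bool_def if_distrib cong: if_cong)
    have 3: "(\<Sum>a\<le>n. p_matrix n a m * (of_bool (even n) * 2 ^ (n - a) * p_coeff n j 0)) = of_bool
        (even n \<and> even m) * p_coeff n j 0"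
    proof -
      have "(\<Sum>a\<le>n. p_matrix n a m * (of_bool (even n) * 2 ^ (n - a) * p_coeff n j 0))
         = of_bool (even n) * p_coeff n j 0 * (\<Sum>a\<le>n. 2 ^ (n - a) * p_matrix n a m)"
        by (simp add: sum_distrib_left mult_ac)
      also have "\<dots> = of_bool (even n \<and> even m) * p_coeff n j 0"
        using m by (auto simp: weight_p_matrix minus_one_power_iff)
      finally show ?thesis .
    qed
    show "(\<Sum>a\<le>n. p_matrix n a m * X a) = 0"
      unfolding X_def right_diff_distrib distrib_left sum.distrib sum_subtractf 1 2 3 by simp
  qed
  moreover have "(\<Sum>k\<le>n. boundary_matrix n a k * core_matrix n k j) =
      (\<Sum>k\<le>n. centred_boundary n a k * core_matrix n k j) + 2 ^ (n - a) * (\<Sum>k\<le>n. 2 ^ (n - k) * core_matrix n k j)"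
    by (simp add: centred_boundary_def left_diff_distrib sum_subtractf sum_distrib_left mult.assoc)
  ultimately show ?thesis
    unfolding weight_core_matrix[OF assms(2)] X_def by (cases "even n") (simp_all add: algebra_simps)
qed

lemma core_matrix_last_row:
  assumes "j \<le> n"
  shows "core_matrix n n j = of_bool (j = n) - (- 1) ^ n * p_coeff n j 0"
proof -
  have "(\<Sum>k\<le>n. boundary_matrix n n k * core_matrix n k j) =
      (\<Sum>k\<le>n. 2 * (2 ^ (n - k) * core_matrix n k j) - (if k = n then core_matrix n k j else 0))"
    by (intro sum.cong refl) (auto simp: boundary_matrix_last_row algebra_simps)
  also have "\<dots> = 2 * (of_bool (odd n) * p_coeff n j 0) - core_matrix n n j"
    by (simp add: sum_subtractf sum_distrib_left[symmetric] weight_core_matrix assms)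
  finally show ?thesis
    using boundary_matrix_core_matrix[of n n j] assms by (cases "even n") (auto simp: algebra_simps)
qed

section \<open>The contour integrals as coefficients\<close>

lemma has_contour_integral_coeff:
  assumes "f has_fps_expansion F" "f holomorphic_on ball 0 R" "0 < \<rho>" "\<rho> < R"
  shows "((\<lambda>z. f z / z ^ Suc l) has_contour_integral (2 * of_real pi * \<i> * fps_nth F l)) (circlepath 0 \<rho>)"
proof -
  have "((\<lambda>u. f u / (u - 0) ^ Suc l) has_contour_integral (2 * pi * \<i>) / fact l * (deriv ^^ l) f 0)
      (circlepath 0 \<rho>)"
    using assms by (intro Cauchy_has_contour_integral_higher_derivative_circlepath)
      (auto intro!: holomorphic_on_imp_continuous_on elim: holomorphic_on_subset)
  then show ?thesis
    using fps_nth_fps_expansion[OF assms(1), of l] by simp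
qed

text \<open>For \<open>e \<le> 0\<close> the integrand has no pole and Cauchy's theorem gives zero.\<close>

lemma has_contour_integral_coeff_powi:
  assumes "f has_fps_expansion F" "f holomorphic_on ball 0 R" "0 < \<rho>" "\<rho> < R"
  shows "((\<lambda>z. f z / z powi e) has_contour_integral
      (2 * of_real pi * \<i> * (if e \<ge> 1 then fps_nth F (nat (e - 1)) else 0))) (circlepath 0 \<rho>)"
proof (cases "e \<ge> 1")
  case True
  then have "e = int (Suc (nat (e - 1)))" by simp
  then have "z powi e = z ^ Suc (nat (e - 1))" for z :: complex by (metis power_int_of_nat)
  then show ?thesis
    using has_contour_integral_coeff[OF assms, of "nat (e - 1)"] True by simp
next
  case False
  have "((\<lambda>z. f z * z ^ nat (- e)) has_contour_integral 0) (circlepath 0 \<rho>)"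
    using assms by (intro Cauchy_theorem_convex_simple[of _ "ball 0 R"])
      (auto intro!: holomorphic_intros simp: path_image_circlepath)
  moreover have "f z / z powi e = f z * z ^ nat (- e)" for z
    using False by (cases "e = 0") (auto simp: power_int_def field_simps)
  ultimately show ?thesis using False by simp
qed

text \<open>The coefficient of \<open>z\<^sup>i\<close> in \<open>z\<^sup>2\<^sup>k (1 + z)\<^sup>n\<^sup>-\<^sup>k\<close>.\<close>

definition odd_basis :: "nat \<Rightarrow> nat \<Rightarrow> nat \<Rightarrow> complex" where
  "odd_basis n k i = (if 2 * k \<le> i then of_nat ((n - k) choose (i - 2 * k)) else 0)"

text \<open>The coefficient of \<open>z\<^sup>i\<close> in \<open>z\<^sup>2\<^sup>k\<^sup>+\<^sup>1 (1 + z)\<^sup>n\<^sup>-\<^sup>k / (1 - z)\<close>, that is, the sum of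
\<open>odd_basis n k i'\<close> over \<open>i' < i\<close>.\<close>

definition even_basis :: "nat \<Rightarrow> nat \<Rightarrow> nat \<Rightarrow> complex" where
  "even_basis n k i = (\<Sum>a<i - 2 * k. of_nat ((n - k) choose a))"

lemma fps_one_plus_X_power_nth: "fps_nth ((1 + fps_X) ^ N :: complex fps) l = of_nat (N choose l)"
  using fps_binomial_nth[of "of_nat N :: complex" l]
  by (simp add: fps_binomial_of_nat binomial_gbinomial)

lemma has_contour_integral_odd_basis:
  assumes "0 < \<rho>" "\<rho> < 1"
  shows "((\<lambda>r. (1 + r) ^ (n - k) / r powi (int i - 2 * int k + 1)) has_contour_integral
     (2 * of_real pi * \<i> * odd_basis n k i)) (circlepath 0 \<rho>)"
proof -
  have "(\<lambda>r :: complex. (1 + r) ^ (n - k)) has_fps_expansion (1 + fps_X) ^ (n - k)"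
    by (intro fps_expansion_intros)
  moreover have "(\<lambda>r :: complex. (1 + r) ^ (n - k)) holomorphic_on ball 0 1"
    by (intro holomorphic_intros)
  ultimately have "((\<lambda>r. (1 + r) ^ (n - k) / r powi (int i - 2 * int k + 1)) has_contour_integral
     (2 * of_real pi * \<i> * (if int i - 2 * int k + 1 \<ge> 1
        then fps_nth ((1 + fps_X) ^ (n - k)) (nat (int i - 2 * int k + 1 - 1)) else 0))) (circlepath 0 \<rho>)"
    using assms by (rule has_contour_integral_coeff_powi)
  moreover have "(if int i - 2 * int k + 1 \<ge> 1
        then fps_nth ((1 + fps_X) ^ (n - k)) (nat (int i - 2 * int k + 1 - 1)) else 0) = odd_basis n k i"
    by (auto simp: odd_basis_def fps_one_plus_X_power_nth nat_diff_distrib nat_mult_distrib)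
  ultimately show ?thesis by simp
qed

lemma has_contour_integral_even_basis:
  assumes "0 < \<rho>" "\<rho> < 1"
  shows "((\<lambda>r. (1 + r) ^ (n - k) / ((1 - r) * r powi (int i - 2 * int k))) has_contour_integral
     (2 * of_real pi * \<i> * even_basis n k i)) (circlepath 0 \<rho>)"
proof -
  define F :: "complex fps" where "F = (1 + fps_X) ^ (n - k) * inverse (1 - fps_X)"
  have "(\<lambda>r :: complex. (1 + r) ^ (n - k) * inverse (1 - r)) has_fps_expansion F"
    unfolding F_def by (intro fps_expansion_intros) auto
  moreover have "(\<lambda>r :: complex. (1 + r) ^ (n - k) * inverse (1 - r)) holomorphic_on ball 0 1"
    by (intro holomorphic_intros) auto
  ultimately have "((\<lambda>r. (1 + r) ^ (n - k) * inverse (1 - r) / r powi (int i - 2 * int k)) has_contour_integral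
     (2 * of_real pi * \<i> * (if int i - 2 * int k \<ge> 1
        then fps_nth F (nat (int i - 2 * int k - 1)) else 0))) (circlepath 0 \<rho>)"
    using assms by (rule has_contour_integral_coeff_powi)
  moreover have "fps_nth F l = (\<Sum>a\<le>l. of_nat ((n - k) choose a))" for l
    unfolding F_def fps_mult_nth
    by (simp add: fps_inverse_one_minus_fps_X fps_one_plus_X_power_nth atLeast0AtMost)
  then have "(if int i - 2 * int k \<ge> 1 then fps_nth F (nat (int i - 2 * int k - 1)) else 0) = even_basis n k i"
  proof -
    assume F: "\<And>l. fps_nth F l = (\<Sum>a\<le>l. of_nat ((n - k) choose a))"
    show ?thesis
    proof (cases "int i - 2 * int k \<ge> 1")
      case True
      then have "{..nat (int i - 2 * int k - 1)} = {..<i - 2 * k}" by auto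
      then show ?thesis using True by (simp add: F even_basis_def)
    next
      case False
      then show ?thesis by (simp add: even_basis_def)
    qed
  qed
  ultimately show ?thesis by (simp add: divide_inverse mult.assoc)
qed

lemma fps_nth_pairing_kernel:
  "fps_nth ((fps_const c - fps_X) * inverse (fps_const c * fps_X - 1)) l
     = (if l = 0 then 0 else c ^ (l - 1)) - c ^ Suc l" for c :: complex
proof -
  \<comment> \<open>the geometric series for \<open>1 / (c z - 1)\<close>\<close>
  define G where "G = - Abs_fps (\<lambda>n. c ^ n)"
  have "(fps_const c * fps_X - 1) * G = 1"
  proof (rule fps_ext)
    fix m show "fps_nth ((fps_const c * fps_X - 1) * G) m = fps_nth 1 m"
      by (cases m) (simp_all add: G_def left_diff_distrib mult.assoc)
  qed
  then have "inverse (fps_const c * fps_X - 1) = G" by (rule fps_inverse_unique)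
  then show ?thesis by (cases l) (simp_all add: G_def left_diff_distrib)
qed

lemma has_contour_integral_pairing_inner:
  assumes "0 < \<rho>" "\<rho> < 1" "cmod s1 = \<rho>"
  shows "((\<lambda>s2. (s1 - s2) / ((s1 * s2 - 1) * s1 ^ (l1 + 1) * s2 ^ (l2 + 1))) has_contour_integral
     (2 * of_real pi * \<i> * (((if l2 = 0 then 0 else s1 ^ (l2 - 1)) - s1 ^ Suc l2) / s1 ^ Suc l1)))
         (circlepath 0 \<rho>)"
proof -
  have e: "(\<lambda>s2. (s1 - s2) * inverse (s1 * s2 - 1)) has_fps_expansion
      (fps_const s1 - fps_X) * inverse (fps_const s1 * fps_X - 1)"
    by (intro fps_expansion_intros) auto
  have h: "(\<lambda>s2. (s1 - s2) * inverse (s1 * s2 - 1)) holomorphic_on ball 0 1"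
  proof (intro holomorphic_intros)
    fix z :: complex assume "z \<in> ball 0 1"
    then have "cmod (s1 * z) < 1" using assms mult_strict_mono[of "cmod s1" 1 "cmod z" 1] by (simp add: norm_mult)
    then show "s1 * z - 1 \<noteq> 0" by auto
  qed
  have "((\<lambda>s2. (s1 - s2) * inverse (s1 * s2 - 1) / s2 ^ Suc l2) has_contour_integral
      (2 * of_real pi * \<i> * ((if l2 = 0 then 0 else s1 ^ (l2 - 1)) - s1 ^ Suc l2))) (circlepath 0 \<rho>)"
    using has_contour_integral_coeff[OF e h assms(1,2), of l2] by (simp only: fps_nth_pairing_kernel)
  from has_contour_integral_lmul[OF this, of "inverse (s1 ^ Suc l1)"] show ?thesis
    by (simp add: divide_inverse mult_ac)
qed

lemma has_contour_integral_pairing_outer: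
  assumes "0 < \<rho>"
  shows "((\<lambda>s1. ((if l2 = 0 then 0 else s1 ^ (l2 - 1)) - s1 ^ Suc l2) / s1 ^ Suc l1) has_contour_integral
     (2 * of_real pi * \<i> * pairing l1 l2)) (circlepath 0 \<rho>)"
proof -
  define F :: "complex fps" where "F = (if l2 = 0 then 0 else fps_X ^ (l2 - 1)) - fps_X ^ Suc l2"
  have "(\<lambda>s1 :: complex. (if l2 = 0 then 0 else s1 ^ (l2 - 1)) - s1 ^ Suc l2) has_fps_expansion F"
    unfolding F_def by (cases "l2 = 0") (auto intro!: fps_expansion_intros simp del: power_Suc)
  moreover have "(\<lambda>s1 :: complex. (if l2 = 0 then 0 else s1 ^ (l2 - 1)) - s1 ^ Suc l2) holomorphic_on ball 0
      (\<rho> + 1)"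
    by (cases "l2 = 0") (auto intro!: holomorphic_intros simp del: power_Suc)
  ultimately have "((\<lambda>s1. ((if l2 = 0 then 0 else s1 ^ (l2 - 1)) - s1 ^ Suc l2) / s1 ^ Suc l1) has_contour_integral
     (2 * of_real pi * \<i> * fps_nth F l1)) (circlepath 0 \<rho>)"
    using assms by (intro has_contour_integral_coeff) auto
  moreover have "fps_nth F l1 = pairing l1 l2"
    unfolding F_def pairing_def by (cases "l2 = 0") (auto simp del: power_Suc)
  ultimately show ?thesis by simp
qed

text \<open>The integrand is a product of a function of \<open>r\<^sub>1\<close>, a function of \<open>r\<^sub>2\<close> and the kernel in \<open>s\<^sub>1,
s\<^sub>2\<close>, so the four integrals are evaluated from the inside out.\<close>

lemma quadruple_integral:
  assumes "0 < \<rho>" "\<rho> < 1"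
    and f: "(f has_contour_integral (2 * of_real pi * \<i> * x)) (circlepath 0 \<rho>)"
    and g: "(g has_contour_integral (2 * of_real pi * \<i> * y)) (circlepath 0 \<rho>)"
    and eq: "\<And>r1 r2 s1 s2. h r1 r2 s1 s2 = f r1 *
        (g r2 * ((s1 - s2) / ((s1 * s2 - 1) * s1 ^ (l1 + 1) * s2 ^ (l2 + 1))))"
  shows "1 / (2 * of_real pi * \<i>) ^ 4 *
     contour_integral (circlepath 0 \<rho>) (\<lambda>r1. contour_integral (circlepath 0 \<rho>) (\<lambda>r2.
     contour_integral (circlepath 0 \<rho>) (\<lambda>s1. contour_integral (circlepath 0 \<rho>) (\<lambda>s2. h r1 r2 s1 s2)))) = x * y
         * pairing l1 l2"
proof -
  define c where "c = (2 * of_real pi * \<i> :: complex)"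
  have c: "c \<noteq> 0" by (simp add: c_def)
  have s: "contour_integral (circlepath 0 \<rho>) (\<lambda>s1. contour_integral (circlepath 0 \<rho>) (\<lambda>s2. h r1 r2 s1 s2))
      = f r1 * (g r2 * (c * (c * pairing l1 l2)))" for r1 r2
  proof -
    have "contour_integral (circlepath 0 \<rho>) (\<lambda>s1. contour_integral (circlepath 0 \<rho>) (\<lambda>s2. h r1 r2 s1 s2))
       = contour_integral (circlepath 0 \<rho>)
           (\<lambda>s1. f r1 * (g r2 * (c * (((if l2 = 0 then 0 else s1 ^ (l2 - 1)) - s1 ^ Suc l2) / s1 ^ Suc l1))))"
    proof (rule contour_integral_eq)
      fix s1 assume "s1 \<in> path_image (circlepath 0 \<rho>)"
      then have "cmod s1 = \<rho>" using assms by (simp add: path_image_circlepath)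
      from has_contour_integral_pairing_inner[OF assms(1,2) this, of l1 l2]
      show "contour_integral (circlepath 0 \<rho>) (\<lambda>s2. h r1 r2 s1 s2)
         = f r1 * (g r2 * (c * (((if l2 = 0 then 0 else s1 ^ (l2 - 1)) - s1 ^ Suc l2) / s1 ^ Suc l1)))"
        unfolding eq c_def by (intro contour_integral_unique has_contour_integral_lmul)
    qed
    also have "\<dots> = f r1 * (g r2 * (c * (c * pairing l1 l2)))"
      using has_contour_integral_pairing_outer[OF assms(1), of l2 l1]
      unfolding c_def by (intro contour_integral_unique has_contour_integral_lmul)
    finally show ?thesis .
  qed
  have r: "contour_integral (circlepath 0 \<rho>) (\<lambda>r2. f r1 * (g r2 * (c * (c * pairing l1 l2)))) = f r1 *
      (c * y * (c * (c * pairing l1 l2)))" for r1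
    using g unfolding c_def by (intro contour_integral_unique has_contour_integral_lmul has_contour_integral_rmul)
  have "contour_integral (circlepath 0 \<rho>) (\<lambda>r1. f r1 * (c * y * (c * (c * pairing l1 l2)))) = c * x *
      (c * y * (c * (c * pairing l1 l2)))"
    using f unfolding c_def by (intro contour_integral_unique has_contour_integral_rmul)
  then show ?thesis
    unfolding s r c_def[symmetric] using c by (simp add: field_simps power4_eq_xxxx)
qed

definition even_mode :: "nat \<Rightarrow> nat \<Rightarrow> complex" where
  "even_mode n i = (\<Sum>k\<le>n. p_coeff n k 0 * even_basis n k i)"

definition odd_mode :: "nat \<Rightarrow> nat \<Rightarrow> complex" where
  "odd_mode n i = (\<Sum>k\<le>n. p_coeff n k 0 * odd_basis n k i)"

text \<open>The bilinear form of the core matrix, applied to two families of basis values.\<close>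

definition pair_sum :: "nat \<Rightarrow> (nat \<Rightarrow> complex) \<Rightarrow> (nat \<Rightarrow> complex) \<Rightarrow> complex" where
  "pair_sum n f g = (\<Sum>k1\<le>n. \<Sum>k2\<le>n. f k1 * g k2 * core_matrix n k1 k2)"

lemma pair_sum_eq:
  "(\<Sum>k1\<le>n. \<Sum>l1\<le>k1. \<Sum>k2\<le>n. \<Sum>l2\<le>k2. p_coeff n k1 l1 * p_coeff n k2 l2 * (f k1 * g k2 * pairing l1 l2))
      = pair_sum n f g"
proof -
  have "(\<Sum>l1\<le>k1. \<Sum>k2\<le>n. \<Sum>l2\<le>k2. p_coeff n k1 l1 * p_coeff n k2 l2 * (f k1 * g k2 * pairing l1 l2))
      = (\<Sum>k2\<le>n. f k1 * g k2 * core_matrix n k1 k2)" for k1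
    unfolding core_matrix_def sum_distrib_left by (subst sum.swap) (simp add: mult_ac)
  then show ?thesis by (simp add: pair_sum_def)
qed

definition T11 :: "nat \<Rightarrow> nat \<Rightarrow> nat \<Rightarrow> complex" where
  "T11 n i j = pair_sum n (\<lambda>k. odd_basis n k i) (\<lambda>k. odd_basis n k j)"

definition T10 :: "nat \<Rightarrow> nat \<Rightarrow> nat \<Rightarrow> complex" where
  "T10 n i j = par (j + 1) * odd_mode n i + pair_sum n (\<lambda>k. odd_basis n k i) (\<lambda>k. even_basis n k j)"

definition T00 :: "nat \<Rightarrow> nat \<Rightarrow> nat \<Rightarrow> complex" where
  "T00 n i j = of_bool (i < j) * par (i + 1) * par j - of_bool (i > j) * par i * par (j + 1)
     + par (j + 1) * (even_mode n i - par (i + 1)) - par (i + 1) * (even_mode n j - par (j + 1))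
     + pair_sum n (\<lambda>k. even_basis n k i) (\<lambda>k. even_basis n k j)"

lemma t_algebraic:
  assumes "0 < \<rho>" "\<rho> < 1"
  shows "t11 \<rho> n i j = T11 n i j" and "t10 \<rho> n i j = T10 n i j" and "t00 \<rho> n i j = T00 n i j"
proof -
  note ia = has_contour_integral_even_basis[OF assms] and ib = has_contour_integral_odd_basis[OF assms]
  have h0: "h0 \<rho> n i = even_mode n i - par (i + 1)" for i
    using contour_integral_unique[OF ia] by (simp add: h0_def even_mode_def)
  have h1: "h1 \<rho> n i = odd_mode n i" for i
    using contour_integral_unique[OF ib] by (simp add: h1_def odd_mode_def)
  show "t11 \<rho> n i j = T11 n i j"
    unfolding t11_def T11_def pair_sum_eq[symmetric]
    by (intro sum.cong refl arg_cong[where f = "(*)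
        (p_coeff n k l * p_coeff n k' l')" for k l k' l'] quadruple_integral[OF assms ib ib])
      (simp add: divide_inverse mult_ac)
  show "t10 \<rho> n i j = T10 n i j"
    unfolding t10_def T10_def pair_sum_eq[symmetric] h1
    by (intro sum.cong refl arg_cong[where f = "(*)
        (p_coeff n k l * p_coeff n k' l')" for k l k' l'] arg_cong2[where f
        = "(+)"] quadruple_integral[OF assms ib ia])
      (simp add: divide_inverse mult_ac)
  show "t00 \<rho> n i j = T00 n i j"
    unfolding t00_def T00_def pair_sum_eq[symmetric] h0
    by (intro sum.cong refl arg_cong[where f = "(*)
        (p_coeff n k l * p_coeff n k' l')" for k l k' l'] arg_cong2[where f
        = "(+)"] quadruple_integral[OF assms ia ia])
      (simp add: divide_inverse mult_ac)
qed

section \<open>Continuation away from the diagonal\<close>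

text \<open>The value at \<open>(a, a + 2 b)\<close> of the function on even vertices that equals \<open>f i\<close> at \<open>(i, i)\<close> and
satisfies the homogeneous rows at odd vertices; see \<open>ext_even_Suc\<close>.\<close>

definition ext_even :: "(nat \<Rightarrow> complex) \<Rightarrow> nat \<Rightarrow> nat \<Rightarrow> complex" where
  "ext_even f a b = (- 1) ^ b * (\<Sum>l\<le>b. of_nat (b choose l) * f (a + l))"

text \<open>The value at \<open>(a, a + 2 b + 1)\<close> of the function on odd vertices that equals \<open>f i\<close> at \<open>(i, i +
1)\<close> and satisfies the homogeneous rows at even vertices off the diagonal; see \<open>ext_odd_Suc\<close>. In
generating functions this is multiplication by \<open>(-1)\<^sup>b (1 + z)\<^sup>-\<^sup>b\<close>.\<close>

definition ext_odd :: "(nat \<Rightarrow> complex) \<Rightarrow> nat \<Rightarrow> nat \<Rightarrow> complex" where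
  "ext_odd f a b = (- 1) ^ b * (\<Sum>l\<le>a. (- 1) ^ l * ((of_nat b - 1 + of_nat l) gchoose l) * f (a - l))"

lemma ext_even_0 [simp]: "ext_even f a 0 = f a"
  by (simp add: ext_even_def)

lemma ext_odd_0 [simp]: "ext_odd f a 0 = f a"
proof -
  have "(of_nat m :: complex) gchoose Suc m = 0" for m
    by (simp add: binomial_gbinomial[symmetric])
  then have "(of_nat 0 - 1 + of_nat l :: complex) gchoose l = of_bool (l = 0)" for l
    by (cases l) auto
  then have "ext_odd f a 0 = (\<Sum>l\<le>a. if l = 0 then f a else 0)"
    unfolding ext_odd_def power_0 mult_1 by (intro sum.cong refl) auto
  then show ?thesis by simp
qed

lemma ext_even_cong: "(\<And>i. a \<le> i \<Longrightarrow> i \<le> a + b \<Longrightarrow> f i = g i) \<Longrightarrow> ext_even f a b = ext_even g a b"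
  by (auto simp: ext_even_def intro!: sum.cong)

lemma ext_odd_cong: "(\<And>i. i \<le> a \<Longrightarrow> f i = g i) \<Longrightarrow> ext_odd f a b = ext_odd g a b"
  by (auto simp: ext_odd_def intro!: sum.cong)

lemma ext_even_sum: "ext_even (\<lambda>i. \<Sum>k\<in>K. c k * f k i) a b = (\<Sum>k\<in>K. c k * ext_even (f k) a b)"
proof -
  have "ext_even (\<lambda>i. \<Sum>k\<in>K. c k * f k i) a b
     = (\<Sum>l\<le>b. \<Sum>k\<in>K. c k * ((- 1) ^ b * (of_nat (b choose l) * f k (a + l))))"
    by (simp add: ext_even_def sum_distrib_left mult_ac)
  also have "\<dots> = (\<Sum>k\<in>K. \<Sum>l\<le>b. c k * ((- 1) ^ b * (of_nat (b choose l) * f k (a + l))))"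
    by (rule sum.swap)
  finally show ?thesis by (simp add: ext_even_def sum_distrib_left)
qed

lemma ext_odd_sum: "ext_odd (\<lambda>i. \<Sum>k\<in>K. c k * f k i) a b = (\<Sum>k\<in>K. c k * ext_odd (f k) a b)"
proof -
  have "ext_odd (\<lambda>i. \<Sum>k\<in>K. c k * f k i) a b
     = (\<Sum>l\<le>a. \<Sum>k\<in>K. c k * ((- 1) ^ b * ((- 1) ^ l * ((of_nat b - 1 + of_nat l) gchoose l) * f k (a - l))))"
    by (simp add: ext_odd_def sum_distrib_left mult_ac)
  also have "\<dots> = (\<Sum>k\<in>K. \<Sum>l\<le>a. c k *
      ((- 1) ^ b * ((- 1) ^ l * ((of_nat b - 1 + of_nat l) gchoose l) * f k (a - l))))"
    by (rule sum.swap)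
  finally show ?thesis by (simp add: ext_odd_def sum_distrib_left)
qed

lemma ext_even_linear: "ext_even (\<lambda>i. f i + g i) a b = ext_even f a b + ext_even g a b"
  "ext_even (\<lambda>i. f i - g i) a b = ext_even f a b - ext_even g a b" "ext_even (\<lambda>i. - f i) a b = - ext_even f a b"
  "ext_even (\<lambda>i. c * f i) a b = c * ext_even f a b" "ext_even (\<lambda>i. f i * c) a b = ext_even f a b * c"
  by (simp_all add: ext_even_def algebra_simps sum.distrib sum_subtractf sum_distrib_left sum_negf)

lemma ext_odd_linear: "ext_odd (\<lambda>i. f i + g i) a b = ext_odd f a b + ext_odd g a b"
  "ext_odd (\<lambda>i. f i - g i) a b = ext_odd f a b - ext_odd g a b" "ext_odd (\<lambda>i. - f i) a b = - ext_odd f a b"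
  "ext_odd (\<lambda>i. c * f i) a b = c * ext_odd f a b" "ext_odd (\<lambda>i. f i * c) a b = ext_odd f a b * c"
  by (simp_all add: ext_odd_def algebra_simps sum.distrib sum_subtractf sum_distrib_left sum_negf)

text \<open>Continuation in the row index commutes with continuation in the column index. Boundary
conditions in one index can thus be checked for each fixed diagonal value of the other.\<close>

lemma ext_even_even_swap: "ext_even (\<lambda>i. ext_even (\<lambda>j. f i j) c d) a b = ext_even
    (\<lambda>j. ext_even (\<lambda>i. f i j) a b) c d"
proof -
  have "ext_even (\<lambda>i. ext_even (\<lambda>j. f i j) c d) a b
     = ext_even (\<lambda>i. \<Sum>l\<le>d. ((- 1) ^ d * of_nat (d choose l)) * f i (c + l)) a b"
    by (simp add: ext_even_def[of _ c d] sum_distrib_left mult.assoc)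
  also have "\<dots> = ext_even (\<lambda>j. ext_even (\<lambda>i. f i j) a b) c d"
    unfolding ext_even_sum by (simp add: ext_even_def[of _ c d] sum_distrib_left mult.assoc)
  finally show ?thesis .
qed

lemma ext_odd_even_swap: "ext_odd (\<lambda>i. ext_even (\<lambda>j. f i j) c d) a b = ext_even (\<lambda>j. ext_odd (\<lambda>i. f i j) a b) c d"
proof -
  have "ext_odd (\<lambda>i. ext_even (\<lambda>j. f i j) c d) a b
     = ext_odd (\<lambda>i. \<Sum>l\<le>d. ((- 1) ^ d * of_nat (d choose l)) * f i (c + l)) a b"
    by (simp add: ext_even_def sum_distrib_left mult.assoc)
  also have "\<dots> = ext_even (\<lambda>j. ext_odd (\<lambda>i. f i j) a b) c d"
    unfolding ext_odd_sum by (simp add: ext_even_def sum_distrib_left mult.assoc)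
  finally show ?thesis .
qed

lemma ext_odd_odd_swap: "ext_odd (\<lambda>i. ext_odd (\<lambda>j. f i j) c d) a b = ext_odd (\<lambda>j. ext_odd (\<lambda>i. f i j) a b) c d"
proof -
  have "ext_odd (\<lambda>i. ext_odd (\<lambda>j. f i j) c d) a b
     = ext_odd (\<lambda>i. \<Sum>l\<le>c. ((- 1) ^ d * ((- 1) ^ l * ((of_nat d - 1 + of_nat l) gchoose l))) * f i (c - l)) a b"
    by (simp add: ext_odd_def[of _ c d] sum_distrib_left mult.assoc)
  also have "\<dots> = ext_odd (\<lambda>j. ext_odd (\<lambda>i. f i j) a b) c d"
    unfolding ext_odd_sum by (simp add: ext_odd_def[of _ c d] sum_distrib_left mult.assoc)
  finally show ?thesis .
qed

text \<open>Shifting the recurrence into the diagonal values is convenient when sums of neighbouring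
values are simpler than the values themselves, as in \<open>ext_even_parity_kernel\<close>.\<close>

lemma ext_even_Suc_fun: "ext_even f a (Suc b) = - ext_even (\<lambda>i. f i + f (Suc i)) a b"
proof -
  have "(\<Sum>l\<le>Suc b. of_nat (Suc b choose l) * f (a + l))
     = f a + (\<Sum>l\<le>b. of_nat (Suc b choose Suc l) * f (a + Suc l))"
    by (subst sum.atMost_Suc_shift) simp
  also have "\<dots> = (f a + (\<Sum>l\<le>b. of_nat (b choose Suc l) * f (a + Suc l))) +
      (\<Sum>l\<le>b. of_nat (b choose l) * f (Suc (a + l)))"
    by (simp add: algebra_simps sum.distrib)
  also have "f a + (\<Sum>l\<le>b. of_nat (b choose Suc l) * f (a + Suc l)) = (\<Sum>l\<le>Suc b. of_nat (b choose l) * f (a + l))"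
    by (simp add: sum.atMost_Suc_shift del: sum.atMost_Suc)
  also have "\<dots> = (\<Sum>l\<le>b. of_nat (b choose l) * f (a + l))" by simp
  finally show ?thesis by (simp add: ext_even_def algebra_simps sum.distrib)
qed

lemma ext_even_Suc: "ext_even f a (Suc b) = - (ext_even f a b + ext_even f (Suc a) b)"
  unfolding ext_even_Suc_fun ext_even_linear by (simp add: ext_even_def)

lemma ext_odd_Suc: "(if a = 0 then 0 else ext_odd f (a - 1) (Suc b)) + ext_odd f a (Suc b) + ext_odd f a b = 0"
proof -
  define c where "c b l = ((- 1) ^ l * ((of_nat b - 1 + of_nat l) gchoose l) :: complex)" for b l
  have c0: "c b 0 = 1" for b by (simp add: c_def)
  have cS: "c (Suc b) l + c (Suc b) (Suc l) = c b (Suc l)" for b l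
    using gbinomial_Suc_Suc[of "of_nat b + of_nat l :: complex" l] by (simp add: c_def algebra_simps)
  have ext_odd: "ext_odd f a b = (- 1) ^ b * (\<Sum>l\<le>a. c b l * f (a - l))" for a b
    by (simp add: ext_odd_def c_def)
  show ?thesis
  proof (cases a)
    case 0
    then show ?thesis by (simp add: ext_odd c0)
  next
    case (Suc a')
    have "(\<Sum>l\<le>a'. c (Suc b) l * f (a' - l)) + (\<Sum>l\<le>a. c (Suc b) l * f (a - l))
       = f a + (\<Sum>l\<le>a'. (c (Suc b) l + c (Suc b) (Suc l)) * f (a' - l))"
      unfolding Suc by (subst sum.atMost_Suc_shift) (simp add: c0 algebra_simps sum.distrib)
    also have "\<dots> = (\<Sum>l\<le>a. c b l * f (a - l))"
      unfolding Suc by (subst sum.atMost_Suc_shift) (simp add: c0 cS)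
    finally have "(- 1) ^ b * ((\<Sum>l\<le>a'. c (Suc b) l * f (a' - l)) + (\<Sum>l\<le>a. c (Suc b) l * f (a - l)))
       = (- 1) ^ b * (\<Sum>l\<le>a. c b l * f (a - l))" by simp
    then show ?thesis by (simp add: ext_odd Suc algebra_simps)
  qed
qed

section \<open>Boundary conditions and diagonal rows\<close>

text \<open>Each step upwards is one application of Pascal's rule to all terms of the partial sum.\<close>

lemma ext_even_basis: "ext_even (even_basis n k) i q = (- 1) ^ q *
    (\<Sum>a<i + q - 2 * k. of_nat ((n - k + q) choose a))"
proof (induction q arbitrary: i)
  case 0
  then show ?case by (simp add: even_basis_def)
next
  case (Suc q)
  have *: "(\<Sum>a<L. of_nat (N choose a)) + (\<Sum>a<Suc L. of_nat (N choose a)) =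
      (\<Sum>a<Suc L. of_nat (Suc N choose a) :: complex)" for N L
    by (induction L) (auto simp: algebra_simps)
  show ?case
  proof (cases "2 * k \<le> i + q")
    case True
    then show ?thesis
      unfolding ext_even_Suc Suc.IH using *[where N = "n - k + q" and L = "i + q - 2 * k"]
      by (simp add: Suc_diff_le flip: distrib_left)
  next
    case False
    then show ?thesis by (simp add: ext_even_Suc Suc.IH)
  qed
qed

lemma ext_even_basis_top: "m \<le> n \<Longrightarrow> k \<le> n \<Longrightarrow> ext_even (even_basis n k) (2 * m) (Suc n - m) = (- 1) ^ (Suc n - m)
    * boundary_matrix n m k"
proof -
  assume "m \<le> n" "k \<le> n"
  then have "2 * m + (Suc n - m) - 2 * k = n + m + 1 - 2 * k" "n - k + (Suc n - m) = 2 * n + 1 - k - m" by auto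
  then show ?thesis by (simp only: ext_even_basis boundary_matrix_def)
qed

lemma par_Suc: "par i + par (Suc i) = 1"
  by (cases "even i") (simp_all add: par_def mod2_eq_if)

lemma ext_even_par: "ext_even (\<lambda>i. par (i + 1)) a (Suc q) = (- 1) ^ Suc q * 2 ^ q"
proof (induction q arbitrary: a)
  case 0
  then show ?case using par_Suc[of "Suc a"] by (simp add: ext_even_Suc)
next
  case (Suc q)
  then show ?case by (subst ext_even_Suc) simp
qed

text \<open>The part of \<open>T00\<close> that involves no coefficient \<open>p\<close>: a fundamental solution of the homogeneous
diagonal rows; see \<open>parity_kernel_diag\<close>.\<close>

definition parity_kernel :: "nat \<Rightarrow> nat \<Rightarrow> complex" where
  "parity_kernel i j = of_bool (i < j) * par (i + 1) * par j - of_bool (i > j) * par i * par (j + 1)"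

text \<open>The products of two parities in \<open>T00\<close> cancel.\<close>

lemma T00_eq: "T00 n i j = parity_kernel i j + par (j + 1) * even_mode n i - par (i + 1) * even_mode n j
     + pair_sum n (\<lambda>k. even_basis n k i) (\<lambda>k. even_basis n k j)"
  by (simp add: T00_def parity_kernel_def algebra_simps)

lemma parity_kernel_pair: "parity_kernel i j + parity_kernel (Suc i) j = of_bool (i < j) - par (j + 1)"
proof -
  have [simp]: "par i = (if even i then 0 else 1)" for i by (simp add: par_def mod2_eq_if)
  consider "i < j" "Suc i < j" | "Suc i = j" | "i = j" | "j < i" by linarith
  then show ?thesis by cases (auto simp: parity_kernel_def)
qed

lemma parity_kernel_diag: "(if i = 0 then 0 else parity_kernel (i - 1) j) - parity_kernel (Suc i) j = of_bool
    (i = j)"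
proof -
  have [simp]: "par i = (if even i then 0 else 1)" for i by (simp add: par_def mod2_eq_if)
  show ?thesis
  proof (cases i)
    case (Suc i')
    consider "Suc (Suc i') < j" | "j = Suc (Suc i')" | "j = Suc i'" | "j = i'" | "j < i'" by linarith
    then show ?thesis by cases (auto simp: parity_kernel_def Suc)
  qed (cases j; auto simp: parity_kernel_def)
qed

text \<open>By \<open>parity_kernel_pair\<close> the sums of neighbouring values are, up to a constant, the indicator
of \<open>i < j\<close>, and continuing an indicator produces partial row sums of Pascal's triangle.\<close>

lemma ext_even_parity_kernel: "m \<le> n \<Longrightarrow> ext_even (\<lambda>i. parity_kernel i j) (2 * m) (Suc n - m)
     = (- 1) ^ (Suc n - m) * (even_basis n m j - 2 ^ (n - m) * par (j + 1))"
proof -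
  assume m: "m \<le> n"
  have less: "ext_even (\<lambda>i. of_bool (i < j)) a b = (- 1) ^ b * (\<Sum>l<j - a. of_nat (b choose l))" for a b
  proof -
    have "(\<Sum>l\<le>b. of_nat (b choose l) * of_bool (a + l < j)) =
        (\<Sum>l\<in>{..b} \<inter> {..<j - a}. of_nat (b choose l) :: complex)"
      by (intro sum.mono_neutral_cong_right) auto
    also have "\<dots> = (\<Sum>l<j - a. of_nat (b choose l))"
      by (intro sum.mono_neutral_left) (auto simp: binomial_eq_0)
    finally show ?thesis by (simp add: ext_even_def)
  qed
  have one: "ext_even (\<lambda>i. c) a b = (- 1) ^ b * 2 ^ b * c" for a b c
    by (induction b arbitrary: a) (simp_all add: ext_even_Suc)
  have "ext_even (\<lambda>i. parity_kernel i j) (2 * m) (Suc (n - m)) = -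
      (ext_even (\<lambda>i. of_bool (i < j)) (2 * m) (n - m) - ext_even (\<lambda>i. par (j + 1)) (2 * m) (n - m))"
    unfolding ext_even_Suc_fun parity_kernel_pair ext_even_linear ..
  then show ?thesis using m unfolding less one
    by (simp add: Suc_diff_le even_basis_def algebra_simps)
qed

lemma pair_sum_left: "pair_sum n f g = (\<Sum>k1\<le>n. (\<Sum>k2\<le>n. g k2 * core_matrix n k1 k2) * f k1)"
  unfolding pair_sum_def sum_distrib_right by (simp add: mult_ac)

lemma pair_sum_right: "pair_sum n f g = (\<Sum>k2\<le>n. (\<Sum>k1\<le>n. f k1 * core_matrix n k1 k2) * g k2)"
  unfolding pair_sum_def sum_distrib_right by (subst sum.swap) (simp add: mult_ac)

lemma pair_sum_skew: "pair_sum n g f = - pair_sum n f g"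
proof -
  have "pair_sum n g f = (\<Sum>k1\<le>n. \<Sum>k2\<le>n. g k2 * f k1 * core_matrix n k2 k1)"
    unfolding pair_sum_def by (rule sum.swap)
  also have "\<dots> = (\<Sum>k1\<le>n. \<Sum>k2\<le>n. - (f k1 * g k2 * core_matrix n k1 k2))"
  proof (intro sum.cong refl)
    fix k1 k2 show "g k2 * f k1 * core_matrix n k2 k1 = - (f k1 * g k2 * core_matrix n k1 k2)"
      using core_matrix_skew[of n k2 k1] by simp
  qed
  finally show ?thesis by (simp add: pair_sum_def sum_negf)
qed

lemma pair_sum_linear:
  "pair_sum n (\<lambda>k. f k + f' k) g = pair_sum n f g + pair_sum n f' g"
  "pair_sum n (\<lambda>k. f k - f' k) g = pair_sum n f g - pair_sum n f' g"
  "pair_sum n (\<lambda>k. c * f k) g = c * pair_sum n f g"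
  "pair_sum n f (\<lambda>k. h k + h' k) = pair_sum n f h + pair_sum n f h'"
  "pair_sum n f (\<lambda>k. h k - h' k) = pair_sum n f h - pair_sum n f h'"
  by (simp_all add: pair_sum_def algebra_simps sum.distrib sum_subtractf sum_distrib_left)

lemma ext_even_pair_sum: "ext_even (\<lambda>i. pair_sum n (\<lambda>k. f k i) g) a b = pair_sum n (\<lambda>k. ext_even (f k) a b) g"
  unfolding pair_sum_left by (rule ext_even_sum)

lemma ext_odd_pair_sum: "ext_odd (\<lambda>i. pair_sum n (\<lambda>k. f k i) g) a b = pair_sum n (\<lambda>k. ext_odd (f k) a b) g"
  unfolding pair_sum_left by (rule ext_odd_sum)

lemma pair_sum_cong: "(\<And>k. k \<le> n \<Longrightarrow> f k = f' k) \<Longrightarrow> (\<And>k. k \<le> n \<Longrightarrow> g k = g' k) \<Longrightarrow> pair_sum n f g = pair_sum n f' g'"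
  by (auto simp: pair_sum_def intro!: sum.cong)

lemma pair_sum_boundary_matrix: "m \<le> n \<Longrightarrow> pair_sum n (\<lambda>k. boundary_matrix n m k) g = 2 ^ (n - m) *
    (\<Sum>k\<le>n. p_coeff n k 0 * g k) - g m"
proof -
  assume m: "m \<le> n"
  have "pair_sum n (\<lambda>k. boundary_matrix n m k) g = (\<Sum>k\<le>n. (2 ^ (n - m) * p_coeff n k 0 - of_bool (m = k)) * g k)"
    unfolding pair_sum_right using m by (intro sum.cong refl) (simp add: boundary_matrix_core_matrix)
  also have "\<dots> = (\<Sum>k\<le>n. 2 ^ (n - m) * (p_coeff n k 0 * g k)) - (\<Sum>k\<le>n. if k = m then g k else 0)"
    unfolding sum_subtractf[symmetric] by (intro sum.cong refl) (auto simp: algebra_simps)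
  finally show ?thesis using m by (simp add: sum_distrib_left)
qed

lemma ext_even_mode_top: "m \<le> n \<Longrightarrow> ext_even (even_mode n) (2 * m) (Suc n - m) = (- 1) ^ (Suc n - m) * 2 ^ (n - m)"
proof -
  assume m: "m \<le> n"
  have "ext_even (even_mode n) (2 * m) (Suc n - m) =
      (\<Sum>k\<le>n. p_coeff n k 0 * ext_even (even_basis n k) (2 * m) (Suc n - m))"
    unfolding even_mode_def by (rule ext_even_sum)
  also have "\<dots> = (\<Sum>k\<le>n. (- 1) ^ (Suc n - m) * (boundary_matrix n m k * p_coeff n k 0))"
    using m by (intro sum.cong refl) (simp add: ext_even_basis_top)
  also have "\<dots> = (- 1) ^ (Suc n - m) * 2 ^ (n - m)"
    using m by (simp add: sum_distrib_left[symmetric] boundary_matrix_p_coeff)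
  finally show ?thesis .
qed

lemma ext_even_pair_sum_top:
  assumes "m \<le> n"
  shows "ext_even (\<lambda>i. pair_sum n (\<lambda>k. even_basis n k i) g) (2 * m) (Suc n - m)
     = (- 1) ^ (Suc n - m) * (2 ^ (n - m) * (\<Sum>k\<le>n. p_coeff n k 0 * g k) - g m)"
proof -
  have "ext_even (\<lambda>i. pair_sum n (\<lambda>k. even_basis n k i) g) (2 * m) (Suc n - m)
      = pair_sum n (\<lambda>k. (- 1) ^ (Suc n - m) * boundary_matrix n m k) g"
    unfolding ext_even_pair_sum using assms by (intro pair_sum_cong) (simp_all add: ext_even_basis_top)
  then show ?thesis using assms by (simp only: pair_sum_linear pair_sum_boundary_matrix)
qed

lemma ext_even_par_top: "m \<le> n \<Longrightarrow> ext_even (\<lambda>i. par (i + 1)) (2 * m) (Suc n - m) = (- 1) ^ (Suc n - m) * 2 ^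
    (n - m)"
  using ext_even_par[of "2 * m" "n - m"] by (simp add: Suc_diff_le)

text \<open>The boundary value \<open>- even_basis n m j\<close> of the bilinear part, which comes from the identity
matrix in \<open>W M = u p\<^sup>T - I\<close>, cancels the one of the parity kernel; the remaining terms cancel
because of \<open>W p = u\<close>.\<close>

lemma T00_top:
  assumes "m \<le> n"
  shows "ext_even (\<lambda>i. T00 n i j) (2 * m) (Suc n - m) = 0"
  unfolding T00_eq ext_even_linear ext_even_parity_kernel[OF assms] ext_even_mode_top[OF assms]
      ext_even_pair_sum_top[OF assms]
    ext_even_par_top[OF assms, simplified] even_mode_def[of n j, symmetric]
  using ext_even_par_top[OF assms] by (simp add: algebra_simps even_mode_def)

text \<open>Here the identity matrix in \<open>W M = u p\<^sup>T - I\<close> leaves a term; \<open>cand_eo_top\<close> matches it with the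
source term.\<close>

lemma T10_top:
  assumes "m \<le> n"
  shows "ext_even (\<lambda>i. T10 n j i) (2 * m) (Suc n - m) = (- 1) ^ (Suc n - m) * odd_basis n m j"
proof -
  have "T10 n j i = par (i + 1) * odd_mode n j - pair_sum n (\<lambda>k. even_basis n k i) (\<lambda>k. odd_basis n k j)" for i
    unfolding T10_def using pair_sum_skew[of n "\<lambda>k. even_basis n k i" "\<lambda>k. odd_basis n k j"] by simp
  then have T10: "T10 n j = (\<lambda>i. par (i + 1) * odd_mode n j - pair_sum n (\<lambda>k. even_basis n k i)
      (\<lambda>k. odd_basis n k j))"
    by (rule ext)
  show ?thesis
    unfolding T10 ext_even_linear ext_even_par_top[OF assms] ext_even_pair_sum_top[OF assms] odd_mode_def
    by (simp add: algebra_simps)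
qed

lemma even_basis_Suc: "even_basis n k (Suc i) - even_basis n k i = odd_basis n k i"
  by (simp add: even_basis_def odd_basis_def Suc_diff_le)

lemma even_basis_0: "even_basis n k 0 = 0"
  by (simp add: even_basis_def)

lemma even_basis_diag: "even_basis n k (Suc i) - (if i = 0 then 0 else even_basis n k (i - 1))
    = odd_basis n k i + (if i = 0 then 0 else odd_basis n k (i - 1))"
  using even_basis_Suc[of n k i] even_basis_Suc[of n k "i - 1"] even_basis_0[of n k] by (cases i)
      (simp_all add: algebra_simps)

lemma par_diag: "0 < i \<Longrightarrow> par (Suc i + 1) = par (i - 1 + 1)"
  by (cases i) (simp_all add: par_def)

lemma even_mode_diag: "even_mode n (Suc i) - (if i = 0 then 0 else even_mode n (i - 1)) = odd_mode n i +
    (if i = 0 then 0 else odd_mode n (i - 1))"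
proof -
  have "even_mode n (Suc i) - (if i = 0 then 0 else even_mode n (i - 1))
     = (\<Sum>k\<le>n. p_coeff n k 0 * (even_basis n k (Suc i) - (if i = 0 then 0 else even_basis n k (i - 1))))"
    by (simp add: even_mode_def algebra_simps sum_subtractf)
  also have "\<dots> = odd_mode n i + (if i = 0 then 0 else odd_mode n (i - 1))"
    unfolding even_basis_diag by (simp add: odd_mode_def algebra_simps sum.distrib)
  finally show ?thesis .
qed

lemma pair_sum_diag:
  "pair_sum n (\<lambda>k. even_basis n k (Suc i)) g - (if i = 0 then 0 else pair_sum n (\<lambda>k. even_basis n k (i - 1)) g)
     = pair_sum n (\<lambda>k. odd_basis n k i) g + (if i = 0 then 0 else pair_sum n (\<lambda>k. odd_basis n k (i - 1)) g)"
proof -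
  have "pair_sum n (\<lambda>k. even_basis n k (Suc i)) g -
      (if i = 0 then 0 else pair_sum n (\<lambda>k. even_basis n k (i - 1)) g)
     = pair_sum n (\<lambda>k. even_basis n k (Suc i) - (if i = 0 then 0 else even_basis n k (i - 1))) g"
    by (cases "i = 0") (simp_all add: pair_sum_linear)
  also have "\<dots> = pair_sum n (\<lambda>k. odd_basis n k i) g +
      (if i = 0 then 0 else pair_sum n (\<lambda>k. odd_basis n k (i - 1)) g)"
    unfolding even_basis_diag by (cases "i = 0") (simp_all add: pair_sum_linear)
  finally show ?thesis .
qed

text \<open>Only the parity kernel contributes to the right-hand side: the other terms cancel because
differences of even basis values are sums of neighbouring odd ones.\<close>

lemma T00_T10_diag:
  "(if i = 0 then 0 else T10 n (i - 1) j) + T10 n i j + (if i = 0 then 0 else T00 n (i - 1) j) - T00 n (Suc i) j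
     = of_bool (i = j)"
proof (cases "i = 0")
  case True
  then show ?thesis
    using parity_kernel_diag[of 0 j] even_mode_diag[of n 0] pair_sum_diag[of n 0 "\<lambda>k. even_basis n k j"]
    by (simp add: T00_eq T10_def par_def)
next
  case False
  have "par (i + 2) = par i" by (simp add: par_def)
  have "par (j + 1) * (even_mode n (Suc i) - even_mode n (i - 1)) = par (j + 1) *
      (odd_mode n i + odd_mode n (i - 1))"
    using even_mode_diag[of n i] False by simp
  then show ?thesis
    using False parity_kernel_diag[of i j] pair_sum_diag[of n i "\<lambda>k. even_basis n k j"] par_diag[of i]
    by (simp add: T00_eq T10_def algebra_simps)
qed

lemma T11_T10_diag:
  "(if i = 0 then 0 else T11 n (i - 1) j) + T11 n i j - (if i = 0 then 0 else T10 n j (i - 1)) + T10 n j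
      (Suc i) = 0"
proof (cases "i = 0")
  case True
  then show ?thesis
    using pair_sum_diag[of n 0 "\<lambda>k. odd_basis n k j"]
      pair_sum_skew[of n "\<lambda>k. even_basis n k (Suc 0)" "\<lambda>k. odd_basis n k j"]
    by (simp add: T11_def T10_def par_def) (metis add.left_inverse)
next
  case False
  then show ?thesis
    using pair_sum_diag[of n i "\<lambda>k. odd_basis n k j"] par_diag[of i]
      pair_sum_skew[of n "\<lambda>k. even_basis n k (Suc i)" "\<lambda>k. odd_basis n k j"]
      pair_sum_skew[of n "\<lambda>k. even_basis n k (i - 1)" "\<lambda>k. odd_basis n k j"]
    by (simp add: T11_def T10_def algebra_simps)
qed

lemma T11_skew: "T11 n j i = - T11 n i j"
  unfolding T11_def by (rule pair_sum_skew)

lemma T00_skew: "T00 n j i = - T00 n i j"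
  using pair_sum_skew[of n "\<lambda>k. even_basis n k j" "\<lambda>k. even_basis n k i"] by (simp add: T00_eq parity_kernel_def)

lemma even_basis_right: "k \<le> n \<Longrightarrow> even_basis n k (Suc (2 * n)) = 2 ^ (n - k)"
proof -
  assume k: "k \<le> n"
  have "even_basis n k (Suc (2 * n)) = (\<Sum>a\<le>n - k. of_nat ((n - k) choose a))"
    unfolding even_basis_def using k by (intro sum.mono_neutral_right) (auto simp: binomial_eq_0)
  also have "\<dots> = of_nat (2 ^ (n - k))" using choose_row_sum[of "n - k"] by (metis of_nat_sum)
  finally show ?thesis by simp
qed

lemma odd_basis_right: "k \<le> n \<Longrightarrow> odd_basis n k (2 * n) = of_bool (k = n)"
  by (auto simp: odd_basis_def binomial_eq_0)

text \<open>The point \<open>2 n + 1\<close> is the first one beyond the right corner. All even basis sequences take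
the value \<open>2\<^sup>n\<^sup>-\<^sup>k\<close> there, so \<open>weight_core_matrix\<close> applies.\<close>

lemma pair_sum_right_boundary:
  "pair_sum n (\<lambda>k. even_basis n k (Suc (2 * n))) g = of_bool (odd n) * (\<Sum>k\<le>n. p_coeff n k 0 * g k)"
proof -
  have "pair_sum n (\<lambda>k. even_basis n k (Suc (2 * n))) g = pair_sum n (\<lambda>k. 2 ^ (n - k)) g"
    by (intro pair_sum_cong) (simp_all add: even_basis_right)
  also have "\<dots> = (\<Sum>k\<le>n. (of_bool (odd n) * p_coeff n k 0) * g k)"
    unfolding pair_sum_right by (intro sum.cong refl) (simp add: weight_core_matrix)
  finally show ?thesis by (simp add: sum_distrib_left mult.assoc)
qed

lemma T00_right: "j \<le> 2 * n \<Longrightarrow> T00 n (Suc (2 * n)) j = of_bool (odd n) * (even_mode n j - par (j + 1))"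
proof -
  assume j: "j \<le> 2 * n"
  have "even_mode n (Suc (2 * n)) = (\<Sum>k\<le>n. 2 ^ (n - k) * p_coeff n k 0)"
    unfolding even_mode_def by (intro sum.cong refl) (simp add: even_basis_right)
  then have "even_mode n (Suc (2 * n)) = of_bool (even n)" by (simp only: p_weight_sum)
  moreover have "par (Suc (2 * n)) = 1" "par (Suc (2 * n) + 1) = 0" by (simp_all add: par_def)
  ultimately show ?thesis
    using j unfolding T00_eq pair_sum_right_boundary even_mode_def[of n j, symmetric] parity_kernel_def
    by (cases "even n") simp_all
qed

lemma T10_right: "T10 n j (Suc (2 * n)) = - of_bool (odd n) * odd_mode n j"
  using pair_sum_skew[of n "\<lambda>k. even_basis n k (Suc (2 * n))" "\<lambda>k. odd_basis n k j"]
  by (simp add: T10_def pair_sum_right_boundary odd_mode_def par_def)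

lemma pair_sum_odd_basis_right: "pair_sum n (\<lambda>k. odd_basis n k (2 * n)) g = g n - (- 1) ^ n *
    (\<Sum>k\<le>n. p_coeff n k 0 * g k)"
proof -
  have "pair_sum n (\<lambda>k. odd_basis n k (2 * n)) g = pair_sum n (\<lambda>k. of_bool (k = n)) g"
    by (intro pair_sum_cong) (simp_all add: odd_basis_right)
  also have "\<dots> = (\<Sum>k\<le>n. g k * core_matrix n n k)"
    by (simp add: pair_sum_left of_bool_def if_distrib cong: if_cong)
  also have "\<dots> = (\<Sum>k\<le>n. (if k = n then g k else 0) - (- 1) ^ n * (p_coeff n k 0 * g k))"
    by (intro sum.cong refl) (auto simp: core_matrix_last_row algebra_simps)
  finally show ?thesis by (simp add: sum_subtractf sum_distrib_left)
qed

section \<open>The candidate inverse\<close>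

lemma ext_odd_basis_low: "a < 2 * k \<Longrightarrow> ext_odd (odd_basis n k) a b = 0"
  using ext_odd_cong[of a "odd_basis n k" "\<lambda>_. 0" b] by (simp add: odd_basis_def) (simp add: ext_odd_def)

text \<open>The generating function \<open>z\<^sup>2\<^sup>k (1 + z)\<^sup>n\<^sup>-\<^sup>k\<close> turns into \<open>(-1)\<^sup>b z\<^sup>2\<^sup>k (1 + z)\<^sup>n\<^sup>-\<^sup>k\<^sup>-\<^sup>b\<close>.\<close>

lemma ext_odd_basis:
  "b \<le> n - k \<Longrightarrow> ext_odd (odd_basis n k) a b = (- 1) ^ b *
      (if 2 * k \<le> a then of_nat ((n - k - b) choose (a - 2 * k)) else 0)"
proof (induction b arbitrary: a)
  case 0
  then show ?case by (simp add: odd_basis_def)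
next
  case (Suc b)
  show ?case
  proof (cases "2 * k \<le> a")
    case False
    then show ?thesis by (simp add: ext_odd_basis_low)
  next
    case True
    then show ?thesis
    proof (induction a rule: dec_induct)
      case base
      have "ext_odd (odd_basis n k) (2 * k) (Suc b) = - ext_odd (odd_basis n k) (2 * k) b"
        using ext_odd_Suc[of "2 * k" "odd_basis n k" b] ext_odd_basis_low[of "2 * k - 1" k n "Suc b"]
        by (auto simp: add_eq_0_iff split: if_splits)
      then show ?case using Suc by simp
    next
      case (step a)
      have "n - k - b = Suc (n - k - Suc b)" using Suc.prems by simp
      moreover have "Suc a - 2 * k = Suc (a - 2 * k)" using step by simp
      moreover have "ext_odd (odd_basis n k) (Suc a) (Suc b) = - ext_odd (odd_basis n k) (Suc a) b - ext_odd
          (odd_basis n k) a (Suc b)"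
      proof -
        have "ext_odd (odd_basis n k) a (Suc b) + ext_odd (odd_basis n k) (Suc a) (Suc b) + ext_odd
            (odd_basis n k) (Suc a) b = 0"
          using ext_odd_Suc[of "Suc a" "odd_basis n k" b] by simp
        then show ?thesis by algebra
      qed
      ultimately show ?case using step Suc by (simp add: algebra_simps)
    qed
  qed
qed

text \<open>Either \<open>z\<^sup>2\<^sup>k (1 + z)\<^sup>n\<^sup>-\<^sup>k\<^sup>-\<^sup>b\<close> is a polynomial of degree less than \<open>a\<close>, or it is a power
series that starts beyond \<open>z\<^sup>a\<close>.\<close>

lemma ext_odd_basis_top:
  assumes "a + 2 * b = 2 * n + 1" "k \<le> n"
  shows "ext_odd (odd_basis n k) a b = 0"
proof (cases "b \<le> n - k")
  case True
  then have "n - k - b < a - 2 * k" using assms by auto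
  then show ?thesis using True by (simp add: ext_odd_basis binomial_eq_0)
next
  case False
  then show ?thesis using assms by (intro ext_odd_basis_low) auto
qed

text \<open>A particular solution for the column of the even vertex \<open>(c, c + 2 d)\<close> at the odd vertex \<open>(a,
a + 2 b + 1)\<close>: by \<open>source_term_even_rows\<close> its negative satisfies the rows at the even vertices off
the diagonal with the unit right-hand side. Read in the other direction, by \<open>source_term_odd_rows\<close>,
it does the same for odd columns.\<close>

definition source_term :: "nat \<Rightarrow> nat \<Rightarrow> nat \<Rightarrow> nat \<Rightarrow> complex" where
  "source_term a b c d = (- 1) ^ (b + d) * of_bool (c \<le> a \<and> b < d) * of_nat ((d - b - 1) choose (a - c))"

lemma source_term_even_rows:
  "(if a = 0 then 0 else source_term (a - 1) (Suc b) c d) + source_term a (Suc b) c d + source_term a b c d =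
      - of_bool (a = c \<and> Suc b = d)"
proof (cases "Suc b < d")
  case True
  then obtain e where e: "d = Suc (Suc (b + e))" using less_imp_Suc_add[OF True] by auto
  show ?thesis
  proof (cases "c < a")
    case True
    then obtain r where "a = Suc (c + r)" using less_imp_Suc_add[OF True] by blast
    then show ?thesis by (simp add: source_term_def e algebra_simps)
  next
    case False
    then show ?thesis by (cases "a = c") (auto simp: source_term_def e)
  qed
next
  case False
  then show ?thesis by (cases "Suc b = d"; cases "a - c") (auto simp: source_term_def)
qed

lemma source_term_odd_rows:
  "source_term c d (Suc a) b + source_term c d a b + source_term c d a (Suc b) = - of_bool (a = c \<and> b = d)"
proof (cases "d < b")
  case True
  then obtain e where e: "b = Suc (d + e)" using less_imp_Suc_add[OF True] by blast
  show ?thesis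
  proof (cases "a < c")
    case True
    then obtain r where "c = Suc (a + r)" using less_imp_Suc_add[OF True] by blast
    then show ?thesis by (simp add: source_term_def e algebra_simps)
  next
    case False
    then show ?thesis by (cases "a = c") (auto simp: source_term_def e)
  qed
next
  case False
  then show ?thesis by (cases "b = d"; cases "c - a") (auto simp: source_term_def)
qed

lemma source_term_top:
  assumes "a + 2 * b = 2 * n + 1" "c + 2 * d \<le> 2 * n + 1"
  shows "source_term a b c d = 0"
  using assms by (cases "c \<le> a \<and> b < d") (auto simp: source_term_def binomial_eq_0)

text \<open>The candidate is indexed by coordinates: \<open>(a, b)\<close> stands for the even vertex \<open>(a, a + 2 b)\<close> or
the odd vertex \<open>(a, a + 2 b + 1)\<close>, and \<open>(c, d)\<close> likewise.\<close>

definition cand_ee :: "nat \<Rightarrow> nat \<Rightarrow> nat \<Rightarrow> nat \<Rightarrow> nat \<Rightarrow> complex" where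
  "cand_ee n a b c d = ext_even (\<lambda>i. ext_even (\<lambda>j. T00 n i j) c d) a b"

definition cand_oe :: "nat \<Rightarrow> nat \<Rightarrow> nat \<Rightarrow> nat \<Rightarrow> nat \<Rightarrow> complex" where
  "cand_oe n a b c d = ext_odd (\<lambda>i. ext_even (\<lambda>j. T10 n i j) c d) a b - source_term a b c d"

definition cand_oo :: "nat \<Rightarrow> nat \<Rightarrow> nat \<Rightarrow> nat \<Rightarrow> nat \<Rightarrow> complex" where
  "cand_oo n a b c d = ext_odd (\<lambda>i. ext_odd (\<lambda>j. T11 n i j) c d) a b"

lemma cand_ee_skew: "cand_ee n c d a b = - cand_ee n a b c d"
proof -
  have "cand_ee n c d a b = ext_even (\<lambda>i. ext_even (\<lambda>j. - T00 n i j) c d) a b"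
    unfolding cand_ee_def ext_even_even_swap[of _ a b] T00_skew[symmetric] ..
  then show ?thesis by (simp only: ext_even_linear cand_ee_def)
qed

lemma cand_oo_skew: "cand_oo n c d a b = - cand_oo n a b c d"
proof -
  have "cand_oo n c d a b = ext_odd (\<lambda>i. ext_odd (\<lambda>j. - T11 n i j) c d) a b"
    unfolding cand_oo_def ext_odd_odd_swap[of _ a b] T11_skew[symmetric] ..
  then show ?thesis by (simp only: ext_odd_linear cand_oo_def)
qed

lemma cand_ee_rec: "cand_ee n (Suc a) b c d + cand_ee n a b c d + cand_ee n a (Suc b) c d = 0"
  unfolding cand_ee_def ext_even_Suc by simp

text \<open>The vertex \<open>(a, a + 2 b + 2)\<close> with \<open>a + 2 b = 2 n\<close> lies just above the graph.\<close>

lemma cand_ee_top: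
  assumes "a + 2 * b = 2 * n"
  shows "cand_ee n a (Suc b) c d = 0"
proof -
  have "even (a + 2 * b)" using assms by simp
  then obtain m where m: "a = 2 * m" by auto
  then have b: "Suc b = Suc n - m" "m \<le> n" using assms by auto
  show ?thesis
    unfolding cand_ee_def ext_even_even_swap[of _ c d] m b(1) T00_top[OF b(2)]
    by (simp add: ext_even_def)
qed

text \<open>For even \<open>n\<close> the vertex \<open>(2 n, 2 n + 1)\<close> belongs to the graph and its row lacks the neighbour
\<open>(2 n + 1, 2 n + 1)\<close>, so the continuation must vanish there.\<close>

lemma cand_ee_right:
  assumes "even n" "c \<le> 2 * n" "c + 2 * d \<le> 2 * n + 1"
  shows "cand_ee n (Suc (2 * n)) 0 c d = 0"
proof -
  have "ext_even (\<lambda>j. T00 n (Suc (2 * n)) j) c d = ext_even (\<lambda>j. 0) c d"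
    using assms by (intro ext_even_cong) (simp add: T00_right)
  then show ?thesis by (simp add: cand_ee_def ext_even_def)
qed

lemma cand_oe_rec:
  "(if a = 0 then 0 else cand_oe n (a - 1) (Suc b) c d) + cand_oe n a (Suc b) c d + cand_oe n a b c d
     = of_bool (a = c \<and> Suc b = d)"
proof -
  have sub: "(x - s) + (y - t) + (z - u) = w" if "x + y + z = 0" "s + t + u = - w" for x y z s t u w :: complex
    using that by algebra
  show ?thesis
    using sub[OF ext_odd_Suc[of a "\<lambda>i. ext_even (\<lambda>j. T10 n i j) c d" b] source_term_even_rows[of a b c d]]
    unfolding cand_oe_def by (cases "a = 0") (simp_all only: if_True if_False diff_self simp_thms)
qed

lemma ext_odd_T10_top:
  assumes "a + 2 * b = 2 * n + 1"
  shows "ext_odd (\<lambda>i. T10 n i j) a b = 0"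
proof -
  have "ext_odd (odd_mode n) a b = (\<Sum>k\<le>n. p_coeff n k 0 * ext_odd (odd_basis n k) a b)"
    unfolding odd_mode_def by (rule ext_odd_sum)
  then have "ext_odd (odd_mode n) a b = 0" using assms by (simp add: ext_odd_basis_top)
  moreover have "pair_sum n (\<lambda>k. ext_odd (odd_basis n k) a b) (\<lambda>k. even_basis n k j) = pair_sum n (\<lambda>k. 0)
      (\<lambda>k. even_basis n k j)"
    using assms by (intro pair_sum_cong) (simp_all add: ext_odd_basis_top)
  then have "pair_sum n (\<lambda>k. ext_odd (odd_basis n k) a b) (\<lambda>k. even_basis n k j) = 0"
    by (simp add: pair_sum_def)
  ultimately show ?thesis
    unfolding T10_def ext_odd_linear ext_odd_pair_sum by simp
qed

lemma cand_oe_top: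
  assumes "a + 2 * b = 2 * n + 1" "c + 2 * d \<le> 2 * n + 1"
  shows "cand_oe n a b c d = 0"
  unfolding cand_oe_def ext_odd_even_swap ext_odd_T10_top[OF assms(1)] source_term_top[OF assms]
  by (simp add: ext_even_def)

lemma ext_even_delta: "ext_even (\<lambda>j. of_bool (i = j)) c d = (- 1) ^ d *
    (if c \<le> i then of_nat (d choose (i - c)) else 0)"
proof -
  have "(\<Sum>l\<le>d. of_nat (d choose l) * of_bool (i = c + l)) =
      (\<Sum>l\<le>d. if l = i - c \<and> c \<le> i then of_nat (d choose l) else (0 :: complex))"
    by (intro sum.cong refl) auto
  also have "\<dots> = (if c \<le> i then of_nat (d choose (i - c)) else 0)"
    by (auto simp: binomial_eq_0)
  finally show ?thesis by (simp add: ext_even_def)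
qed

text \<open>If \<open>d > 0\<close>, the continued delta function and the source term cancel by Pascal's rule; if \<open>d =
0\<close>, the source term is zero and the delta function remains.\<close>

lemma cand_diag_even:
  "(if a = 0 then 0 else cand_oe n (a - 1) 0 c d) + cand_oe n a 0 c d
     + (if a = 0 then 0 else cand_ee n (a - 1) 0 c d) - cand_ee n (Suc a) 0 c d = of_bool (a = c \<and> d = 0)"
proof -
  have "(if a = 0 then 0 else ext_even (\<lambda>j. T10 n (a - 1) j) c d) + ext_even (\<lambda>j. T10 n a j) c d
     + (if a = 0 then 0 else ext_even (\<lambda>j. T00 n (a - 1) j) c d) - ext_even (\<lambda>j. T00 n (Suc a) j) c d
     = ext_even (\<lambda>j. (if a = 0 then 0 else T10 n (a - 1) j) + T10 n a j +
         (if a = 0 then 0 else T00 n (a - 1) j) - T00 n (Suc a) j) c d"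
    by (cases "a = 0") (simp_all add: ext_even_linear)
  also have "\<dots> = (- 1) ^ d * (if c \<le> a then of_nat (d choose (a - c)) else 0)"
    unfolding T00_T10_diag by (rule ext_even_delta)
  also have "\<dots> - (if a = 0 then 0 else source_term (a - 1) 0 c d) - source_term a 0 c d = of_bool (a = c \<and> d = 0)"
  proof (cases d)
    case 0
    then show ?thesis by (cases "a - c") (auto simp: source_term_def)
  next
    case (Suc d')
    show ?thesis
    proof (cases "c < a")
      case True
      then obtain r where "a = Suc (c + r)" using less_imp_Suc_add[OF True] by blast
      then show ?thesis by (simp add: source_term_def Suc algebra_simps)
    next
      case False
      then show ?thesis by (cases "a = c") (auto simp: source_term_def Suc)
    qed
  qed
  finally show ?thesis
    unfolding cand_oe_def cand_ee_def by (cases "a = 0") (simp_all add: algebra_simps)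
qed

lemma T10_T00_right:
  assumes "odd n" "j \<le> 2 * n"
  shows "T10 n (2 * n) j = T00 n (Suc (2 * n)) j"
proof -
  have "odd_mode n (2 * n) = (\<Sum>k\<le>n. if k = n then p_coeff n k 0 else 0)"
    unfolding odd_mode_def by (intro sum.cong refl) (auto simp: odd_basis_right)
  then have "odd_mode n (2 * n) = - 1" using assms by (simp add: p_coeff_n)
  moreover have "even_basis n n j = 0" using assms by (simp add: even_basis_def)
  ultimately show ?thesis
    using assms by (simp add: T10_def T00_right pair_sum_odd_basis_right even_mode_def[symmetric])
qed

text \<open>For odd \<open>n\<close> the vertices \<open>(2 n, 2 n + 1)\<close> and \<open>(2 n + 1, 2 n + 1)\<close> are both missing, and only
their joint contribution to the row at \<open>(2 n, 2 n)\<close> has to vanish.\<close>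

lemma cand_right_even:
  assumes "odd n" "c \<le> 2 * n" "c + 2 * d \<le> 2 * n + 1"
  shows "cand_oe n (2 * n) 0 c d = cand_ee n (Suc (2 * n)) 0 c d"
proof -
  have "ext_even (\<lambda>j. T10 n (2 * n) j) c d = ext_even (\<lambda>j. T00 n (Suc (2 * n)) j) c d"
    using assms by (intro ext_even_cong) (simp add: T10_T00_right)
  moreover have "source_term (2 * n) 0 c d = 0" using assms by (cases d) (auto simp: source_term_def binomial_eq_0)
  ultimately show ?thesis by (simp add: cand_oe_def cand_ee_def)
qed

lemma cand_eo_rec:
  "cand_oe n c d (Suc a) b + cand_oe n c d a b + cand_oe n c d a (Suc b) = of_bool (a = c \<and> b = d)"
proof -
  have sub: "(y' - s) + (y - t) + (z - u) = w" if "z = - (y + y')" "s + t + u = - w" for y y' z s t u w :: complex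
    using that by algebra
  show ?thesis
    unfolding cand_oe_def ext_odd_even_swap by (rule sub[OF ext_even_Suc source_term_odd_rows])
qed

text \<open>The boundary value of \<open>T10\<close>, a continued odd basis sequence, is exactly the source term.\<close>

lemma cand_eo_top:
  assumes "a + 2 * b = 2 * n" "c + 2 * d \<le> 2 * n"
  shows "cand_oe n c d a (Suc b) = 0"
proof -
  have "even (a + 2 * b)" using assms by simp
  then obtain m where m: "a = 2 * m" by auto
  then have b: "Suc b = Suc n - m" "m \<le> n" using assms by auto
  have "ext_odd (\<lambda>i. ext_even (\<lambda>j. T10 n i j) a (Suc b)) c d = (- 1) ^ Suc b * ext_odd (odd_basis n m) c d"
    unfolding m b(1) T10_top[OF b(2)] ext_odd_linear ..
  also have "\<dots> = source_term c d a (Suc b)"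
  proof (cases "d \<le> n - m")
    case True
    moreover have "n - m = b" using b by simp
    ultimately show ?thesis using m by (simp add: ext_odd_basis source_term_def power_add)
  next
    case False
    then have "c < 2 * m" using assms m by auto
    then show ?thesis using m by (simp add: ext_odd_basis_low source_term_def)
  qed
  finally show ?thesis by (simp add: cand_oe_def)
qed

lemma cand_eo_right:
  assumes "even n"
  shows "cand_oe n c d (Suc (2 * n)) 0 = 0"
  using assms by (simp add: cand_oe_def T10_right source_term_def) (simp add: ext_odd_def)

lemma cand_oo_rec:
  "(if a = 0 then 0 else cand_oo n (a - 1) (Suc b) c d) + cand_oo n a (Suc b) c d + cand_oo n a b c d = 0"
  unfolding cand_oo_def by (rule ext_odd_Suc)

lemma cand_oo_top:
  assumes "a + 2 * b = 2 * n + 1"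
  shows "cand_oo n a b c d = 0"
proof -
  have "pair_sum n (\<lambda>k. ext_odd (odd_basis n k) a b) (\<lambda>k. odd_basis n k j) = pair_sum n (\<lambda>k. 0)
      (\<lambda>k. odd_basis n k j)" for j
    using assms by (intro pair_sum_cong) (simp_all add: ext_odd_basis_top)
  then have "ext_odd (\<lambda>i. T11 n i j) a b = 0" for j
    unfolding T11_def ext_odd_pair_sum by (simp add: pair_sum_def)
  then show ?thesis
    unfolding cand_oo_def ext_odd_odd_swap[of _ c d] by (simp add: ext_odd_def)
qed

lemma cand_diag_odd:
  "(if a = 0 then 0 else cand_oo n (a - 1) 0 c d) + cand_oo n a 0 c d
     - (if a = 0 then 0 else cand_oe n c d (a - 1) 0) + cand_oe n c d (Suc a) 0 = 0"
proof -
  have "(if a = 0 then 0 else ext_odd (\<lambda>j. T11 n (a - 1) j) c d) + ext_odd (\<lambda>j. T11 n a j) c d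
     - (if a = 0 then 0 else ext_odd (\<lambda>j. T10 n j (a - 1)) c d) + ext_odd (\<lambda>j. T10 n j (Suc a)) c d
     = ext_odd (\<lambda>j. (if a = 0 then 0 else T11 n (a - 1) j) + T11 n a j -
         (if a = 0 then 0 else T10 n j (a - 1)) + T10 n j (Suc a)) c d"
    by (cases "a = 0") (simp_all add: ext_odd_linear)
  also have "\<dots> = 0" unfolding T11_T10_diag by (simp add: ext_odd_def)
  finally show ?thesis
    by (cases "a = 0") (simp_all add: cand_oo_def cand_oe_def source_term_def)
qed

lemma cand_right_odd:
  assumes "odd n" "c < 2 * n"
  shows "cand_oo n (2 * n) 0 c d = - cand_oe n c d (Suc (2 * n)) 0"
proof -
  have "T11 n (2 * n) j = - T10 n j (Suc (2 * n))" if "j \<le> c" for j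
  proof -
    have "odd_basis n n j = 0" using assms that by (simp add: odd_basis_def)
    then show ?thesis using assms by (simp add: T11_def T10_right pair_sum_odd_basis_right odd_mode_def[symmetric])
  qed
  then have "ext_odd (\<lambda>j. T11 n (2 * n) j) c d = ext_odd (\<lambda>j. - T10 n j (Suc (2 * n))) c d"
    by (intro ext_odd_cong)
  then show ?thesis by (simp add: cand_oo_def cand_oe_def ext_odd_linear source_term_def)
qed

section \<open>Rows of the Kasteleyn matrix\<close>

text \<open>For \<open>e\<close> equal to zero or one, \<open>e\<close> is the parity of the coordinate sum.\<close>

definition vtx :: "nat \<Rightarrow> nat \<Rightarrow> nat \<Rightarrow> int \<times> int" where
  "vtx a b e = (int a, int (a + 2 * b + e))"

lemma vtx_in_G_verts:
  "vtx a b e \<in> G_verts n \<longleftrightarrow> a \<le> 2 * n \<and> a + 2 * b + e \<le> 2 * n + 1 \<and> \<not> (odd n \<and> a = 2 * n \<and> b = 0 \<and> e = 1)"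
  by (auto simp: vtx_def G_verts_def; presburger)

lemma G_verts_vtx:
  assumes "x \<in> G_verts n"
  obtains a b e where "x = vtx a b e" "e = 0 \<or> e = 1"
proof -
  obtain x1 x2 where x: "x = (x1, x2)" by (cases x)
  then have "0 \<le> x1" "x1 \<le> x2" using assms by (auto simp: G_verts_def split: if_splits)
  then have "x = vtx (nat x1) (nat (x2 - x1) div 2) (nat (x2 - x1) mod 2)"
    unfolding x vtx_def by (simp add: int_ops nat_diff_distrib)
  then show ?thesis using that by (metis not_mod_2_eq_1_eq_0)
qed

lemma sum_of_bool_point: "finite V \<Longrightarrow> (\<Sum>z\<in>V. of_bool (z = w) * g z) = (if w \<in> V then g w else (0 :: complex))"
  by (simp add: of_bool_def if_distrib if_distribR cong: if_cong)

lemma abs_diff_eq_1_iff: "\<bar>u - v\<bar> = 1 \<longleftrightarrow> u = v + 1 \<or> u = v - (1 :: int)"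
  by linarith

text \<open>These expansions hold for all integer points \<open>z\<close>, whether or not they are vertices; neighbours
outside the graph are dropped only when the row is summed.\<close>

lemma kasteleyn_odd: "kasteleyn (vtx a b 1) z
   = - (of_bool (z = vtx (Suc a) b 0) + of_bool (z = vtx a b 0) + of_bool (z = vtx a (Suc b) 0))"
proof -
  obtain z1 z2 where z: "z = (z1, z2)" by (cases z)
  have o: "(int a + int (a + 2 * b + 1)) mod 2 = 1" by presburger
  have e: "kasteleyn_orient (vtx a b 1) z = 0"
    unfolding kasteleyn_orient_def vtx_def z prod.case o by simp
  have "((z1 + z2) mod 2 = 0 \<and> z2 = int (a + 2 * b + 1) \<and> z1 - int a = 1 \<or>
      (z1 + z2) mod 2 = 0 \<and> \<bar>int (a + 2 * b + 1) - z2\<bar> = 1 \<and> z1 = int a \<or>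
      z1 = z2 \<and> int a = z1 - 1 \<and> int (a + 2 * b + 1) = z1 - 1)
    \<longleftrightarrow> z1 = int (Suc a) \<and> z2 = int (Suc a + 2 * b + 0) \<or> z1 = int a \<and> z2 = int (a + 2 * b + 0)
      \<or> z1 = int a \<and> z2 = int (a + 2 * Suc b + 0)"
    by presburger
  then have "kasteleyn_orient z (vtx a b 1) = of_bool (z = vtx (Suc a) b 0 \<or> z = vtx a b 0 \<or> z = vtx a (Suc b) 0)"
    unfolding kasteleyn_orient_def vtx_def z prod.case prod.inject by simp
  moreover have "vtx (Suc a) b 0 \<noteq> vtx a b 0" "vtx (Suc a) b 0 \<noteq> vtx a (Suc b) 0" "vtx a b 0 \<noteq> vtx a (Suc b) 0"
    by (simp_all add: vtx_def)
  ultimately show ?thesis unfolding kasteleyn_def e by auto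
qed

lemma kasteleyn_even: "kasteleyn (vtx a (Suc b) 0) z
   = of_bool (a > 0 \<and> z = vtx (a - 1) (Suc b) 1) + of_bool (a = 0 \<and> z = (- 1, int (a + 2 * Suc b)))
     + of_bool (z = vtx a (Suc b) 1) + of_bool (z = vtx a b 1)"
proof -
  obtain z1 z2 where z: "z = (z1, z2)" by (cases z)
  have o: "(int a + int (a + 2 * Suc b + 0)) mod 2 = 0" by presburger
  have e: "kasteleyn_orient z (vtx a (Suc b) 0) = 0"
  proof -
    have "\<not> ((z1 + z2) mod 2 = 0 \<and> z2 = int (a + 2 * Suc b + 0) \<and> z1 - int a = 1 \<or>
      (z1 + z2) mod 2 = 0 \<and> \<bar>int (a + 2 * Suc b + 0) - z2\<bar> = 1 \<and> z1 = int a \<or>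
      z1 = z2 \<and> int a = z1 - 1 \<and> int (a + 2 * Suc b + 0) = z1 - 1)" by presburger
    then show ?thesis unfolding kasteleyn_orient_def vtx_def z prod.case by simp
  qed
  have "((int a + int (a + 2 * Suc b + 0)) mod 2 = 0 \<and> int (a + 2 * Suc b + 0) = z2 \<and> int a - z1 = 1 \<or>
      (int a + int (a + 2 * Suc b + 0)) mod 2 = 0 \<and> \<bar>z2 - int (a + 2 * Suc b + 0)\<bar> = 1 \<and> int a = z1 \<or>
      int a = int (a + 2 * Suc b + 0) \<and> z1 = int a - 1 \<and> z2 = int a - 1)
    \<longleftrightarrow> (a > 0 \<and> z1 = int (a - 1) \<and> z2 = int (a - 1 + 2 * Suc b + 1)) \<or> (a = 0 \<and> z1 = - 1 \<and> z2 = int (a + 2 * Suc b))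
      \<or> z1 = int a \<and> z2 = int (a + 2 * Suc b + 1) \<or> z1 = int a \<and> z2 = int (a + 2 * b + 1)"
    unfolding o abs_diff_eq_1_iff by (cases a) auto
  then have k: "kasteleyn_orient (vtx a (Suc b) 0) z
     = of_bool ((a > 0 \<and> z = vtx (a - 1) (Suc b) 1) \<or> (a = 0 \<and> z = (- 1, int (a + 2 * Suc b))) \<or> z = vtx a
         (Suc b) 1 \<or> z = vtx a b 1)"
    unfolding kasteleyn_orient_def vtx_def z prod.case prod.inject by simp
  show ?thesis unfolding kasteleyn_def e k by (cases "a = 0") (auto simp: vtx_def z)
qed

lemma kasteleyn_diag: "kasteleyn (vtx a 0 0) z
   = of_bool (a > 0 \<and> z = vtx (a - 1) 0 1) + of_bool (a > 0 \<and> z = vtx (a - 1) 0 0)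
     + of_bool (a = 0 \<and> z = (- 1, 0)) + of_bool (a = 0 \<and> z = (- 1, - 1))
     + of_bool (z = vtx a 0 1) + of_bool (z = (int a, int a - 1)) - of_bool (z = vtx (Suc a) 0 0)"
proof -
  obtain z1 z2 where z: "z = (z1, z2)" by (cases z)
  have o: "(int a + int (a + 2 * 0 + 0)) mod 2 = 0" by presburger
  have "((z1 + z2) mod 2 = 0 \<and> z2 = int (a + 2 * 0 + 0) \<and> z1 - int a = 1 \<or>
      (z1 + z2) mod 2 = 0 \<and> \<bar>int (a + 2 * 0 + 0) - z2\<bar> = 1 \<and> z1 = int a \<or>
      z1 = z2 \<and> int a = z1 - 1 \<and> int (a + 2 * 0 + 0) = z1 - 1)
     \<longleftrightarrow> z1 = int (Suc a) \<and> z2 = int (Suc a + 2 * 0 + 0)" by presburger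
  then have e: "kasteleyn_orient z (vtx a 0 0) = of_bool (z = vtx (Suc a) 0 0)"
    unfolding kasteleyn_orient_def vtx_def z prod.case prod.inject by simp
  have "((int a + int (a + 2 * 0 + 0)) mod 2 = 0 \<and> int (a + 2 * 0 + 0) = z2 \<and> int a - z1 = 1 \<or>
      (int a + int (a + 2 * 0 + 0)) mod 2 = 0 \<and> \<bar>z2 - int (a + 2 * 0 + 0)\<bar> = 1 \<and> int a = z1 \<or>
      int a = int (a + 2 * 0 + 0) \<and> z1 = int a - 1 \<and> z2 = int a - 1)
    \<longleftrightarrow> (a > 0 \<and> z1 = int (a - 1) \<and> z2 = int (a - 1 + 2 * 0 + 1)) \<or>
        (a > 0 \<and> z1 = int (a - 1) \<and> z2 = int (a - 1 + 2 * 0 + 0))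
      \<or> (a = 0 \<and> z1 = - 1 \<and> z2 = 0) \<or> (a = 0 \<and> z1 = - 1 \<and> z2 = - 1)
      \<or> z1 = int a \<and> z2 = int (a + 2 * 0 + 1) \<or> z1 = int a \<and> z2 = int a - 1"
    unfolding o abs_diff_eq_1_iff by (cases a) auto
  then have k: "kasteleyn_orient (vtx a 0 0) z
     = of_bool ((a > 0 \<and> z = vtx (a - 1) 0 1) \<or> (a > 0 \<and> z = vtx (a - 1) 0 0) \<or> (a = 0 \<and> z = (- 1, 0)) \<or>
         (a = 0 \<and> z = (- 1, - 1))
        \<or> z = vtx a 0 1 \<or> z = (int a, int a - 1))"
    unfolding kasteleyn_orient_def vtx_def z prod.case prod.inject by simp
  show ?thesis unfolding kasteleyn_def e k by (cases "a = 0") (auto simp: vtx_def z)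
qed

text \<open>The rows of \<open>K\<close> on the finite graph are the unrestricted three-term relations and diagonal
relations minus the contributions of missing neighbours. The relations do not refer to neighbours to
the left of the graph or below the diagonal; those above or to the right contribute zero by the
boundary conditions.\<close>

lemma kasteleyn_column:
  fixes Ev Od :: "nat \<Rightarrow> nat \<Rightarrow> complex"
  assumes g0: "\<And>a b. g (vtx a b 0) = Ev a b" and g1: "\<And>a b. g (vtx a b 1) = Od a b"
    and odd_rows: "\<And>a b. Ev (Suc a) b + Ev a b + Ev a (Suc b) = - r1 a b"
    and even_rows: "\<And>a b. (if a = 0 then 0 else Od (a - 1) (Suc b)) + Od a (Suc b) + Od a b = r0 a (Suc b)"
    and diag_rows: "\<And>a. (if a = 0 then 0 else Od (a - 1) 0) + Od a 0 + (if a = 0 then 0 else Ev (a - 1) 0)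
        - Ev (Suc a) 0 = r0 a 0"
    and top_E: "\<And>a b. a + 2 * b = 2 * n \<Longrightarrow> Ev a (Suc b) = 0"
    and top_O: "\<And>a b. a + 2 * b = 2 * n + 1 \<Longrightarrow> Od a b = 0"
    and right_even: "even n \<Longrightarrow> Ev (Suc (2 * n)) 0 = 0"
    and right_odd: "odd n \<Longrightarrow> Od (2 * n) 0 = Ev (Suc (2 * n)) 0"
    and x: "vtx a b e \<in> G_verts n" "e = 0 \<or> e = 1"
  shows "(\<Sum>z\<in>G_verts n. kasteleyn (vtx a b e) z * g z) = (if e = 0 then r0 a b else r1 a b)"
proof -
  let ?V = "G_verts n"
  let ?pt = "\<lambda>w. if w \<in> ?V then g w else 0"
  note pt = sum_of_bool_point[OF finite_G_verts[of n]]
  consider "e = 1" | b' where "e = 0" "b = Suc b'" | "e = 0" "b = 0"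
    using x(2) by (cases b) auto
  then show ?thesis
  proof cases
    case 1
    have "(\<Sum>z\<in>?V. kasteleyn (vtx a b e) z * g z)
       = - (\<Sum>z\<in>?V. of_bool (z = vtx (Suc a) b 0) * g z + of_bool (z = vtx a b 0) * g z + of_bool
           (z = vtx a (Suc b) 0) * g z)"
      unfolding sum_negf[symmetric] 1 kasteleyn_odd by (intro sum.cong refl)
          (simp only: distrib_right minus_mult_left[symmetric])
    also have "\<dots> = - (?pt (vtx (Suc a) b 0) + ?pt (vtx a b 0) + ?pt (vtx a (Suc b) 0))"
      by (simp only: sum.distrib pt)
    also have "?pt (vtx (Suc a) b 0) = Ev (Suc a) b"
    proof (cases "a = 2 * n")
      case True
      then show ?thesis using x 1 right_even by (auto simp: vtx_in_G_verts g0)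
    qed (use x 1 in \<open>simp add: vtx_in_G_verts g0\<close>)
    also have "?pt (vtx a b 0) = Ev a b" using x 1 by (simp add: vtx_in_G_verts g0)
    also have "?pt (vtx a (Suc b) 0) = Ev a (Suc b)"
    proof (cases "a + 2 * b = 2 * n")
      case True
      then show ?thesis by (simp add: vtx_in_G_verts g0 top_E)
    qed (use x 1 in \<open>simp add: vtx_in_G_verts g0\<close>)
    finally show ?thesis using 1 odd_rows[of a b] by simp
  next
    case 2
    have "(\<Sum>z\<in>?V. kasteleyn (vtx a b e) z * g z)
       = (\<Sum>z\<in>?V. of_bool (a > 0) * (of_bool (z = vtx (a - 1) b 1) * g z)
          + of_bool (a = 0) * (of_bool (z = (- 1, int (a + 2 * Suc b'))) * g z)
          + of_bool (z = vtx a b 1) * g z + of_bool (z = vtx a b' 1) * g z)"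
      unfolding 2 kasteleyn_even by (intro sum.cong refl) (simp only: distrib_right of_bool_conj mult.assoc)
    also have "\<dots> = of_bool (a > 0) * ?pt (vtx (a - 1) b 1) + of_bool (a = 0) * ?pt (- 1, int (a + 2 * Suc b'))
        + ?pt (vtx a b 1) + ?pt (vtx a b' 1)"
      by (simp only: sum.distrib sum_distrib_left[symmetric] pt)
    also have "of_bool (a > 0) * ?pt (vtx (a - 1) b 1) = (if a = 0 then 0 else Od (a - 1) (Suc b'))"
      using x 2 by (auto simp: vtx_in_G_verts g1 g1[unfolded One_nat_def])
    also have "?pt (- 1, int (a + 2 * Suc b')) = 0" by (simp add: G_verts_def)
    also have "?pt (vtx a b 1) = Od a (Suc b')"
    proof (cases "a + 2 * b = 2 * n + 1")
      case True
      then show ?thesis using 2 top_O[of a b] by (simp add: vtx_in_G_verts)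
    next
      case False
      then show ?thesis using x 2 g1 by (auto simp: vtx_in_G_verts)
    qed
    also have "?pt (vtx a b' 1) = Od a b'" using x 2 g1 by (auto simp: vtx_in_G_verts)
    finally show ?thesis using 2 even_rows[of a b'] by simp
  next
    case 3
    have "(\<Sum>z\<in>?V. kasteleyn (vtx a b e) z * g z)
       = (\<Sum>z\<in>?V. of_bool (a > 0) * (of_bool (z = vtx (a - 1) 0 1) * g z)
          + of_bool (a > 0) * (of_bool (z = vtx (a - 1) 0 0) * g z)
          + of_bool (a = 0) * (of_bool (z = (- 1, 0)) * g z) + of_bool (a = 0) * (of_bool (z = (- 1, - 1)) * g z)
          + of_bool (z = vtx a 0 1) * g z + of_bool (z = (int a, int a - 1)) * g z
          - of_bool (z = vtx (Suc a) 0 0) * g z)"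
      unfolding 3 kasteleyn_diag by (intro sum.cong refl)
          (simp only: distrib_right left_diff_distrib of_bool_conj mult.assoc)
    also have "\<dots> = of_bool (a > 0) * ?pt (vtx (a - 1) 0 1) + of_bool (a > 0) * ?pt (vtx (a - 1) 0 0)
          + of_bool (a = 0) * ?pt (- 1, 0) + of_bool (a = 0) * ?pt (- 1, - 1)
          + ?pt (vtx a 0 1) + ?pt (int a, int a - 1) - ?pt (vtx (Suc a) 0 0)"
      by (simp only: sum.distrib sum_subtractf sum_distrib_left[symmetric] pt)
    also have "of_bool (a > 0) * ?pt (vtx (a - 1) 0 1) = (if a = 0 then 0 else Od (a - 1) 0)"
      using x 3 g1 by (auto simp: vtx_in_G_verts)
    also have "of_bool (a > 0) * ?pt (vtx (a - 1) 0 0) = (if a = 0 then 0 else Ev (a - 1) 0)"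
      using x 3 by (auto simp: vtx_in_G_verts g0)
    also have "?pt (- 1, 0) = 0" by (simp add: G_verts_def)
    also have "?pt (- 1, - 1) = 0" by (simp add: G_verts_def)
    also have "?pt (int a, int a - 1) = 0" by (simp add: G_verts_def)
    finally have sum: "(\<Sum>z\<in>?V. kasteleyn (vtx a b e) z * g z)
       = (if a = 0 then 0 else Od (a - 1) 0) + (if a = 0 then 0 else Ev (a - 1) 0) +
           (?pt (vtx a 0 1) - ?pt (vtx (Suc a) 0 0))"
      by (simp add: algebra_simps)
    have d: "?pt (vtx a 0 1) - ?pt (vtx (Suc a) 0 0) = Od a 0 - Ev (Suc a) 0"
    proof (cases "a = 2 * n")
      case True
      then show ?thesis using x 3 right_even right_odd g0[of "Suc a" 0] g1[of a 0]
        by (cases "even n") (auto simp: vtx_in_G_verts)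
    next
      case False
      then show ?thesis using x 3 g0[of "Suc a" 0] g1[of a 0] by (auto simp: vtx_in_G_verts)
    qed
    show ?thesis unfolding sum d using 3 diag_rows[of a] by (simp add: algebra_simps)
  qed
qed

section \<open>The inverse of the Kasteleyn matrix\<close>

definition cand :: "nat \<Rightarrow> int \<times> int \<Rightarrow> int \<times> int \<Rightarrow> complex" where
  "cand n x y = (let a = nat (fst x); b = nat (snd x - fst x) div 2; e = nat (snd x - fst x) mod 2;
       c = nat (fst y); d = nat (snd y - fst y) div 2; e' = nat (snd y - fst y) mod 2 in
     if e = 0 then (if e' = 0 then cand_ee n a b c d else - cand_oe n c d a b)
     else (if e' = 0 then cand_oe n a b c d else cand_oo n a b c d))"

lemma cand_vtx:
  "cand n (vtx a b 0) (vtx c d 0) = cand_ee n a b c d" "cand n (vtx a b 1) (vtx c d 0) = cand_oe n a b c d"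
  "cand n (vtx a b 0) (vtx c d 1) = - cand_oe n c d a b" "cand n (vtx a b 1) (vtx c d 1) = cand_oo n a b c d"
proof -
  have "nat (int a) = a" "nat (int (a + 2 * b + 0) - int a) = 2 * b" "nat (int (a + 2 * b + 1) - int a) = 2
      * b + 1"
    for a b by auto
  then show "cand n (vtx a b 0) (vtx c d 0) = cand_ee n a b c d" "cand n (vtx a b 1) (vtx c d 0)
      = cand_oe n a b c d"
    "cand n (vtx a b 0) (vtx c d 1) = - cand_oe n c d a b" "cand n (vtx a b 1) (vtx c d 1) = cand_oo n a b c d"
    by (simp_all only: cand_def vtx_def fst_conv snd_conv Let_def) simp_all
qed

lemma cand_skew: "cand n y x = - cand n x y"
  unfolding cand_def Let_def by (simp add: cand_ee_skew[of n "nat (fst x)" _ "nat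
      (fst y)"] cand_oo_skew[of n "nat (fst x)" _ "nat (fst y)"])

lemma vtx_eq_iff: "vtx a b 0 = vtx c d 0 \<longleftrightarrow> a = c \<and> b = d" "vtx a b 1 = vtx c d 1 \<longleftrightarrow> a = c \<and> b = d"
  "vtx a b 0 \<noteq> vtx c d 1" "vtx a b 1 \<noteq> vtx c d 0"
  by (auto simp: vtx_def; presburger)+

lemma kasteleyn_cand:
  assumes "x \<in> G_verts n" "y \<in> G_verts n"
  shows "(\<Sum>z\<in>G_verts n. kasteleyn x z * cand n z y) = of_bool (x = y)"
proof -
  obtain a b e where x: "x = vtx a b e" "e = 0 \<or> e = 1" using G_verts_vtx[OF assms(1)] by blast
  obtain c d e' where y: "y = vtx c d e'" "e' = 0 \<or> e' = 1" using G_verts_vtx[OF assms(2)] by blast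
  have y_in: "c \<le> 2 * n" "c + 2 * d + e' \<le> 2 * n + 1" "\<not> (odd n \<and> c = 2 * n \<and> d = 0 \<and> e' = 1)"
    using assms(2) unfolding y vtx_in_G_verts by auto
  show ?thesis
    using y(2)
  proof
    assume e': "e' = 0"
    have "(\<Sum>z\<in>G_verts n. kasteleyn (vtx a b e) z * cand n z (vtx c d 0))
       = (if e = 0 then of_bool (a = c \<and> b = d) else 0)"
    proof (rule kasteleyn_column[where Ev = "\<lambda>a b. cand_ee n a b c d" and Od = "\<lambda>a b. cand_oe n a b c d"
          and ?r0.0 = "\<lambda>a b. of_bool (a = c \<and> b = d)" and ?r1.0 = "\<lambda>_ _. 0"])
      show "(if a = 0 then 0 else cand_oe n (a - 1) 0 c d) + cand_oe n a 0 c d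
           + (if a = 0 then 0 else cand_ee n (a - 1) 0 c d) - cand_ee n (Suc a) 0 c d = of_bool
               (a = c \<and> 0 = d)" for a
        using cand_diag_even[of a n c d] by (simp only: eq_commute[of 0 d])
      show "cand_oe n (2 * n) 0 c d = cand_ee n (Suc (2 * n)) 0 c d" if "odd n"
        using cand_right_even[OF that, of c d] y_in e' by simp
    qed (use y_in e' assms x in \<open>simp_all only: cand_vtx cand_ee_rec cand_oe_rec cand_ee_top cand_oe_top
          cand_ee_right cand_right_even add_0_right minus_zero\<close>)
    then show ?thesis using x(2) by (auto simp: x(1) y(1) e' vtx_eq_iff vtx_eq_iff[unfolded One_nat_def])
  next
    assume e': "e' = 1"
    have "(\<Sum>z\<in>G_verts n. kasteleyn (vtx a b e) z * cand n z (vtx c d 1))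
       = (if e = 0 then 0 else of_bool (a = c \<and> b = d))"
    proof (rule kasteleyn_column[where Ev = "\<lambda>a b. - cand_oe n c d a b" and Od = "\<lambda>a b. cand_oo n a b c d"
          and ?r0.0 = "\<lambda>_ _. 0" and ?r1.0 = "\<lambda>a b. of_bool (a = c \<and> b = d)"])
      show "- cand_oe n c d (Suc a) b + - cand_oe n c d a b + - cand_oe n c d a (Suc b) = - of_bool
          (a = c \<and> b = d)" for a b
        using cand_eo_rec[of n c d a b] by (simp only: minus_add_distrib[symmetric])
      show "(if a = 0 then 0 else cand_oo n (a - 1) 0 c d) + cand_oo n a 0 c d
           + (if a = 0 then 0 else - cand_oe n c d (a - 1) 0) - - cand_oe n c d (Suc a) 0 = 0" for a
        using cand_diag_odd[of a n c d] by (cases "a = 0") simp_all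
      show "cand_oo n (2 * n) 0 c d = - cand_oe n c d (Suc (2 * n)) 0" if "odd n"
      proof (rule cand_right_odd[OF that])
        show "c < 2 * n" using that y_in e' by (cases "c = 2 * n") auto
      qed
      show "- cand_oe n c d a (Suc b) = 0" if "a + 2 * b = 2 * n" for a b
        using cand_eo_top[OF that, of c d] y_in e' by simp
    qed (use y_in e' assms x in \<open>simp_all only: cand_vtx cand_oo_rec cand_oo_top cand_eo_right minus_zero\<close>)
    then show ?thesis using x(2) by (auto simp: x(1) y(1) e' vtx_eq_iff vtx_eq_iff[unfolded One_nat_def])
  qed
qed

text \<open>Both \<open>K\<close> and the candidate are skew, so the second equation is the transpose of the first.\<close>

lemma is_inverse_cand: "is_inverse_on (G_verts n) kasteleyn (cand n)"
  unfolding is_inverse_on_def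
proof (intro conjI ballI)
  fix x y assume xy: "x \<in> G_verts n" "y \<in> G_verts n"
  show "(\<Sum>z\<in>G_verts n. kasteleyn x z * cand n z y) = of_bool (x = y)"
    using xy by (rule kasteleyn_cand)
  have "(\<Sum>z\<in>G_verts n. cand n x z * kasteleyn z y) = (\<Sum>z\<in>G_verts n. kasteleyn y z * cand n z x)"
  proof (intro sum.cong refl)
    fix z show "cand n x z * kasteleyn z y = kasteleyn y z * cand n z x"
      using cand_skew[of n x z] kasteleyn_skew[of z y] by simp
  qed
  then show "(\<Sum>z\<in>G_verts n. cand n x z * kasteleyn z y) = of_bool (x = y)"
    using kasteleyn_cand[OF xy(2,1)] by (simp add: eq_commute)
qed

lemma kasteleyn_inv_eq_cand:
  assumes "x \<in> G_verts n" "y \<in> G_verts n"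
  shows "kasteleyn_inv n x y = cand n x y"
proof (rule is_inverse_on_unique[OF finite_G_verts _ is_inverse_cand assms])
  show "is_inverse_on (G_verts n) kasteleyn (kasteleyn_inv n)"
    unfolding kasteleyn_inv_def matrix_inv_on_def by (rule someI[of _ "cand n"]) (rule is_inverse_cand)
qed

theorem theorem3p2:
  fixes n i1 i2 j1 j2 \<epsilon>i \<epsilon>j :: nat and x1 x2 y1 y2 :: int and \<rho> :: real
  assumes "n \<ge> 1" and "0 < \<rho>" and "\<rho> < 1"
    and "(x1, x2) = (int i1, int (i1 + 2 * i2 + \<epsilon>i))"
    and "(y1, y2) = (int j1, int (j1 + 2 * j2 + \<epsilon>j))"
    and "i1 \<le> 2 * n - 1" and "j1 \<le> 2 * n - 1"
    and "\<epsilon>i \<in> {0, 1}" and "\<epsilon>j \<in> {0, 1}"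
    and "i2 \<le> n - (i1 + \<epsilon>i) div 2" and "j2 \<le> n - (j1 + \<epsilon>j) div 2"
  shows
    "(\<epsilon>i = 1 \<and> \<epsilon>j = 1 \<longrightarrow>
       kasteleyn_inv n (x1, x2) (y1, y2) =
         (\<Sum>l1\<le>i1. \<Sum>l2\<le>j1. (- 1) ^ (i2 + j2) * (- 1) ^ (l1 + l2)
            * ((of_nat i2 - 1 + of_nat l1) gchoose l1) * ((of_nat j2 - 1 + of_nat l2) gchoose l2)
            * t11 \<rho> n (i1 - l1) (j1 - l2))) \<and>
     (\<epsilon>i = 0 \<and> \<epsilon>j = 0 \<longrightarrow>
       kasteleyn_inv n (x1, x2) (y1, y2) =
         (\<Sum>l1\<le>i2. \<Sum>l2\<le>j2. (- 1) ^ (i2 + j2)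
            * of_nat (i2 choose l1) * of_nat (j2 choose l2)
            * t00 \<rho> n (i1 + l1) (j1 + l2))) \<and>
     (\<epsilon>i = 1 \<and> \<epsilon>j = 0 \<longrightarrow>
       kasteleyn_inv n (x1, x2) (y1, y2) =
         (\<Sum>l1\<le>i1. \<Sum>l2\<le>j2. (- 1) ^ (i2 + j2) * (- 1) ^ l1
            * ((of_nat i2 - 1 + of_nat l1) gchoose l1) * of_nat (j2 choose l2)
            * t10 \<rho> n (i1 - l1) (j1 + l2))
         - (- 1) ^ (i2 + j2) * of_bool (x1 \<ge> y1) * of_bool (x1 + x2 < y1 + y2)
            * ((of_nat j2 - of_nat i2 - 1) gchoose (i1 - j1)))"
proof -
  have x: "(x1, x2) = vtx i1 i2 \<epsilon>i" and y: "(y1, y2) = vtx j1 j2 \<epsilon>j"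
    using assms by (simp_all add: vtx_def)
  have in_verts: "vtx a b e \<in> G_verts n" if "a \<le> 2 * n - 1" "e \<in> {0, 1}" "b \<le> n - (a + e) div 2" for a b e
  proof -
    have "(a + e) div 2 \<le> n" using that assms(1) by auto
    then have "2 * b + (a + e) \<le> 2 * n + 1" using that(3) by linarith
    then show ?thesis using that assms(1) by (auto simp: vtx_in_G_verts)
  qed
  have inv: "kasteleyn_inv n (x1, x2) (y1, y2) = cand n (vtx i1 i2 \<epsilon>i) (vtx j1 j2 \<epsilon>j)"
    unfolding x y using assms by (intro kasteleyn_inv_eq_cand in_verts) auto
  note t = t_algebraic[OF assms(2,3)]
  show ?thesis
  proof (intro conjI impI)
    assume e: "\<epsilon>i = 1 \<and> \<epsilon>j = 1"
    show "kasteleyn_inv n (x1, x2) (y1, y2) =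
         (\<Sum>l1\<le>i1. \<Sum>l2\<le>j1. (- 1) ^ (i2 + j2) * (- 1) ^ (l1 + l2)
            * ((of_nat i2 - 1 + of_nat l1) gchoose l1) * ((of_nat j2 - 1 + of_nat l2) gchoose l2)
            * t11 \<rho> n (i1 - l1) (j1 - l2))"
      unfolding inv e[THEN conjunct1] e[THEN conjunct2] cand_vtx t cand_oo_def ext_odd_def
      by (simp add: sum_distrib_left power_add mult_ac)
  next
    assume e: "\<epsilon>i = 0 \<and> \<epsilon>j = 0"
    show "kasteleyn_inv n (x1, x2) (y1, y2) =
         (\<Sum>l1\<le>i2. \<Sum>l2\<le>j2. (- 1) ^ (i2 + j2)
            * of_nat (i2 choose l1) * of_nat (j2 choose l2)
            * t00 \<rho> n (i1 + l1) (j1 + l2))"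
      unfolding inv e[THEN conjunct1] e[THEN conjunct2] cand_vtx t cand_ee_def ext_even_def
      by (simp add: sum_distrib_left power_add mult_ac)
  next
    assume e: "\<epsilon>i = 1 \<and> \<epsilon>j = 0"
    have "ext_odd (\<lambda>i. ext_even (\<lambda>j. T10 n i j) j1 j2) i1 i2
       = (\<Sum>l1\<le>i1. \<Sum>l2\<le>j2. (- 1) ^ (i2 + j2) * (- 1) ^ l1
            * ((of_nat i2 - 1 + of_nat l1) gchoose l1) * of_nat (j2 choose l2)
            * t10 \<rho> n (i1 - l1) (j1 + l2))"
      unfolding t ext_even_def ext_odd_def by (simp add: sum_distrib_left power_add mult_ac)
    \<comment> \<open>the condition on the coordinate sums is stronger than \<open>i2 < j2\<close>, but the binomial coefficient
      vanishes where the two differ\<close>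
    moreover have "source_term i1 i2 j1 j2 = (- 1) ^ (i2 + j2) * of_bool (x1 \<ge> y1) * of_bool (x1 + x2 < y1 + y2)
            * ((of_nat j2 - of_nat i2 - 1) gchoose (i1 - j1))"
    proof (cases "i1 \<ge> j1 \<and> i2 < j2")
      case True
      have xy: "x1 \<ge> y1" "x1 + x2 < y1 + y2 \<longleftrightarrow> i1 + i2 < j1 + j2"
        using assms(4,5) e True by auto
      have g: "(of_nat j2 - of_nat i2 - 1 :: complex) gchoose (i1 - j1) = of_nat ((j2 - i2 - 1) choose (i1 - j1))"
        using True by (simp add: binomial_gbinomial of_nat_diff diff_diff_eq add.commute)
      have "of_nat ((j2 - i2 - 1) choose (i1 - j1)) = (0 :: complex)" if "\<not> i1 + i2 < j1 + j2"
      proof -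
        have "j2 - i2 - 1 < i1 - j1" using that True by linarith
        then show ?thesis by (simp add: binomial_eq_0)
      qed
      then show ?thesis unfolding source_term_def g xy(2) using xy(1) True by (cases "i1 + i2 < j1 + j2") simp_all
    next
      case False
      then show ?thesis using assms(4,5) e by (auto simp: source_term_def)
    qed
    ultimately show "kasteleyn_inv n (x1, x2) (y1, y2) =
         (\<Sum>l1\<le>i1. \<Sum>l2\<le>j2. (- 1) ^ (i2 + j2) * (- 1) ^ l1
            * ((of_nat i2 - 1 + of_nat l1) gchoose l1) * of_nat (j2 choose l2)
            * t10 \<rho> n (i1 - l1) (j1 + l2))
         - (- 1) ^ (i2 + j2) * of_bool (x1 \<ge> y1) * of_bool (x1 + x2 < y1 + y2)
            * ((of_nat j2 - of_nat i2 - 1) gchoose (i1 - j1))"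
      unfolding inv e[THEN conjunct1] e[THEN conjunct2] cand_vtx cand_oe_def by simp
  qed
qed

end
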